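(* Let $\mathbb X=(X,\tau,\mathsf d,\mathfrak m)$ be an extended metric-topological measure space and $q\in(1,\infty)$. Let $\pi\in\mathcal T_q(\mathbb X)$ be a $\mathcal T_q$-test plan and let $\hat\pi=\pi\otimes\mathscr L_1\in\mathcal M_+(\mathrm{RA}(X,\mathsf d)\times[0,1])$, where $\mathscr L_1$ is the Lebesgue measure on $[0,1]$. Then for any $f\in\mathrm{Lip}_b(X,\tau,\mathsf d)$ we have that $$\hat{\mathsf e}_\#(\mathrm D_f^+\hat\pi),\ \hat{\mathsf e}_\#(\mathrm D_f^-\hat\pi)\ll\mathfrak m,\qquad b_\pi(f):=\frac{d\hat{\mathsf e}_\#(\mathrm D_f^+\hat\pi)}{d\mathfrak m}-\frac{d\hat{\mathsf e}_\#(\mathrm D_f^-\hat\pi)}{d\mathfrak m}\in L^q(\mathfrak m),$$ where $\mathrm D_f^+$ and $\mathrm D_f^-$ denote the positive and negative parts of $\mathrm D_f$. Moreover, the resulting map $b_\pi\colon\mathrm{Lip}_b(X,\tau,\mathsf d)\to L^q(\mathfrak m)$ belongs to $\mathrm{Der}^q_q(\mathbb X)$ and it holds that $$|b_\pi|\leq h_\pi,\qquad\mathrm{div}(b_\pi)=\frac{d(\hat{\mathsf e}_0)_\#\pi}{d\mathfrak m}-\frac{d(\hat{\mathsf e}_1)_\#\pi}{d\mathfrak m}.$$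
   Context: An extended distance on a set $X$ is a symmetric function $\mathsf d\colon X\times X\to[0,+\infty]$ satisfying the triangle inequality and with $\mathsf d(x,y)=0$ iff $x=y$. For $f\colon X\to\mathbb R$ and $A\subseteq X$, $\mathrm{Lip}(f,A,\mathsf d)=\sup\{|f(x)-f(y)|/\mathsf d(x,y):x,y\in A,\ x\neq y\}$ (with $c/(+\infty)=0$, $\sup\varnothing=0$), $\mathrm{Lip}(f,\mathsf d)=\mathrm{Lip}(f,X,\mathsf d)$. $\mathrm{Lip}_b(X,\tau,\mathsf d)$ is the algebra of bounded $\tau$-continuous $\mathsf d$-Lipschitz functions $f\colon X\to\mathbb R$. $(X,\tau,\mathsf d)$ is an extended metric-topological space if $\tau$ is Hausdorff, $\mathsf d$ is an extended distance, $\tau$ is the initial topology of $\mathrm{Lip}_b(X,\tau,\mathsf d)$, and $\mathsf d(x,y)=\sup\{|f(x)-f(y)|:f\in\mathrm{Lip}_b(X,\tau,\mathsf d),\ \mathrm{Lip}(f,\mathsf d)\leq 1\}$ for all $x,y$. It becomes an extended metric-topological measure space when equipped with a finite Radon (inner regular with respect to $\tau$-compact sets) measure $\mathfrak m$ on the Borel sets of $\tau$. $\mathcal M_+(Y)$ denotes the finite Radon measures on a Hausdorff space $Y$. The asymptotic slope of $f\in\mathrm{Lip}_b(X,\tau,\mathsf d)$ is $\mathrm{lip}_{\mathsf d}(f)(x)=\inf\{\mathrm{Lip}(f,U,\mathsf d):x\in U\in\tau\}$. $L^0(\mathfrak m)$ is the algebra of real-valued $\tau$-Borel functions up to $\mathfrak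 m$-a.e. equality. Derivations: a Lipschitz derivation on $\mathbb X$ is a linear map $b\colon\mathrm{Lip}_b(X,\tau,\mathsf d)\to L^0(\mathfrak m)$ with $b(fg)=f\,b(g)+g\,b(f)$ for all $f,g$. $b$ has divergence if $b(f)\in L^1(\mathfrak m)$ for every $f$ and there is a (unique) $\mathrm{div}(b)\in L^1(\mathfrak m)$ with $\int b(f)\,d\mathfrak m=-\int f\,\mathrm{div}(b)\,d\mathfrak m$ for every $f\in\mathrm{Lip}_b(X,\tau,\mathsf d)$. $\mathrm{Der}^q(\mathbb X)$ is the set of Lipschitz derivations $b$ for which there is $g\in L^q(\mathfrak m)$, $g\geq 0$, with $|b(f)|\leq g\,\mathrm{lip}_{\mathsf d}(f)$ $\mathfrak m$-a.e. for every $f$; $|b|$ is the $\mathfrak m$-essential infimum of all such $g$. $\mathrm{Der}^q_q(\mathbb X)$ is the set of $b\in\mathrm{Der}^q(\mathbb X)$ having divergence with $\mathrm{div}(b)\in L^q(\mathfrak m)$. Rectifiable arcs: equip $C([0,1];(X,\tau))$ with the compact-open topology $\tau_C$. For $\gamma,\sigma\in C([0,1];(X,\tau))$ write $\gamma\sim\sigma$ if $\gamma\circ\phi_\gamma=\sigma\circ\phi_\sigma$ for some continuous, non-decreasing, surjective maps $\phi_\gamma,\phi_\sigma\colon[0,1]\to[0,1]$; equip the quotient $\mathrm A(X,\tau)$ with the quotient topology $\tau_{\mathrm A}$. $\mathrm{RA}(X,\mathsf d)\subseteq\mathrm A(X,\tau)$ is the set of classes $[\gamma]$ of $\mathsf d$-continuous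 curves $\gamma$ with finite $\mathsf d$-length $\ell(\gamma)$ (total variation), with the topology induced by $\tau_{\mathrm A}$; $\mathrm{RA}(X,\mathsf d)\times[0,1]$ has the product topology. Each $\gamma\in\mathrm{RA}(X,\mathsf d)$ has a well-defined length $\ell(\gamma)$ and a unique constant $\mathsf d$-speed representative $R_\gamma\colon[0,1]\to X$, i.e. the variation of $R_\gamma$ on $[0,t]$ equals $\ell(\gamma)t$ for every $t\in[0,1]$. Set $\hat{\mathsf e}_t(\gamma)=\hat{\mathsf e}(\gamma,t)=R_\gamma(t)$, $\int_\gamma f=\ell(\gamma)\int_0^1 f(R_\gamma(t))\,dt$ for bounded Borel $f$, and, for $f\in\mathrm{Lip}_b(X,\tau,\mathsf d)$, $\mathrm D_f(\gamma,t)=\limsup_{h\to0}\frac{f(R_\gamma(t+h))-f(R_\gamma(t))}{h}$ for $(\gamma,t)\in\mathrm{RA}(X,\mathsf d)\times[0,1]$ (over $h\ne 0$ with $t+h\in[0,1]$). The maps $\hat{\mathsf e}$ and $\mathrm D_f$ are universally Lusin measurable (for every finite Radon measure $\mu$ on $\mathrm{RA}(X,\mathsf d)\times[0,1]$ and $\varepsilon>0$ they are continuous when restricted to some compact set whose complement has $\mu$-measure at most $\varepsilon$), so the push-forwards are meaningful. $\mathcal T_q$-test plans: a dynamic plan is $\pi\in\mathcal M_+(\mathrm{RA}(X,\mathsf d),\tau_{\mathrm A})$ with $\int\ell(\gamma)\,d\pi(\gamma)<+\infty$; its barycenter is the unique $\mu_\pi\in\mathcal M_+(X,\tau)$ with $\int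 f\,d\mu_\pi=\int(\int_\gamma f)\,d\pi(\gamma)$ for all bounded Borel $f$. It is a $\mathcal T_q$-test plan if $\mu_\pi\ll\mathfrak m$ with $h_\pi:=\frac{d\mu_\pi}{d\mathfrak m}\in L^q(\mathfrak m)$, and $(\hat{\mathsf e}_0)_\#\pi,(\hat{\mathsf e}_1)_\#\pi\ll\mathfrak m$ with densities in $L^q(\mathfrak m)$; $\mathcal T_q(\mathbb X)$ is the set of such plans. *)

theory Defs
  imports "HOL-Analysis.Analysis"
begin

section \<open>Extended metric-topological measure spaces\<close>

text \<open>The set \<open>X\<close> with its topology \<open>\<tau>\<close> is a type of class \<^class>\<open>topological_space\<close>
  (\<^class>\<open>t2_space\<close> when \<open>\<tau>\<close> is Hausdorff). Division on \<^typ>\<open>ennreal\<close> satisfies \<open>c / \<infinity> = 0\<close>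
  for finite \<open>c\<close>, and the supremum of the empty set is \<open>0\<close>.\<close>

definition extended_distance :: "('a \<Rightarrow> 'a \<Rightarrow> ennreal) \<Rightarrow> bool" where
  "extended_distance d \<longleftrightarrow>
     (\<forall>x y. d x y = d y x) \<and>
     (\<forall>x y z. d x z \<le> d x y + d y z) \<and>
     (\<forall>x y. d x y = 0 \<longleftrightarrow> x = y)"

definition Lip :: "('a \<Rightarrow> 'a \<Rightarrow> ennreal) \<Rightarrow> 'a set \<Rightarrow> ('a \<Rightarrow> real) \<Rightarrow> ennreal" where
  "Lip d A f = Sup {ennreal \<bar>f x - f y\<bar> / d x y | x y. x \<in> A \<and> y \<in> A \<and> x \<noteq> y}"

definition Lipb :: "('a::topological_space \<Rightarrow> 'a \<Rightarrow> ennreal) \<Rightarrow> ('a \<Rightarrow> real) set" where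
  "Lipb d = {f. bounded (range f) \<and> continuous_on UNIV f \<and> Lip d UNIV f < \<infinity>}"

definition asymptotic_slope ::
    "('a::topological_space \<Rightarrow> 'a \<Rightarrow> ennreal) \<Rightarrow> ('a \<Rightarrow> real) \<Rightarrow> 'a \<Rightarrow> ennreal" where
  "asymptotic_slope d f x = (INF U\<in>{U. open U \<and> x \<in> U}. Lip d U f)"

definition ext_metric_top_space :: "('a::t2_space \<Rightarrow> 'a \<Rightarrow> ennreal) \<Rightarrow> bool" where
  "ext_metric_top_space d \<longleftrightarrow>
     extended_distance d \<and>
     (open :: 'a set \<Rightarrow> bool) = generate_topology {f -` V | f V. f \<in> Lipb d \<and> open V} \<and>
     (\<forall>x y. d x y = (SUP f\<in>{f \<in> Lipb d. Lip d UNIV f \<le> 1}. ennreal \<bar>f x - f y\<bar>))"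

definition radon_measures :: "'a topology \<Rightarrow> 'a measure set" where
  "radon_measures T = {\<mu>.
     space \<mu> = topspace T \<and>
     sets \<mu> = sigma_sets (topspace T) {U. openin T U} \<and>
     finite_measure \<mu> \<and>
     (\<forall>B\<in>sets \<mu>. emeasure \<mu> B = (SUP K\<in>{K. compactin T K \<and> K \<subseteq> B}. emeasure \<mu> K))}"

definition ext_metric_top_measure_space ::
    "('a::t2_space \<Rightarrow> 'a \<Rightarrow> ennreal) \<Rightarrow> 'a measure \<Rightarrow> bool" where
  "ext_metric_top_measure_space d m \<longleftrightarrow> ext_metric_top_space d \<and> m \<in> radon_measures euclidean"

section \<open>Derivations\<close>

text \<open>Elements of \<open>L\<^sup>0(m)\<close> are represented by Borel functions; all identities between them
  are required to hold almost everywhere.\<close>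

definition Lq :: "'a measure \<Rightarrow> real \<Rightarrow> ('a \<Rightarrow> real) set" where
  "Lq m q = {g \<in> borel_measurable m. integrable m (\<lambda>x. \<bar>g x\<bar> powr q)}"

definition lipschitz_derivation ::
    "('a::topological_space \<Rightarrow> 'a \<Rightarrow> ennreal) \<Rightarrow> 'a measure \<Rightarrow> (('a \<Rightarrow> real) \<Rightarrow> 'a \<Rightarrow> real) \<Rightarrow> bool" where
  "lipschitz_derivation d m b \<longleftrightarrow>
     (\<forall>f\<in>Lipb d. b f \<in> borel_measurable m) \<and>
     (\<forall>f\<in>Lipb d. \<forall>g\<in>Lipb d. AE x in m. b (\<lambda>y. f y + g y) x = b f x + b g x) \<and>
     (\<forall>c. \<forall>f\<in>Lipb d. AE x in m. b (\<lambda>y. c * f y) x = c * b f x) \<and>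
     (\<forall>f\<in>Lipb d. \<forall>g\<in>Lipb d. AE x in m. b (\<lambda>y. f y * g y) x = f x * b g x + g x * b f x)"

text \<open>\<open>has_divergence d m b v\<close> says that \<open>b\<close> has divergence and \<open>v\<close> represents \<open>div(b)\<close>.\<close>

definition has_divergence ::
    "('a::topological_space \<Rightarrow> 'a \<Rightarrow> ennreal) \<Rightarrow> 'a measure \<Rightarrow> (('a \<Rightarrow> real) \<Rightarrow> 'a \<Rightarrow> real) \<Rightarrow>
     ('a \<Rightarrow> real) \<Rightarrow> bool" where
  "has_divergence d m b v \<longleftrightarrow>
     (\<forall>f\<in>Lipb d. integrable m (b f)) \<and>
     integrable m v \<and>
     (\<forall>f\<in>Lipb d. (\<integral>x. b f x \<partial>m) = - (\<integral>x. f x * v x \<partial>m))"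

definition der_bounds ::
    "('a::topological_space \<Rightarrow> 'a \<Rightarrow> ennreal) \<Rightarrow> 'a measure \<Rightarrow> real \<Rightarrow> (('a \<Rightarrow> real) \<Rightarrow> 'a \<Rightarrow> real) \<Rightarrow>
     ('a \<Rightarrow> real) set" where
  "der_bounds d m q b = {g \<in> Lq m q.
     (AE x in m. 0 \<le> g x) \<and>
     (\<forall>f\<in>Lipb d. AE x in m. ennreal \<bar>b f x\<bar> \<le> ennreal (g x) * asymptotic_slope d f x)}"

definition Der ::
    "('a::topological_space \<Rightarrow> 'a \<Rightarrow> ennreal) \<Rightarrow> 'a measure \<Rightarrow> real \<Rightarrow>
     (('a \<Rightarrow> real) \<Rightarrow> 'a \<Rightarrow> real) set" where
  "Der d m q = {b. lipschitz_derivation d m b \<and> der_bounds d m q b \<noteq> {}}"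

definition Der_div ::
    "('a::topological_space \<Rightarrow> 'a \<Rightarrow> ennreal) \<Rightarrow> 'a measure \<Rightarrow> real \<Rightarrow>
     (('a \<Rightarrow> real) \<Rightarrow> 'a \<Rightarrow> real) set" where
  "Der_div d m q = {b \<in> Der d m q. \<exists>v\<in>Lq m q. has_divergence d m b v}"

definition is_ess_Inf :: "'a measure \<Rightarrow> ('a \<Rightarrow> real) set \<Rightarrow> ('a \<Rightarrow> real) \<Rightarrow> bool" where
  "is_ess_Inf m G u \<longleftrightarrow>
     u \<in> borel_measurable m \<and>
     (\<forall>g\<in>G. AE x in m. u x \<le> g x) \<and>
     (\<forall>w\<in>borel_measurable m. (\<forall>g\<in>G. AE x in m. w x \<le> g x) \<longrightarrow> (AE x in m. w x \<le> u x))"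

text \<open>The pointwise norm \<open>|b|\<close>; the choice is unique up to almost everywhere equality.\<close>

definition der_norm ::
    "('a::topological_space \<Rightarrow> 'a \<Rightarrow> ennreal) \<Rightarrow> 'a measure \<Rightarrow> real \<Rightarrow> (('a \<Rightarrow> real) \<Rightarrow> 'a \<Rightarrow> real) \<Rightarrow>
     'a \<Rightarrow> real" where
  "der_norm d m q b = (SOME u. is_ess_Inf m (der_bounds d m q b) u)"

section \<open>Rectifiable arcs\<close>

text \<open>Curves are functions on \<^typ>\<open>real\<close> made extensional outside \<open>[0,1]\<close>, so that equality of
  curves is equality on \<open>[0,1]\<close>.\<close>

definition curves :: "(real \<Rightarrow> 'a::topological_space) set" where
  "curves = {\<gamma> \<in> extensional {0..1}. continuous_on {0..1} \<gamma>}"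

definition curve_topology :: "(real \<Rightarrow> 'a::topological_space) topology" where
  "curve_topology = topology_generated_by
     {{\<gamma> \<in> curves. \<gamma> ` K \<subseteq> V} | K V. compact K \<and> K \<subseteq> {0..1} \<and> open V}"

definition reparametrizations :: "(real \<Rightarrow> real) set" where
  "reparametrizations =
     {\<phi>. continuous_on {0..1} \<phi> \<and> mono_on {0..1} \<phi> \<and> \<phi> ` {0..1} = {0..1}}"

definition curve_rel :: "((real \<Rightarrow> 'a::topological_space) \<times> (real \<Rightarrow> 'a)) set" where
  "curve_rel = {(\<gamma>, \<sigma>). \<gamma> \<in> curves \<and> \<sigma> \<in> curves \<and>
     (\<exists>\<phi>\<in>reparametrizations. \<exists>\<psi>\<in>reparametrizations. \<forall>t\<in>{0..1}. \<gamma> (\<phi> t) = \<sigma> (\<psi> t))}"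

definition quotient_topology :: "'a topology \<Rightarrow> ('a \<times> 'a) set \<Rightarrow> 'a set topology" where
  "quotient_topology T r =
     topology (\<lambda>U. U \<subseteq> topspace T // r \<and> openin T {x \<in> topspace T. r `` {x} \<in> U})"

lemma openin_quotient_topology:
  "openin (quotient_topology T r) U \<longleftrightarrow>
     U \<subseteq> topspace T // r \<and> openin T {x \<in> topspace T. r `` {x} \<in> U}"
proof -
  let ?P = "\<lambda>U. U \<subseteq> topspace T // r \<and> openin T {x \<in> topspace T. r `` {x} \<in> U}"
  have "istopology ?P"
    unfolding istopology_def
  proof (intro conjI allI impI)
    fix S S' assume *: "?P S" "?P S'"
    show "S \<inter> S' \<subseteq> topspace T // r" using * by blast
    have "{x \<in> topspace T. r `` {x} \<in> S \<inter> S'} =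
        {x \<in> topspace T. r `` {x} \<in> S} \<inter> {x \<in> topspace T. r `` {x} \<in> S'}" by blast
    then show "openin T {x \<in> topspace T. r `` {x} \<in> S \<inter> S'}" using * by auto
  next
    fix \<K> assume *: "\<forall>K\<in>\<K>. ?P K"
    show "\<Union>\<K> \<subseteq> topspace T // r" using * by blast
    have "{x \<in> topspace T. r `` {x} \<in> \<Union>\<K>} = (\<Union>K\<in>\<K>. {x \<in> topspace T. r `` {x} \<in> K})" by blast
    then show "openin T {x \<in> topspace T. r `` {x} \<in> \<Union>\<K>}" using * by auto
  qed
  then show ?thesis
    unfolding quotient_topology_def by (simp add: topology_inverse')
qed

definition arc_topology :: "(real \<Rightarrow> 'a::topological_space) set topology" where
  "arc_topology = quotient_topology curve_topology curve_rel"

definition variation ::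
    "('a \<Rightarrow> 'a \<Rightarrow> ennreal) \<Rightarrow> (real \<Rightarrow> 'a) \<Rightarrow> real \<Rightarrow> real \<Rightarrow> ennreal" where
  "variation d \<gamma> a b = Sup {(\<Sum>i<n. d (\<gamma> (t i)) (\<gamma> (t (Suc i)))) | n t.
     mono_on {..n} t \<and> t ` {..n} \<subseteq> {a..b}}"

definition d_continuous :: "('a \<Rightarrow> 'a \<Rightarrow> ennreal) \<Rightarrow> (real \<Rightarrow> 'a) \<Rightarrow> bool" where
  "d_continuous d \<gamma> \<longleftrightarrow>
     (\<forall>t\<in>{0..1}. ((\<lambda>s. d (\<gamma> s) (\<gamma> t)) \<longlongrightarrow> 0) (at t within {0..1}))"

definition RA :: "('a::topological_space \<Rightarrow> 'a \<Rightarrow> ennreal) \<Rightarrow> (real \<Rightarrow> 'a) set set" where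
  "RA d = {curve_rel `` {\<gamma>} | \<gamma>. \<gamma> \<in> curves \<and> d_continuous d \<gamma> \<and> variation d \<gamma> 0 1 < \<infinity>}"

definition RA_topology ::
    "('a::topological_space \<Rightarrow> 'a \<Rightarrow> ennreal) \<Rightarrow> (real \<Rightarrow> 'a) set topology" where
  "RA_topology d = subtopology arc_topology (RA d)"

text \<open>The length of an arc is that of any representative.\<close>

definition arc_length ::
    "('a \<Rightarrow> 'a \<Rightarrow> ennreal) \<Rightarrow> (real \<Rightarrow> 'a) set \<Rightarrow> ennreal" where
  "arc_length d \<Gamma> = variation d (SOME \<gamma>. \<gamma> \<in> \<Gamma>) 0 1"

definition arc_rep :: "('a \<Rightarrow> 'a \<Rightarrow> ennreal) \<Rightarrow> (real \<Rightarrow> 'a) set \<Rightarrow> real \<Rightarrow> 'a" where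
  "arc_rep d \<Gamma> =
     (THE R. R \<in> \<Gamma> \<and> (\<forall>t\<in>{0..1}. variation d R 0 t = arc_length d \<Gamma> * ennreal t))"

definition ehat :: "('a \<Rightarrow> 'a \<Rightarrow> ennreal) \<Rightarrow> (real \<Rightarrow> 'a) set \<times> real \<Rightarrow> 'a" where
  "ehat d = (\<lambda>(\<Gamma>, t). arc_rep d \<Gamma> t)"

definition arc_integral ::
    "('a \<Rightarrow> 'a \<Rightarrow> ennreal) \<Rightarrow> (real \<Rightarrow> 'a) set \<Rightarrow> ('a \<Rightarrow> real) \<Rightarrow> real" where
  "arc_integral d \<Gamma> f = enn2real (arc_length d \<Gamma>) * (LBINT t:{0..1}. f (arc_rep d \<Gamma> t))"

text \<open>The upper limit is finite for \<open>f \<in> Lipb d\<close> and \<open>\<Gamma> \<in> RA d\<close>, since \<open>f\<close> is then Lipschitz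
  along \<open>arc_rep d \<Gamma>\<close>.\<close>

definition Dupper ::
    "('a \<Rightarrow> 'a \<Rightarrow> ennreal) \<Rightarrow> ('a \<Rightarrow> real) \<Rightarrow> (real \<Rightarrow> 'a) set \<times> real \<Rightarrow> real" where
  "Dupper d f = (\<lambda>(\<Gamma>, t). real_of_ereal
     (Limsup (at 0 within {h. t + h \<in> {0..1}})
        (\<lambda>h. ereal ((f (arc_rep d \<Gamma> (t + h)) - f (arc_rep d \<Gamma> t)) / h))))"

section \<open>Test plans\<close>

text \<open>Maps on arcs that are only universally Lusin measurable need not be Borel, but they are
  measurable for the completion of every finite Radon measure. Integrals and push-forwards of
  such maps are therefore taken with respect to the completion, which changes nothing in the
  Borel case.\<close>

definition dynamic_plans ::
    "('a::topological_space \<Rightarrow> 'a \<Rightarrow> ennreal) \<Rightarrow> (real \<Rightarrow> 'a) set measure set" where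
  "dynamic_plans d = {\<pi> \<in> radon_measures (RA_topology d). (\<integral>\<^sup>+\<Gamma>. arc_length d \<Gamma> \<partial>\<pi>) < \<infinity>}"

definition barycenter ::
    "('a::topological_space \<Rightarrow> 'a \<Rightarrow> ennreal) \<Rightarrow> (real \<Rightarrow> 'a) set measure \<Rightarrow> 'a measure" where
  "barycenter d \<pi> = (THE \<mu>. \<mu> \<in> radon_measures euclidean \<and>
     (\<forall>f\<in>borel_measurable borel. bounded (range f) \<longrightarrow>
        (\<integral>x. f x \<partial>\<mu>) = (\<integral>\<Gamma>. arc_integral d \<Gamma> f \<partial>completion \<pi>)))"

definition endpoint_law ::
    "('a::topological_space \<Rightarrow> 'a \<Rightarrow> ennreal) \<Rightarrow> (real \<Rightarrow> 'a) set measure \<Rightarrow> real \<Rightarrow> 'a measure" where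
  "endpoint_law d \<pi> t = distr (completion \<pi>) borel (\<lambda>\<Gamma>. ehat d (\<Gamma>, t))"

text \<open>A real-valued version of the Radon-Nikodym derivative \<open>d\<nu>/dm\<close>, meant for finite
  \<open>\<nu> \<lless> m\<close>, for which \<^const>\<open>RN_deriv\<close> is finite almost everywhere.\<close>

definition real_deriv :: "'a measure \<Rightarrow> 'a measure \<Rightarrow> 'a \<Rightarrow> real" where
  "real_deriv m \<nu> = (\<lambda>x. enn2real (RN_deriv m \<nu> x))"

definition plan_density ::
    "('a::topological_space \<Rightarrow> 'a \<Rightarrow> ennreal) \<Rightarrow> 'a measure \<Rightarrow> (real \<Rightarrow> 'a) set measure \<Rightarrow> 'a \<Rightarrow> real" where
  "plan_density d m \<pi> = real_deriv m (barycenter d \<pi>)"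

definition test_plans ::
    "('a::topological_space \<Rightarrow> 'a \<Rightarrow> ennreal) \<Rightarrow> 'a measure \<Rightarrow> real \<Rightarrow>
     (real \<Rightarrow> 'a) set measure set" where
  "test_plans d m q = {\<pi> \<in> dynamic_plans d.
     absolutely_continuous m (barycenter d \<pi>) \<and> plan_density d m \<pi> \<in> Lq m q \<and>
     (\<forall>t\<in>{0, 1}. absolutely_continuous m (endpoint_law d \<pi> t) \<and>
        real_deriv m (endpoint_law d \<pi> t) \<in> Lq m q)}"

text \<open>Since \<open>[0,1]\<close> is second countable, the Borel sigma-algebra of the product topology on
  \<open>RA d \<times> [0,1]\<close> is the product of the Borel sigma-algebras, so the measure \<open>\<pi> \<otimes> L\<^sub>1\<close> on Borel
  sets is the library's product measure.\<close>

definition plan_hat :: "(real \<Rightarrow> 'a) set measure \<Rightarrow> ((real \<Rightarrow> 'a) set \<times> real) measure" where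
  "plan_hat \<pi> = \<pi> \<Otimes>\<^sub>M restrict_space lborel {0..1}"

definition push_weighted ::
    "('a::topological_space \<Rightarrow> 'a \<Rightarrow> ennreal) \<Rightarrow> (real \<Rightarrow> 'a) set measure \<Rightarrow>
     ((real \<Rightarrow> 'a) set \<times> real \<Rightarrow> real) \<Rightarrow> 'a measure" where
  "push_weighted d \<pi> w =
     distr (density (completion (plan_hat \<pi>)) (\<lambda>p. ennreal (w p))) borel (ehat d)"

definition push_Dpos ::
    "('a::topological_space \<Rightarrow> 'a \<Rightarrow> ennreal) \<Rightarrow> (real \<Rightarrow> 'a) set measure \<Rightarrow> ('a \<Rightarrow> real) \<Rightarrow> 'a measure" where
  "push_Dpos d \<pi> f = push_weighted d \<pi> (\<lambda>p. max 0 (Dupper d f p))"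

definition push_Dneg ::
    "('a::topological_space \<Rightarrow> 'a \<Rightarrow> ennreal) \<Rightarrow> (real \<Rightarrow> 'a) set measure \<Rightarrow> ('a \<Rightarrow> real) \<Rightarrow> 'a measure" where
  "push_Dneg d \<pi> f = push_weighted d \<pi> (\<lambda>p. max 0 (- Dupper d f p))"

definition plan_derivation ::
    "('a::topological_space \<Rightarrow> 'a \<Rightarrow> ennreal) \<Rightarrow> 'a measure \<Rightarrow> (real \<Rightarrow> 'a) set measure \<Rightarrow>
     ('a \<Rightarrow> real) \<Rightarrow> 'a \<Rightarrow> real" where
  "plan_derivation d m \<pi> f =
     (\<lambda>x. real_deriv m (push_Dpos d \<pi> f) x - real_deriv m (push_Dneg d \<pi> f) x)"

end

theory Submission
  imports Defs
begin

text \<open>Along an arc \<open>R\<close> of length \<open>l\<close> a function \<open>f \<in> Lipb d\<close> is Lipschitz, hence differentiable almost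
  everywhere, with \<open>\<bar>(f \<circ> R)'\<bar> \<le> l * lip f\<close>. Integrating this over the plan, the push-forward of the
  positive and negative part of the derivative is dominated by \<open>lip f\<close> times the barycenter, that is, by
  \<open>h * lip f * m\<close>; this gives absolute continuity and \<open>\<bar>b\<bar> \<le> h\<close>. The sum and Leibniz rules hold where
  the derivatives exist, and the fundamental theorem of calculus on every arc gives the divergence.

  No Lusin-type argument is needed, because the evaluation map is Borel: \<open>R t \<in> V\<close>, for open \<open>V\<close>, means
  that some portion of the arc runs inside \<open>V\<close>, preceded by more than \<open>l * t\<close> and followed by more than
  \<open>l * (1 - t)\<close> of length up to its ends, and after replacing these two bounds by rational numbers this
  is a countable union of conditions that are invariant under reparametrization and open (as the
  length is lower semicontinuous). The barycenter is the push-forward, under evaluation, of the plan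
  weighted by length, and is Radon because portions of arcs depend upper semicontinuously on the arc.\<close>

section \<open>Almost everywhere differentiability of Lipschitz functions on the line\<close>

text \<open>The obstacle is that the constant speed representative depends discontinuously on the
  arc, because length is only lower semicontinuous, while \<tau> need be neither metrizable nor
  second countable: measurability of evaluation comes neither from limits of simpler maps nor from a
  countable base, and each open set has to be treated directly. An upper bound on the length
  travelled before a given point is not an open condition. For that reason a point of an arc is
  located by two lower bounds, on the length already travelled and on the length still to come, both
  stable under small perturbations. What remains, the comparison of the two rational bounds with
  \<open>l * t\<close> and \<open>l * (1 - t)\<close>, is Borel in the pair of arc and time. The
  same bounds return in the proof of inner regularity, which is needed because the barycenter is
  singled out among Radon measures. Differentiability is used arc by arc and for almost every time
  only; Fubini turns it into a statement on pairs, for which the upper derivative must be jointly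
  measurable, and this rests on rational times alone.\<close>

lemma le_if_locally_increasing:
  fixes F :: "real \<Rightarrow> real"
  assumes "a \<le> b" and cont: "continuous_on {a..b} F"
    and step: "\<And>x. a \<le> x \<Longrightarrow> x < b \<Longrightarrow> \<exists>y. x < y \<and> y \<le> b \<and> F x \<le> F y"
  shows "F a \<le> F b"
proof -
  \<comment> \<open>Continuity makes \<open>S\<close> compact, and its largest element can be pushed
    to the right unless it is \<open>b\<close>. One later point \<open>y\<close> is enough for this,
    so the argument suits one-sided lower and upper derivatives, which provide no full
    neighbourhood.\<close>
  define S where "S = {x \<in> {a..b}. F a \<le> F x}"
  have "closed S"
    unfolding S_def using cont
    by (intro continuous_on_closed_Collect_le continuous_on_const) auto
  then have "compact S"
    by (metis (no_types, lifting) S_def bounded_closed_interval bounded_subset compact_eq_bounded_closed mem_Collect_eq subsetI)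
  moreover have "S \<noteq> {}"
    using \<open>a \<le> b\<close> unfolding S_def by force
  ultimately obtain x where x: "x \<in> S" "\<And>y. y \<in> S \<Longrightarrow> y \<le> x"
    using compact_attains_sup by metis
  have "x = b"
  proof (rule ccontr)
    assume "x \<noteq> b"
    then obtain y where "x < y" "y \<le> b" "F x \<le> F y"
      using step[of x] x(1) unfolding S_def by auto
    then have "y \<in> S"
      using x(1) unfolding S_def by auto
    then show False
      using x(2) \<open>x < y\<close> by fastforce
  qed
  then show ?thesis
    using x(1) unfolding S_def by simp
qed

text \<open>The sum counts the levels \<open>k * \<epsilon>\<close> not above \<open>y\<close>, that
  is, the floor of \<open>y / \<epsilon>\<close> plus one, because level 0 counts as well; the bound
  \<open>y < real N * \<epsilon>\<close> ensures that cutting the sum at \<open>N\<close> loses no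
  level.\<close>

lemma layer_cake_bounds:
  fixes y \<epsilon> :: real
  assumes "0 \<le> y" "y < real N * \<epsilon>" "0 < \<epsilon>"
  shows "y \<le> \<epsilon> * (\<Sum>k<N. of_bool (real k * \<epsilon> \<le> y))"
    and "\<epsilon> * (\<Sum>k<N. of_bool (real k * \<epsilon> \<le> y)) \<le> y + \<epsilon>"
proof -
  define j where "j = nat \<lfloor>y / \<epsilon>\<rfloor>"
  have j: "real j \<le> y / \<epsilon>" "y / \<epsilon> < real j + 1"
    using assms unfolding j_def by (auto simp: of_nat_nat intro: divide_nonneg_pos)
  have "k < N \<and> real k * \<epsilon> \<le> y \<longleftrightarrow> k \<le> j" for k
  proof
    assume "k < N \<and> real k * \<epsilon> \<le> y"
    then have "real k \<le> y / \<epsilon>"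
      using assms by (simp add: field_simps)
    then show "k \<le> j"
      using j by linarith
  next
    assume "k \<le> j"
    then have "real k \<le> y / \<epsilon>"
      using j by linarith
    moreover have "y / \<epsilon> < real N"
      using assms by (simp add: field_simps)
    ultimately show "k < N \<and> real k * \<epsilon> \<le> y"
      using assms by (simp add: field_simps) (metis le_less_trans mult.commute mult_less_cancel_right_pos of_nat_less_iff)
  qed
  then have "{..<N} \<inter> {k. real k * \<epsilon> \<le> y} = {..j}"
    by auto
  then have "(\<Sum>k<N. of_bool (real k * \<epsilon> \<le> y) :: real) = real j + 1"
    by (simp add: sum.If_cases of_bool_def)
  then show "y \<le> \<epsilon> * (\<Sum>k<N. of_bool (real k * \<epsilon> \<le> y))"
    "\<epsilon> * (\<Sum>k<N. of_bool (real k * \<epsilon> \<le> y)) \<le> y + \<epsilon>"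
    using j assms by (simp_all add: field_simps)
qed

text \<open>Connects the gauge integral, whose indefinite integrals are handy on the line, with the
  Lebesgue integral, which carries the almost everywhere statements.\<close>

lemma bounded_borel_integrable_on:
  fixes h :: "real \<Rightarrow> real"
  assumes [measurable]: "h \<in> borel_measurable borel" and "\<And>x. \<bar>h x\<bar> \<le> C"
  shows "h integrable_on {a..b}" and "set_integrable lborel {a..b} h"
    and "(LBINT x:{a..b}. h x) = integral {a..b} h"
proof -
  show s: "set_integrable lborel {a..b} h"
    unfolding set_integrable_def
  proof (rule Bochner_Integration.integrable_bound)
    show "integrable lborel (\<lambda>x. C * indicator {a..b} x)"
      by (intro integrable_mult_right integrable_real_indicator) (auto simp: emeasure_lborel_Icc_eq)
    show "AE x in lborel. norm (indicator {a..b} x *\<^sub>R h x) \<le> norm (C * indicator {a..b} x)"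
      by (intro AE_I2) (auto simp: indicator_def intro: order_trans[OF assms(2) abs_ge_self])
  qed measurable
  show "h integrable_on {a..b}" "(LBINT x:{a..b}. h x) = integral {a..b} h"
    using set_borel_integral_eq_integral[OF s] by auto
qed

text \<open>The function \<open>D\<close> is dominated, up to a small error in the integral, by a lower semicontinuous \<open>u\<close>,
  a layer cake over open sets. Then \<open>x \<mapsto> integral {a..x} u - g x + \<epsilon> * x\<close> increases to the right of every
  point. Applied to \<open>g\<close> and \<open>- g\<close>, this makes upper and lower one-sided derivatives agree almost
  everywhere without a covering theorem.\<close>

lemma lipschitz_increment_le_integral:
  fixes g D :: "real \<Rightarrow> real"
  assumes "a \<le> b" and lip: "\<And>x y. \<bar>g x - g y\<bar> \<le> L * \<bar>x - y\<bar>"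
    and [measurable]: "D \<in> borel_measurable borel" and bd: "\<And>x. \<bar>D x\<bar> \<le> L"
    and quot: "\<And>x \<eta> \<delta>. 0 < \<eta> \<Longrightarrow> 0 < \<delta> \<Longrightarrow>
      \<exists>y. x < y \<and> y < x + \<delta> \<and> g y - g x \<le> (D x + \<eta>) * (y - x)"
  shows "g b - g a \<le> integral {a..b} D"
proof -
  have L0: "0 \<le> L"
    using bd[of 0] by linarith
  \<comment> \<open>The error has three sources: \<open>\<epsilon> * (b - a)\<close> from the slope
    \<open>\<epsilon>\<close> added to \<open>F\<close>, the same amount from the step height of the
    layer cake, and \<open>\<epsilon>\<close> from the open sets being larger than the level
    sets.\<close>
  have main: "g b - g a \<le> integral {a..b} D + \<epsilon> * (2 * (b - a) + 1)" if "0 < \<epsilon>" for \<epsilon>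
  proof -
    obtain N where N: "2 * L / \<epsilon> < real N"
      using reals_Archimedean2 by blast
    then have N: "2 * L < real N * \<epsilon>" and "N > 0"
      using that L0 by (auto simp: field_simps intro!: gr0I)
    \<comment> \<open>\<open>D + L\<close> lies between 0 and \<open>2 * L\<close>, so the
      \<open>N\<close> levels with spacing \<open>\<epsilon>\<close> exhaust its range.\<close>
    define E where "E k = {x \<in> {a..b}. real k * \<epsilon> \<le> D x + L}" for k
    have "E k \<in> sets borel" for k
      unfolding E_def by measurable
    moreover have "emeasure lborel (E k) \<le> emeasure lborel {a..b}" for k
      by (rule emeasure_mono) (auto simp: E_def)
    ultimately have Em: "E k \<in> lmeasurable" for k
      by (intro bounded_set_imp_lmeasurable bounded_subset[OF bounded_closed_interval[of a b]])
        (auto simp: E_def)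
    have "\<exists>U. open U \<and> E k \<subseteq> U \<and> U - E k \<in> lmeasurable \<and> measure lebesgue (U - E k) < 1 / real N" for k
    proof -
      obtain T where T: "open T" "E k \<subseteq> T" "T - E k \<in> lmeasurable"
        "emeasure lebesgue (T - E k) < ennreal (1 / real N)"
        using sets_lebesgue_outer_open[of "E k" "1 / real N"] Em[of k] \<open>N > 0\<close> by auto
      then have "measure lebesgue (T - E k) < 1 / real N"
        by (simp add: emeasure_eq_measure2 ennreal_less_iff)
      then show ?thesis
        using T by blast
    qed
    then obtain U where U: "\<And>k. open (U k)" "\<And>k. E k \<subseteq> U k" "\<And>k. U k - E k \<in> lmeasurable"
      "\<And>k. measure lebesgue (U k - E k) < 1 / real N"
      by metis
    define u where "u x = \<epsilon> * (\<Sum>k<N. indicator (U k) x) - L" for x :: real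
    have [measurable]: "U k \<in> sets borel" for k
      using U(1) by auto
    have [measurable]: "u \<in> borel_measurable borel"
      unfolding u_def by measurable
    have ubd: "\<bar>u x\<bar> \<le> \<epsilon> * real N + L" for x
    proof -
      have "0 \<le> (\<Sum>k<N. indicator (U k) x :: real)" "(\<Sum>k<N. indicator (U k) x :: real) \<le> real N"
        using sum_bounded_above[of "{..<N}" "\<lambda>k. indicator (U k) x :: real" 1]
        by (auto intro!: sum_nonneg)
      then have "0 \<le> \<epsilon> * (\<Sum>k<N. indicator (U k) x :: real)" "\<epsilon> * (\<Sum>k<N. indicator (U k) x :: real) \<le> \<epsilon> * real N"
        using that by (auto intro: mult_left_mono)
      then show ?thesis
        unfolding u_def using L0 by linarith
    qed
    have Dle: "D x \<le> u x" if "x \<in> {a..b}" for x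
    proof -
      have "D x + L \<le> \<epsilon> * (\<Sum>k<N. of_bool (real k * \<epsilon> \<le> D x + L))"
        using bd[of x] N \<open>0 < \<epsilon>\<close> by (intro layer_cake_bounds) auto
      also have "\<dots> \<le> \<epsilon> * (\<Sum>k<N. indicator (U k) x)"
        using U(2) that \<open>0 < \<epsilon>\<close>
        by (intro mult_left_mono sum_mono) (auto simp: of_bool_def indicator_def E_def)
      finally show ?thesis
        unfolding u_def by simp
    qed
    \<comment> \<open>Near \<open>x\<close> every \<open>U k\<close> that contains \<open>x\<close>
      is still present, so the sum can only grow.\<close>
    have lsc: "\<exists>\<delta>>0. \<forall>y. \<bar>y - x\<bar> < \<delta> \<longrightarrow> u x \<le> u y" for x
    proof -
      have "open (\<Inter>k\<in>{k. k < N \<and> x \<in> U k}. U k)"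
        using U(1) by auto
      moreover have "x \<in> (\<Inter>k\<in>{k. k < N \<and> x \<in> U k}. U k)"
        by auto
      ultimately obtain \<delta> where "\<delta> > 0" and \<delta>: "\<And>y. dist y x < \<delta> \<Longrightarrow> y \<in> (\<Inter>k\<in>{k. k < N \<and> x \<in> U k}. U k)"
        unfolding open_dist by blast
      have "u x \<le> u y" if "\<bar>y - x\<bar> < \<delta>" for y
        using \<delta>[of y] that \<open>0 < \<epsilon>\<close> unfolding u_def
        by (intro diff_right_mono mult_left_mono sum_mono) (auto simp: indicator_def dist_real_def)
      then show ?thesis
        using \<open>\<delta> > 0\<close> by blast
    qed
    note uint = bounded_borel_integrable_on[OF \<open>u \<in> borel_measurable borel\<close> ubd]
    define F where "F x = integral {a..x} u - g x + \<epsilon> * x" for x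
    have "F a \<le> F b"
    proof (rule le_if_locally_increasing[OF \<open>a \<le> b\<close>])
      have "L-lipschitz_on {a..b} g"
        using lip L0 by (auto simp: lipschitz_on_def dist_real_def)
      then have "continuous_on {a..b} g"
        by (rule lipschitz_on_continuous_on)
      then show "continuous_on {a..b} F"
        unfolding F_def by (intro continuous_intros indefinite_integral_continuous_1 uint)
    next
      fix x assume x: "a \<le> x" "x < b"
      obtain \<delta> where \<delta>: "\<delta> > 0" "\<And>y. \<bar>y - x\<bar> < \<delta> \<Longrightarrow> u x \<le> u y"
        using lsc by blast
      obtain y where y: "x < y" "y < x + min \<delta> (b - x)" "g y - g x \<le> (D x + \<epsilon>) * (y - x)"
        using quot[of \<epsilon> "min \<delta> (b - x)" x] \<open>0 < \<epsilon>\<close> \<delta> x by auto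
      have "integral {a..y} u = integral {a..x} u + integral {x..y} u"
        using x y by (intro Henstock_Kurzweil_Integration.integral_combine[symmetric] uint) auto
      moreover have "u x * (y - x) \<le> integral {x..y} u"
      proof -
        have "integral {x..y} (\<lambda>_. u x) \<le> integral {x..y} u"
          using \<delta> y by (intro integral_le integrable_const_ivl uint) auto
        then show ?thesis
          using y(1) by (simp add: mult.commute)
      qed
      moreover have "D x * (y - x) \<le> u x * (y - x)"
        using Dle[of x] x y by (intro mult_right_mono) auto
      ultimately have "F x \<le> F y"
        unfolding F_def using y(3) by (simp add: algebra_simps)
      then show "\<exists>y. x < y \<and> y \<le> b \<and> F x \<le> F y"
        using y by (intro exI[of _ y]) auto
    qed
    then have 1: "g b - g a \<le> integral {a..b} u + \<epsilon> * (b - a)"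
      unfolding F_def by (simp add: algebra_simps)
    \<comment> \<open>\<open>v\<close> collects the points of the open sets outside the level sets.
      Each of the \<open>N\<close> excess sets has measure below \<open>1 / real N\<close>, so
      \<open>v\<close> integrates to at most \<open>\<epsilon>\<close>.\<close>
    define v where "v x = \<epsilon> * (\<Sum>k<N. indicator (U k - E k) x)" for x :: real
    have vi: "(v has_integral \<epsilon> * (\<Sum>k<N. measure lebesgue (U k - E k))) UNIV"
    proof -
      have "(indicator (U k - E k) has_integral measure lebesgue (U k - E k)) UNIV" for k
        using U(3)[of k] by (simp add: lmeasurable_iff_has_integral)
      then show ?thesis
        unfolding v_def by (intro has_integral_mult_right has_integral_sum) auto
    qed
    have v0: "0 \<le> v x" for x
      unfolding v_def using that by (intro mult_nonneg_nonneg sum_nonneg) auto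
    have vab: "v integrable_on {a..b}"
      using vi by (auto intro: integrable_on_subinterval has_integral_integrable)
    note Dint = bounded_borel_integrable_on[OF \<open>D \<in> borel_measurable borel\<close> bd]
    have "integral {a..b} u \<le> integral {a..b} (\<lambda>x. D x + (\<epsilon> + v x))"
    proof (rule integral_le)
      fix x assume x: "x \<in> {a..b}"
      have "\<epsilon> * (\<Sum>k<N. indicator (U k) x)
          = \<epsilon> * (\<Sum>k<N. of_bool (real k * \<epsilon> \<le> D x + L)) + v x"
        unfolding v_def distrib_left[symmetric] sum.distrib[symmetric]
        using U(2) x by (intro arg_cong[where f="\<lambda>s. \<epsilon> * s"] sum.cong) (auto simp: indicator_def E_def)
      also have "\<epsilon> * (\<Sum>k<N. of_bool (real k * \<epsilon> \<le> D x + L)) \<le> D x + L + \<epsilon>"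
        using bd[of x] N \<open>0 < \<epsilon>\<close> by (intro layer_cake_bounds) auto
      finally show "u x \<le> D x + (\<epsilon> + v x)"
        unfolding u_def by simp
    qed (intro integrable_add Dint vab uint integrable_const_ivl)+
    also have "\<dots> = integral {a..b} D + (\<epsilon> * (b - a) + integral {a..b} v)"
      using \<open>a \<le> b\<close> by (subst Henstock_Kurzweil_Integration.integral_add Dint,
        auto intro!: integrable_add Dint vab simp: Henstock_Kurzweil_Integration.integral_add vab)+
    also have "integral {a..b} v \<le> integral UNIV v"
      using vi v0 vab by (intro integral_subset_le) auto
    also have "integral UNIV v \<le> \<epsilon> * (\<Sum>k<N. 1 / real N)"
      unfolding integral_unique[OF vi] using U(4) that by (intro mult_left_mono sum_mono) (auto intro: less_imp_le)
    also have "\<dots> = \<epsilon>"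
      using \<open>N > 0\<close> by simp
    finally show ?thesis
      using 1 by (simp add: algebra_simps)
  qed
  show ?thesis
  proof (rule field_le_epsilon)
    fix e :: real assume "0 < e"
    have "0 < 2 * (b - a) + 1"
      using \<open>a \<le> b\<close> by simp
    then show "g b - g a \<le> integral {a..b} D + e"
      using main[of "e / (2 * (b - a) + 1)"] \<open>0 < e\<close> by simp
  qed
qed



text \<open>The case \<open>\<sigma> = -1\<close> is the right-sided estimate for the reflected
  function \<open>- g (- x)\<close> on \<open>{- b..- a}\<close>, whose right difference quotients
  are the left ones of \<open>g\<close>.\<close>

lemma lipschitz_increment_le_integral_two_sided:
  fixes g D :: "real \<Rightarrow> real" and \<sigma> :: real
  assumes "a \<le> b" and \<sigma>: "\<sigma> = 1 \<or> \<sigma> = -1" and lip: "\<And>x y. \<bar>g x - g y\<bar> \<le> L * \<bar>x - y\<bar>"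
    and D: "D \<in> borel_measurable borel" and bd: "\<And>x. \<bar>D x\<bar> \<le> L"
    and quot: "\<And>x \<eta> \<delta>. 0 < \<eta> \<Longrightarrow> 0 < \<delta> \<Longrightarrow>
      \<exists>t. 0 < t \<and> t < \<delta> \<and> (g (x + \<sigma> * t) - g x) / (\<sigma> * t) \<le> D x + \<eta>"
  shows "g b - g a \<le> integral {a..b} D"
proof (cases "\<sigma> = 1")
  case True
  show ?thesis
  proof (rule lipschitz_increment_le_integral[OF \<open>a \<le> b\<close> lip D bd])
    fix x \<eta> \<delta> :: real assume "0 < \<eta>" "0 < \<delta>"
    then obtain t where "0 < t" "t < \<delta>" "(g (x + t) - g x) / t \<le> D x + \<eta>"
      using quot[of \<eta> \<delta> x] True by auto
    then show "\<exists>y. x < y \<and> y < x + \<delta> \<and> g y - g x \<le> (D x + \<eta>) * (y - x)"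
      by (intro exI[of _ "x + t"]) (simp add: field_simps)
  qed
next
  case False
  then have \<sigma>: "\<sigma> = -1"
    using \<sigma> by simp
  have "- g (- (- a)) - - g (- (- b)) \<le> integral {- b..- a} (\<lambda>x. D (- x))"
  proof (rule lipschitz_increment_le_integral[where L=L and g="\<lambda>x. - g (- x)"])
    show "(\<lambda>x. D (- x)) \<in> borel_measurable borel"
      using D by measurable
    show "\<bar>- g (- x) - - g (- y)\<bar> \<le> L * \<bar>x - y\<bar>" for x y
      using lip[of "- y" "- x"] by (simp add: abs_minus_commute algebra_simps)
  next
    fix x \<eta> \<delta> :: real assume "0 < \<eta>" "0 < \<delta>"
    then obtain t where "0 < t" "t < \<delta>" "(g (- x + \<sigma> * t) - g (- x)) / (\<sigma> * t) \<le> D (- x) + \<eta>"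
      using quot by blast
    moreover have "- x + \<sigma> * t = - (x + t)"
      unfolding \<sigma> by simp
    ultimately have "0 < t" "t < \<delta>" "(g (- (x + t)) - g (- x)) / - t \<le> D (- x) + \<eta>"
      unfolding \<sigma> by auto
    then show "\<exists>y. x < y \<and> y < x + \<delta> \<and> - g (- y) - - g (- x) \<le> (D (- x) + \<eta>) * (y - x)"
      by (intro exI[of _ "x + t"]) (simp add: field_simps del: minus_add_distrib)
  qed (use \<open>a \<le> b\<close> bd in auto)
  then show ?thesis
    by simp
qed

text \<open>Along the fixed steps \<open>1 / real (Suc n)\<close> the lower and upper limits of the
  quotients are Borel. The increments of \<open>g\<close> are at most the integral of the lower
  limit and, by the same estimate for \<open>- g\<close>, at least the integral of the upper limit.
  Since the lower limit never exceeds the upper one, both integrals agree on every interval, and so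
  do the limits almost everywhere.\<close>

lemma lipschitz_sequential_derivative:
  fixes g :: "real \<Rightarrow> real" and \<sigma> :: real
  assumes \<sigma>: "\<sigma> = 1 \<or> \<sigma> = -1" and lip: "\<And>x y. \<bar>g x - g y\<bar> \<le> L * \<bar>x - y\<bar>"
  defines "q \<equiv> \<lambda>n x. (g (x + \<sigma> * (1 / real (Suc n))) - g x) / (\<sigma> * (1 / real (Suc n)))"
  obtains r where "r \<in> borel_measurable borel" "\<And>x. \<bar>r x\<bar> \<le> L"
    "\<And>a b. a \<le> b \<Longrightarrow> integral {a..b} r = g b - g a"
    "AE x in lborel. (\<lambda>n. q n x) \<longlonglongrightarrow> r x"
proof -
  have L0: "0 \<le> L"
    using lip[of 0 1] by simp
  have "L-lipschitz_on UNIV g"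
    using lip L0 by (auto simp: lipschitz_on_def dist_real_def)
  then have [measurable]: "g \<in> borel_measurable borel"
    by (intro borel_measurable_continuous_onI lipschitz_on_continuous_on)
  have [measurable]: "q n \<in> borel_measurable borel" for n
    unfolding q_def by measurable
  have qb: "\<bar>q n x\<bar> \<le> L" for n x
  proof -
    have "\<bar>g (x + \<sigma> * (1 / real (Suc n))) - g x\<bar> \<le> L * (1 / real (Suc n))"
      using lip[of "x + \<sigma> * (1 / real (Suc n))" x] \<sigma> by auto
    moreover have "\<bar>\<sigma> * (1 / real (Suc n))\<bar> = 1 / real (Suc n)"
      using \<sigma> by auto
    ultimately show ?thesis
      unfolding q_def abs_divide by (simp add: field_simps)
  qed
  define lo where "lo x = real_of_ereal (liminf (\<lambda>n. ereal (q n x)))" for x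
  define hi where "hi x = real_of_ereal (limsup (\<lambda>n. ereal (q n x)))" for x
  have [measurable]: "lo \<in> borel_measurable borel" "hi \<in> borel_measurable borel"
    unfolding lo_def hi_def by measurable
  have lims: "- ereal L \<le> liminf (\<lambda>n. ereal (q n x))" "limsup (\<lambda>n. ereal (q n x)) \<le> ereal L"
    "liminf (\<lambda>n. ereal (q n x)) \<le> limsup (\<lambda>n. ereal (q n x))" for x
    using qb[of _ x]
    by (auto intro!: Liminf_bounded Limsup_bounded Liminf_le_Limsup always_eventually simp: abs_le_iff minus_le_iff)
  have lo: "ereal (lo x) = liminf (\<lambda>n. ereal (q n x))" and hi: "ereal (hi x) = limsup (\<lambda>n. ereal (q n x))" for x
    using lims[of x] unfolding lo_def hi_def by (auto intro!: ereal_real')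
  have bds: "- L \<le> lo x" "lo x \<le> hi x" "hi x \<le> L" for x
    using lims[of x] unfolding lo[symmetric] hi[symmetric] by auto
  then have bd: "\<bar>lo x\<bar> \<le> L" "\<bar>hi x\<bar> \<le> L" for x
    using bds[of x] by linarith+
  have small: "\<exists>N. \<forall>n\<ge>N. 1 / real (Suc n) < \<delta>" if "0 < \<delta>" for \<delta>
    using LIMSEQ_inverse_real_of_nat[THEN order_tendstoD(2), OF that]
    by (simp add: eventually_sequentially inverse_eq_divide)
  have 1: "g b - g a \<le> integral {a..b} lo" if "a \<le> b" for a b
  proof (rule lipschitz_increment_le_integral_two_sided[OF that \<sigma> lip _ bd(1)])
    fix x \<eta> \<delta> :: real assume "0 < \<eta>" "0 < \<delta>"
    obtain N where N: "\<And>n. n \<ge> N \<Longrightarrow> 1 / real (Suc n) < \<delta>"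
      using small[OF \<open>0 < \<delta>\<close>] by blast
    have "liminf (\<lambda>n. ereal (q n x)) < ereal (lo x + \<eta>)"
      using \<open>0 < \<eta>\<close> unfolding lo[symmetric] by simp
    then have "\<not> (\<forall>\<^sub>F n in sequentially. ereal (lo x + \<eta>) \<le> ereal (q n x))"
      using Liminf_bounded[of "ereal (lo x + \<eta>)" "\<lambda>n. ereal (q n x)" sequentially] by (meson not_le)
    then obtain n where n: "n \<ge> N" "q n x < lo x + \<eta>"
      unfolding eventually_sequentially by (auto simp: not_le)
    from n(2) have "(g (x + \<sigma> * (1 / real (Suc n))) - g x) / (\<sigma> * (1 / real (Suc n))) \<le> lo x + \<eta>"
      unfolding q_def by (rule less_imp_le)
    moreover have "0 < 1 / real (Suc n)"
      by simp
    moreover note N[OF n(1)]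
    ultimately show "\<exists>t. 0 < t \<and> t < \<delta> \<and> (g (x + \<sigma> * t) - g x) / (\<sigma> * t) \<le> lo x + \<eta>"
      by (intro exI[of _ "1 / real (Suc n)"] conjI)
  qed simp
  have "- g b - - g a \<le> integral {a..b} (\<lambda>x. - hi x)" if "a \<le> b" for a b
  proof (rule lipschitz_increment_le_integral_two_sided[OF that \<sigma>, where L=L])
    fix x \<eta> \<delta> :: real assume "0 < \<eta>" "0 < \<delta>"
    obtain N where N: "\<And>n. n \<ge> N \<Longrightarrow> 1 / real (Suc n) < \<delta>"
      using small[OF \<open>0 < \<delta>\<close>] by blast
    have "ereal (hi x - \<eta>) < limsup (\<lambda>n. ereal (q n x))"
      using \<open>0 < \<eta>\<close> unfolding hi[symmetric] by simp
    then have "\<not> (\<forall>\<^sub>F n in sequentially. ereal (q n x) \<le> ereal (hi x - \<eta>))"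
      using Limsup_bounded[of "\<lambda>n. ereal (q n x)" "ereal (hi x - \<eta>)" sequentially] by (meson not_le)
    then obtain n where n: "n \<ge> N" "hi x - \<eta> < q n x"
      unfolding eventually_sequentially by (auto simp: not_le)
    have "(- a - - b) / c = - ((a - b) / c)" for a b c :: real
      by (simp add: minus_divide_left)
    then have "(- g (x + \<sigma> * (1 / real (Suc n))) - - g x) / (\<sigma> * (1 / real (Suc n))) = - q n x"
      unfolding q_def .
    then have "(- g (x + \<sigma> * (1 / real (Suc n))) - - g x) / (\<sigma> * (1 / real (Suc n))) \<le> - hi x + \<eta>"
      using n(2) by linarith
    moreover have "0 < 1 / real (Suc n)"
      by simp
    moreover note N[OF n(1)]
    ultimately show "\<exists>t. 0 < t \<and> t < \<delta> \<and> (- g (x + \<sigma> * t) - - g x) / (\<sigma> * t) \<le> - hi x + \<eta>"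
      by (intro exI[of _ "1 / real (Suc n)"] conjI)
  next
    show "\<bar>- g x - - g y\<bar> \<le> L * \<bar>x - y\<bar>" for x y
      using lip[of x y] by linarith
  qed (use bd in auto)
  then have 2: "integral {a..b} hi \<le> g b - g a" if "a \<le> b" for a b
    using that by fastforce
  note loi = bounded_borel_integrable_on[OF _ bd(1)] and hii = bounded_borel_integrable_on[OF _ bd(2)]
  have 3: "integral {a..b} lo \<le> integral {a..b} hi" for a b
    by (intro integral_le loi hii bds) auto
  have "AE x in lborel. x \<in> {- real n..real n} \<longrightarrow> hi x = lo x" for n
  proof -
    have "(LBINT x:{- real n..real n}. hi x - lo x) = 0"
      using 1[of "- real n" "real n"] 2[of "- real n" "real n"] 3[of "- real n" "real n"]
      by (subst set_integral_diff) (auto intro!: loi hii simp: loi hii)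
    moreover have "set_integrable lborel {- real n..real n} (\<lambda>x. hi x - lo x)"
      by (intro set_integral_diff loi hii) auto
    ultimately have "AE x in lborel. indicator {- real n..real n} x *\<^sub>R (hi x - lo x) = 0"
      using bds unfolding set_integrable_def set_lebesgue_integral_def
      by (subst integral_nonneg_eq_0_iff_AE[symmetric]) (auto simp: zero_le_mult_iff)
    then show ?thesis
      by (rule AE_mp) (auto intro!: AE_I2)
  qed
  then have "AE x in lborel. \<forall>n. x \<in> {- real n..real n} \<longrightarrow> hi x = lo x"
    unfolding AE_all_countable by blast
  then have "AE x in lborel. hi x = lo x"
  proof eventually_elim
    case (elim x)
    obtain n where "\<bar>x\<bar> \<le> real n"
      using real_arch_simple by blast
    then have "- real n \<le> x" "x \<le> real n"
      by linarith+
    then show ?case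
      using elim by auto
  qed
  then have "AE x in lborel. (\<lambda>n. q n x) \<longlonglongrightarrow> lo x"
  proof (rule AE_mp[OF _ AE_I2], intro impI)
    fix x assume "hi x = lo x"
    then have "(\<lambda>n. ereal (q n x)) \<longlonglongrightarrow> ereal (lo x)"
      by (intro Liminf_eq_Limsup) (auto simp: hi[symmetric] lo[symmetric])
    then show "(\<lambda>n. q n x) \<longlonglongrightarrow> lo x"
      by simp
  qed
  moreover have "integral {a..b} lo = g b - g a" if "a \<le> b" for a b
    using 1[OF that] 2[OF that] 3[of a b] by linarith
  ultimately show thesis
    using that[of lo] bd by auto
qed

text \<open>After an affine change the difference \<open>r - l\<close> becomes a nonnegative density
  whose integral over every interval is its length. The measure with this density gives every box
  its volume, hence is Lebesgue measure, and densities are unique.\<close>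

lemma AE_eq_if_interval_integrals_eq:
  fixes r l :: "real \<Rightarrow> real"
  assumes [measurable]: "r \<in> borel_measurable borel" "l \<in> borel_measurable borel"
    and bd: "\<And>x. \<bar>r x\<bar> \<le> L" "\<And>x. \<bar>l x\<bar> \<le> L"
    and eq: "\<And>a b. a \<le> b \<Longrightarrow> integral {a..b} r = integral {a..b} l"
  shows "AE x in lborel. r x = l x"
proof -
  \<comment> \<open>\<open>r - l\<close> is at least \<open>-2 * L\<close>, so adding
    \<open>C\<close> makes it positive; the extra 1 permits division by \<open>C\<close> when
    \<open>L = 0\<close>.\<close>
  define C where "C = 2 * L + 1"
  have C: "0 < C" "0 \<le> r x - l x + C" for x
    using bd[of x] unfolding C_def by auto
  define u where "u x = (r x - l x + C) / C" for x
  have u0: "0 \<le> u x" for x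
    unfolding u_def using C(1) C(2)[of x] by auto
  have [measurable]: "u \<in> borel_measurable borel"
    unfolding u_def by measurable
  have ub: "\<bar>u x\<bar> \<le> (4 * L + 1) / C" for x
  proof -
    have "\<bar>r x - l x + C\<bar> \<le> 4 * L + 1"
      using bd[of x] C(2)[of x] unfolding C_def by linarith
    then show ?thesis
      unfolding u_def abs_divide using C(1) by (simp add: divide_right_mono)
  qed
  note ui = bounded_borel_integrable_on[OF \<open>u \<in> borel_measurable borel\<close> ub]
  have "lborel = density lborel (\<lambda>x. ennreal (u x))"
  proof (rule lborel_eqI)
    fix a b :: real assume "\<And>c. c \<in> Basis \<Longrightarrow> a \<bullet> c \<le> b \<bullet> c"
    then have "a \<le> b"
      by simp
    note ri = bounded_borel_integrable_on[OF assms(1) bd(1)]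
      and li = bounded_borel_integrable_on[OF assms(2) bd(2)]
    have "integral {a..b} (\<lambda>x. r x - l x + C) = C * (b - a)"
      using \<open>a \<le> b\<close> eq[OF \<open>a \<le> b\<close>]
      by (simp add: Henstock_Kurzweil_Integration.integral_add Henstock_Kurzweil_Integration.integral_diff
          ri li integrable_diff integrable_const_ivl)
    then have "integral {a..b} u = b - a"
      unfolding u_def using C(1) by simp
    then have "(LBINT x:{a..b}. u x) = b - a"
      using ui by simp
    moreover have "emeasure (density lborel (\<lambda>x. ennreal (u x))) {a..b} = ennreal (LBINT x:{a..b}. u x)"
      using ui(2)[of a b] u0 unfolding set_integrable_def set_lebesgue_integral_def
      by (simp add: emeasure_density nn_integral_eq_integral[symmetric] mult.commute ennreal_mult'' ennreal_indicator)
    moreover have "emeasure (density lborel (\<lambda>x. ennreal (u x))) {a..b}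
        = emeasure (density lborel (\<lambda>x. ennreal (u x))) (box a b)"
    proof (rule emeasure_eq_AE)
      have "AE x in lborel. x \<noteq> a" "AE x in lborel. x \<noteq> b"
        by (rule AE_lborel_singleton)+
      then show "AE x in density lborel (\<lambda>x. ennreal (u x)). x \<in> {a..b} \<longleftrightarrow> x \<in> box a b"
        by (subst AE_density, simp, eventually_elim) auto
    qed auto
    ultimately show "emeasure (density lborel (\<lambda>x. ennreal (u x))) (box a b) = (\<Prod>c\<in>Basis. (b - a) \<bullet> c)"
      by simp
  qed simp
  then have "density lborel (\<lambda>x. ennreal (u x)) = density lborel (\<lambda>_. 1)"
    by (simp add: density_1)
  then have "AE x in lborel. ennreal (u x) = 1"
    by (intro sigma_finite_measure.density_unique[OF sigma_finite_lborel]) auto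
  then show ?thesis
    by (rule AE_mp[OF _ AE_I2]) (use C in \<open>auto simp: u_def field_simps ennreal_eq_1\<close>)
qed


text \<open>Neighbouring steps \<open>1 / (n + 1)\<close> and \<open>1 / (n + 2)\<close> differ by
  their product, a quantity of second order. The Lipschitz bound therefore makes the quotient at any
  small increment \<open>t\<close> close to the quotient at the nearest step of the same sign that
  is not shorter.\<close>

lemma lipschitz_has_derivative_if_sequential:
  fixes g :: "real \<Rightarrow> real"
  assumes lip: "\<And>x y. \<bar>g x - g y\<bar> \<le> L * \<bar>x - y\<bar>"
    and seq: "\<And>\<sigma>. \<sigma> = 1 \<or> \<sigma> = -1 \<Longrightarrow>
      (\<lambda>n. (g (x + \<sigma> * (1 / real (Suc n))) - g x) / (\<sigma> * (1 / real (Suc n)))) \<longlonglongrightarrow> D"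
  shows "(g has_real_derivative D) (at x)"
  unfolding DERIV_def
proof (rule LIM_I)
  fix e :: real assume "0 < e"
  have L0: "0 \<le> L"
    using lip[of 0 1] by simp
  define q where "q \<sigma> n = (g (x + \<sigma> * (1 / real (Suc n))) - g x) / (\<sigma> * (1 / real (Suc n)))" for \<sigma> n
  have "\<forall>\<^sub>F n in sequentially. \<bar>q 1 n - D\<bar> < e / 2 \<and> \<bar>q (-1) n - D\<bar> < e / 2"
    using seq[of 1] seq[of "-1"] \<open>0 < e\<close> unfolding q_def[symmetric] tendsto_iff dist_real_def
    by (intro eventually_conj) (auto dest: spec[of _ "e / 2"])
  then obtain N where N: "\<And>n. n \<ge> N \<Longrightarrow> \<bar>q 1 n - D\<bar> < e / 2 \<and> \<bar>q (-1) n - D\<bar> < e / 2"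
    unfolding eventually_sequentially by blast
  \<comment> \<open>The first bound forces the index \<open>n\<close> chosen below to be at least
    \<open>N\<close>; the second makes the comparison error \<open>4 * L * s\<close> smaller than
    \<open>e / 2\<close>.\<close>
  define \<delta> where "\<delta> = min (1 / real (Suc N)) (e / (8 * (L + 1)))"
  have "\<bar>(g (x + t) - g x) / t - D\<bar> < e" if t: "t \<noteq> 0" "\<bar>t\<bar> < \<delta>" for t
  proof -
    define \<sigma> where "\<sigma> = sgn t"
    have \<sigma>: "\<sigma> = 1 \<or> \<sigma> = -1" "t = \<sigma> * \<bar>t\<bar>" "\<bar>\<sigma>\<bar> = 1"
      using t(1) unfolding \<sigma>_def by (auto simp: sgn_if)
    have inv: "real (Suc N) < 1 / \<bar>t\<bar>"
      using t unfolding \<delta>_def by (simp add: field_simps)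
    \<comment> \<open>This choice yields
      \<open>1 / (n + 2) < \<bar>t\<bar> \<le> 1 / (n + 1)\<close>: the step \<open>c\<close> is at
      least \<open>\<bar>t\<bar>\<close> and exceeds it by at most
      \<open>c * \<bar>t\<bar>\<close>.\<close>
    define n where "n = nat \<lfloor>1 / \<bar>t\<bar>\<rfloor> - 1"
    have "real (nat \<lfloor>1 / \<bar>t\<bar>\<rfloor>) = of_int \<lfloor>1 / \<bar>t\<bar>\<rfloor>"
      by simp
    moreover have "Suc N \<le> nat \<lfloor>1 / \<bar>t\<bar>\<rfloor>"
      using inv by (simp add: le_nat_iff le_floor_iff)
    ultimately have n: "n \<ge> N" "real n + 1 \<le> 1 / \<bar>t\<bar>" "1 / \<bar>t\<bar> < real n + 2"
      unfolding n_def by linarith+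
    define c where "c = 1 / real (Suc n)"
    define s where "s = \<bar>t\<bar>"
    have s: "0 < s" "s \<le> c" "c - s \<le> c * s" "c \<le> 2 * s" "0 < c"
    proof -
      show "0 < s" "0 < c"
        using t(1) unfolding s_def c_def by auto
      then have *: "(real n + 1) * s \<le> 1" "1 < (real n + 2) * s" "(real n + 1) * c = 1"
        using n(2,3) unfolding s_def c_def by (auto simp: field_simps)
      then have "(real n + 1) * s \<le> (real n + 1) * c"
        by simp
      then show "s \<le> c"
        by simp
      have "(real n + 1) * (c - s) < s"
        using * by (simp add: algebra_simps)
      also have "s = (real n + 1) * (c * s)"
        using *(3) by (metis mult.assoc mult_1)
      finally show "c - s \<le> c * s"
        by (simp add: mult_less_cancel_left_pos)
      then show "c \<le> 2 * s"
        using \<open>(real n + 1) * (c - s) < s\<close> \<open>s \<le> c\<close> mult_right_mono[of 1 "real n + 1" "c - s"]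
        by simp
    qed
    have "\<bar>(g (x + t) - g x) / t - q \<sigma> n\<bar> \<le> 4 * L * s"
    proof -
      have qn: "q \<sigma> n = (g (x + \<sigma> * c) - g x) / (\<sigma> * c)"
        unfolding q_def c_def ..
      have ts: "t = \<sigma> * s"
        using \<sigma>(2) unfolding s_def .
      have "\<bar>g (x + t) - g (x + \<sigma> * c)\<bar> \<le> L * \<bar>\<sigma> * (s - c)\<bar>"
        using lip[of "x + t" "x + \<sigma> * c"] unfolding ts by (simp add: algebra_simps)
      also have "\<dots> \<le> L * (c * s)"
        using s L0 \<sigma>(3) by (intro mult_left_mono) (auto simp: abs_mult)
      finally have 1: "\<bar>(g (x + t) - g (x + \<sigma> * c)) / t\<bar> \<le> L * c"
        using s \<sigma>(3) unfolding ts by (simp add: abs_mult field_simps)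
      have "\<bar>g (x + \<sigma> * c) - g x\<bar> \<le> L * c"
        using lip[of "x + \<sigma> * c" x] \<sigma>(3) s by (simp add: abs_mult)
      moreover have "\<bar>1 / t - 1 / (\<sigma> * c)\<bar> \<le> 1"
      proof -
        have "1 / t - 1 / (\<sigma> * c) = \<sigma> * ((c - s) / (c * s))"
          using \<sigma>(1) s unfolding ts by (auto simp: field_simps)
        then show ?thesis
          using s \<sigma>(3) by (simp add: abs_mult)
      qed
      ultimately have "\<bar>(g (x + \<sigma> * c) - g x) * (1 / t - 1 / (\<sigma> * c))\<bar> \<le> L * c * 1"
        unfolding abs_mult using L0 s by (intro mult_mono) auto
      moreover have "(g (x + t) - g x) / t - q \<sigma> n = (g (x + t) - g (x + \<sigma> * c)) / t
          + (g (x + \<sigma> * c) - g x) * (1 / t - 1 / (\<sigma> * c))"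
        unfolding qn by (simp add: diff_divide_distrib right_diff_distrib left_diff_distrib)
      ultimately have "\<bar>(g (x + t) - g x) / t - q \<sigma> n\<bar> \<le> 2 * L * c"
        using 1 by linarith
      also have "\<dots> \<le> 2 * L * (2 * s)"
        using s L0 by (intro mult_left_mono) auto
      finally show ?thesis
        by simp
    qed
    also have "4 * L * s < e / 2"
    proof -
      have "s < e / (8 * (L + 1))"
        using t(2) unfolding s_def \<delta>_def by simp
      then have "8 * (L * s) + 8 * s < e"
        using L0 by (simp add: field_simps)
      then show ?thesis
        using s by linarith
    qed
    finally have "\<bar>(g (x + t) - g x) / t - q \<sigma> n\<bar> < e / 2" .
    moreover have "\<bar>q \<sigma> n - D\<bar> < e / 2"
      using N[OF n(1)] \<sigma>(1) by auto
    ultimately show ?thesis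
      by linarith
  qed
  moreover have "0 < \<delta>"
    using \<open>0 < e\<close> L0 unfolding \<delta>_def by simp
  ultimately show "\<exists>s>0. \<forall>t. t \<noteq> 0 \<and> norm (t - 0) < s \<longrightarrow> norm ((g (x + t) - g x) / t - D) < e"
    by (intro exI[of _ \<delta>]) auto
qed

text \<open>The limits along right and left steps both integrate to the increments of
  \<open>g\<close>, so they coincide almost everywhere, and where they coincide \<open>g\<close> is
  differentiable.\<close>

theorem lipschitz_real_derivative:
  fixes g :: "real \<Rightarrow> real"
  assumes lip: "\<And>x y. \<bar>g x - g y\<bar> \<le> L * \<bar>x - y\<bar>"
  obtains r where "r \<in> borel_measurable borel" "\<And>x. \<bar>r x\<bar> \<le> L"
    "\<And>a b. a \<le> b \<Longrightarrow> integral {a..b} r = g b - g a"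
    "AE x in lborel. (g has_real_derivative r x) (at x)"
proof -
  obtain r where r: "r \<in> borel_measurable borel" "\<And>x. \<bar>r x\<bar> \<le> L"
    "\<And>a b. a \<le> b \<Longrightarrow> integral {a..b} r = g b - g a"
    "AE x in lborel. (\<lambda>n. (g (x + 1 * (1 / real (Suc n))) - g x) / (1 * (1 / real (Suc n)))) \<longlonglongrightarrow> r x"
    using lipschitz_sequential_derivative[of 1 g L, OF _ lip] by blast
  obtain l where l: "l \<in> borel_measurable borel" "\<And>x. \<bar>l x\<bar> \<le> L"
    "\<And>a b. a \<le> b \<Longrightarrow> integral {a..b} l = g b - g a"
    "AE x in lborel. (\<lambda>n. (g (x + (-1) * (1 / real (Suc n))) - g x) / ((-1) * (1 / real (Suc n)))) \<longlonglongrightarrow> l x"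
    using lipschitz_sequential_derivative[of "-1" g L, OF _ lip] by blast
  have "AE x in lborel. r x = l x"
    by (rule AE_eq_if_interval_integrals_eq[OF r(1) l(1) r(2) l(2)]) (simp add: r(3) l(3))
  with r(4) l(4) have "AE x in lborel. (g has_real_derivative r x) (at x)"
  proof eventually_elim
    case (elim x)
    then show ?case
      by (intro lipschitz_has_derivative_if_sequential[OF lip]) auto
  qed
  then show thesis
    using r that by blast
qed

section \<open>Variation of curves\<close>

lemma variation_eq_SUP:
  "variation d \<gamma> a b = (SUP p\<in>{(n, t). mono_on {..n} t \<and> t ` {..n} \<subseteq> {a..b}}.
     \<Sum>i<fst p. d (\<gamma> (snd p i)) (\<gamma> (snd p (Suc i))))"
proof -
  have "{(\<Sum>i<n. d (\<gamma> (t i)) (\<gamma> (t (Suc i)))) | n t. mono_on {..n} t \<and> t ` {..n} \<subseteq> {a..b}} =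
    (\<lambda>p. \<Sum>i<fst p. d (\<gamma> (snd p i)) (\<gamma> (snd p (Suc i)))) ` {(n, t). mono_on {..n} t \<and> t ` {..n} \<subseteq> {a..b}}"
    by (simp add: set_eq_iff image_iff) blast
  then show ?thesis
    unfolding variation_def by (rule arg_cong)
qed

lemma variation_upper:
  assumes "mono_on {..n} t" "t ` {..n} \<subseteq> {a..b}"
  shows "(\<Sum>i<n. d (\<gamma> (t i)) (\<gamma> (t (Suc i)))) \<le> variation d \<gamma> a b"
  unfolding variation_def using assms by (intro Sup_upper) blast

lemma variation_least:
  assumes "\<And>n t. mono_on {..n} t \<Longrightarrow> t ` {..n} \<subseteq> {a..b} \<Longrightarrow>
    (\<Sum>i<n. d (\<gamma> (t i)) (\<gamma> (t (Suc i)))) \<le> c"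
  shows "variation d \<gamma> a b \<le> c"
  unfolding variation_def using assms by (intro Sup_least) blast

lemma variation_cong:
  assumes "\<And>t. t \<in> {a..b} \<Longrightarrow> \<gamma> t = \<sigma> t"
  shows "variation d \<gamma> a b = variation d \<sigma> a b"
proof -
  have "(\<Sum>i<n. d (\<gamma> (t i)) (\<gamma> (t (Suc i)))) = (\<Sum>i<n. d (\<sigma> (t i)) (\<sigma> (t (Suc i))))"
    if "t ` {..n} \<subseteq> {a..b}" for n and t :: "nat \<Rightarrow> real"
  proof (intro sum.cong refl arg_cong2[where f=d] assms)
    fix i assume "i \<in> {..<n}"
    then show "t i \<in> {a..b}" "t (Suc i) \<in> {a..b}"
      using that by (simp_all add: image_subset_iff)
  qed
  then show ?thesis
    unfolding variation_eq_SUP by (intro SUP_cong) auto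
qed

lemma dist_le_variation:
  assumes "a \<le> s" "s \<le> t" "t \<le> b"
  shows "d (\<gamma> s) (\<gamma> t) \<le> variation d \<gamma> a b"
  using variation_upper[of 1 "\<lambda>i. if i = 0 then s else t" a b d \<gamma>] assms
  by (auto simp: mono_on_def image_subset_iff)

lemma variation_subinterval_mono:
  assumes "a \<le> a'" "b' \<le> b"
  shows "variation d \<gamma> a' b' \<le> variation d \<gamma> a b"
  using assms by (intro variation_least variation_upper) force+

text \<open>One inequality splits a partition of \<open>{a..c}\<close> by clamping its points to
  either side of \<open>b\<close>, the step across \<open>b\<close> being divided by the triangle
  inequality. The other concatenates partitions of the two halves.\<close>

lemma variation_add:
  assumes d: "extended_distance d" and "a \<le> b" "b \<le> c"
  shows "variation d \<gamma> a c = variation d \<gamma> a b + variation d \<gamma> b c"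
proof (rule antisym)
  show "variation d \<gamma> a c \<le> variation d \<gamma> a b + variation d \<gamma> b c"
  proof (rule variation_least)
    fix n and t :: "nat \<Rightarrow> real" assume t: "mono_on {..n} t" "t ` {..n} \<subseteq> {a..c}"
    have "d (\<gamma> (t i)) (\<gamma> (t (Suc i))) \<le> d (\<gamma> (min (t i) b)) (\<gamma> (min (t (Suc i)) b))
        + d (\<gamma> (max (t i) b)) (\<gamma> (max (t (Suc i)) b))" if "i < n" for i
    proof -
      have "t i \<le> t (Suc i)"
        using that by (intro mono_onD[OF t(1)]) auto
      then consider "t (Suc i) \<le> b" "t i \<le> b" | "b \<le> t i" "b \<le> t (Suc i)" | "t i \<le> b" "b \<le> t (Suc i)"
        by linarith
      then show ?thesis
      proof cases
        case 3
        have "d (\<gamma> (t i)) (\<gamma> (t (Suc i))) \<le> d (\<gamma> (t i)) (\<gamma> b) + d (\<gamma> b) (\<gamma> (t (Suc i)))"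
          using d unfolding extended_distance_def by blast
        then show ?thesis
          using 3 by (simp add: min_absorb1 min_absorb2 max_absorb1 max_absorb2)
      qed (use d in \<open>auto simp: extended_distance_def min_def max_def\<close>)
    qed
    then have "(\<Sum>i<n. d (\<gamma> (t i)) (\<gamma> (t (Suc i)))) \<le>
        (\<Sum>i<n. d (\<gamma> (min (t i) b)) (\<gamma> (min (t (Suc i)) b)))
        + (\<Sum>i<n. d (\<gamma> (max (t i) b)) (\<gamma> (max (t (Suc i)) b)))"
      unfolding sum.distrib[symmetric] by (intro sum_mono) auto
    also have "\<dots> \<le> variation d \<gamma> a b + variation d \<gamma> b c"
      using t assms
      by (intro add_mono variation_upper[where t="\<lambda>i. min (t i) b"] variation_upper[where t="\<lambda>i. max (t i) b"])
        (force simp: mono_on_def image_subset_iff min_le_iff_disj le_max_iff_disj)+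
    finally show "(\<Sum>i<n. d (\<gamma> (t i)) (\<gamma> (t (Suc i)))) \<le> variation d \<gamma> a b + variation d \<gamma> b c" .
  qed
next
  have *: "(\<Sum>i<n. d (\<gamma> (t i)) (\<gamma> (t (Suc i)))) + (\<Sum>i<m. d (\<gamma> (s i)) (\<gamma> (s (Suc i)))) \<le> variation d \<gamma> a c"
    if t: "mono_on {..n} t" "t ` {..n} \<subseteq> {a..b}" and s: "mono_on {..m} s" "s ` {..m} \<subseteq> {b..c}"
    for n m t s
  proof -
    \<comment> \<open>Indices up to \<open>n\<close> run through \<open>t\<close>, those from
      \<open>n + 1\<close> on through \<open>s\<close>. The link from \<open>t n\<close> to
      \<open>s 0\<close> is an additional nonnegative summand, which only helps.\<close>
    define u where "u i = (if i \<le> n then t i else s (i - Suc n))" for i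
    have split_sum: "(\<Sum>i<k + m. f i) = (\<Sum>i<k. f i) + (\<Sum>i<m. f (k + i))" for f :: "nat \<Rightarrow> ennreal" and k
      by (induction m) (simp_all add: add.assoc)
    have ub: "a \<le> t i" "t i \<le> b" if "i \<le> n" for i
      using t(2) that by (auto simp: image_subset_iff)
    have sb: "b \<le> s i" "s i \<le> c" if "i \<le> m" for i
      using s(2) that by (auto simp: image_subset_iff)
    have "(\<Sum>i<n. d (\<gamma> (t i)) (\<gamma> (t (Suc i)))) + (\<Sum>i<m. d (\<gamma> (s i)) (\<gamma> (s (Suc i))))
       \<le> (\<Sum>i<n. d (\<gamma> (u i)) (\<gamma> (u (Suc i)))) + (d (\<gamma> (u n)) (\<gamma> (u (Suc n)))
         + (\<Sum>i<m. d (\<gamma> (u (Suc n + i))) (\<gamma> (u (Suc (Suc n + i))))))"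
      by (intro add_mono add_increasing sum_mono) (auto simp: u_def)
    also have "\<dots> = (\<Sum>i<Suc n + m. d (\<gamma> (u i)) (\<gamma> (u (Suc i))))"
      by (simp add: split_sum add.assoc del: add_Suc)
    also have "\<dots> \<le> variation d \<gamma> a c"
    proof (rule variation_upper)
      show "mono_on {..Suc n + m} u"
      proof (rule mono_onI)
        fix i j assume ij: "i \<in> {..Suc n + m}" "j \<in> {..Suc n + m}" "i \<le> j"
        consider "j \<le> n" | "i \<le> n" "n < j" | "n < i"
          by linarith
        then show "u i \<le> u j"
        proof cases
          case 1
          then show ?thesis
            using ij t(1) by (auto simp: u_def intro: mono_onD)
        next
          case 2
          then have "t i \<le> b" "b \<le> s (j - Suc n)"
            using ij ub(2)[of i] sb(1)[of "j - Suc n"] by auto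
          then show ?thesis
            using 2 by (simp add: u_def)
        next
          case 3
          then show ?thesis
            using ij s(1) by (auto simp: u_def intro!: mono_onD[of _ s])
        qed
      qed
      have "a \<le> u i \<and> u i \<le> c" if "i \<le> Suc n + m" for i
      proof (cases "i \<le> n")
        case True
        then show ?thesis
          using ub[of i] assms unfolding u_def by auto
      next
        case False
        then have "i - Suc n \<le> m"
          using that by simp
        then show ?thesis
          using sb[of "i - Suc n"] False assms unfolding u_def by simp
      qed
      then show "u ` {..Suc n + m} \<subseteq> {a..c}"
        by auto
    qed
    finally show ?thesis .
  qed
  \<comment> \<open>In \<open>ennreal\<close> a constant can be moved into a supremum only over a
    nonempty index set; the one-point partition provides an index.\<close>
  have ne: "{(n, t). mono_on {..n} t \<and> t ` {..n} \<subseteq> {x..y}} \<noteq> {}" if "x \<le> y" for x y :: real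
    using that by (auto intro!: exI[of _ 0] exI[of _ "\<lambda>_. x"] simp: mono_on_def)
  show "variation d \<gamma> a b + variation d \<gamma> b c \<le> variation d \<gamma> a c"
  proof -
    let ?A = "{(n, t). mono_on {..n} t \<and> t ` {..n} \<subseteq> {a..b}}" and ?B = "{(n, t). mono_on {..n} t \<and> t ` {..n} \<subseteq> {b..c}}"
      and ?F = "\<lambda>p. \<Sum>i<fst p. d (\<gamma> (snd p i)) (\<gamma> (snd p (Suc i)))"
    have "(SUP p\<in>?A. ?F p) + (SUP r\<in>?B. ?F r) = (SUP p\<in>?A. ?F p + (SUP r\<in>?B. ?F r))"
      by (rule ennreal_SUP_add_left[OF ne[OF \<open>a \<le> b\<close>], symmetric])
    also have "\<dots> = (SUP p\<in>?A. SUP r\<in>?B. ?F p + ?F r)"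
      by (intro SUP_cong refl ennreal_SUP_add_right[OF ne[OF \<open>b \<le> c\<close>]])
    also have "\<dots> \<le> variation d \<gamma> a c"
      using * by (intro SUP_least) auto
    finally show ?thesis
      unfolding variation_eq_SUP[of d \<gamma> a b] variation_eq_SUP[of d \<gamma> b c] .
  qed
qed

lemma variation_refl:
  assumes "extended_distance d"
  shows "variation d \<gamma> a a = 0"
proof -
  have "variation d \<gamma> a a \<le> 0"
  proof (rule variation_least)
    fix n and t :: "nat \<Rightarrow> real" assume "t ` {..n} \<subseteq> {a..a}"
    then have "t i = a" if "i \<le> n" for i
      using that by (auto simp: image_subset_iff)
    then show "(\<Sum>i<n. d (\<gamma> (t i)) (\<gamma> (t (Suc i)))) \<le> 0"
      using assms by (simp add: extended_distance_def)
  qed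
  then show ?thesis
    by simp
qed

text \<open>Partitions are pushed forward by \<open>\<phi>\<close> and pulled back through one fixed
  choice of preimages. Since the choice depends on the value alone, equal partition points receive
  the same preimage, which keeps the pulled back partition monotone even where \<open>\<phi>\<close>
  is constant.\<close>

lemma variation_compose:
  assumes "a \<le> b" and mono: "mono_on {a..b} \<phi>" and img: "\<phi> ` {a..b} = {\<phi> a..\<phi> b}"
  shows "variation d (\<lambda>t. \<gamma> (\<phi> t)) a b = variation d \<gamma> (\<phi> a) (\<phi> b)"
proof (rule antisym)
  show "variation d (\<lambda>t. \<gamma> (\<phi> t)) a b \<le> variation d \<gamma> (\<phi> a) (\<phi> b)"
  proof (rule variation_least)
    fix n and t :: "nat \<Rightarrow> real" assume t: "mono_on {..n} t" "t ` {..n} \<subseteq> {a..b}"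
    show "(\<Sum>i<n. d (\<gamma> (\<phi> (t i))) (\<gamma> (\<phi> (t (Suc i))))) \<le> variation d \<gamma> (\<phi> a) (\<phi> b)"
    proof (rule variation_upper[where t="\<lambda>i. \<phi> (t i)"])
      show "mono_on {..n} (\<lambda>i. \<phi> (t i))"
        using t by (auto simp: mono_on_def image_subset_iff intro!: mono_onD[OF mono])
      show "(\<lambda>i. \<phi> (t i)) ` {..n} \<subseteq> {\<phi> a..\<phi> b}"
        using t(2) img by blast
    qed
  qed
  show "variation d \<gamma> (\<phi> a) (\<phi> b) \<le> variation d (\<lambda>t. \<gamma> (\<phi> t)) a b"
  proof (rule variation_least)
    fix n and t :: "nat \<Rightarrow> real" assume t: "mono_on {..n} t" "t ` {..n} \<subseteq> {\<phi> a..\<phi> b}"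
    define s where "s i = inv_into {a..b} \<phi> (t i)" for i
    have s: "s i \<in> {a..b}" "\<phi> (s i) = t i" if "i \<le> n" for i
      using t(2) that img unfolding s_def by (auto intro!: inv_into_into f_inv_into_f simp: image_subset_iff simp del: atLeastAtMost_iff)
    have "(\<Sum>i<n. d (\<gamma> (t i)) (\<gamma> (t (Suc i)))) = (\<Sum>i<n. d (\<gamma> (\<phi> (s i))) (\<gamma> (\<phi> (s (Suc i)))))"
      using s by simp
    also have "\<dots> \<le> variation d (\<lambda>t. \<gamma> (\<phi> t)) a b"
    proof (rule variation_upper)
      show "mono_on {..n} s"
      proof (rule mono_onI)
        fix i j assume ij: "i \<in> {..n}" "j \<in> {..n}" "i \<le> j"
        then have "t i \<le> t j"
          by (intro mono_onD[OF t(1)]) auto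
        show "s i \<le> s j"
        proof (rule ccontr)
          assume "\<not> s i \<le> s j"
          then have "\<phi> (s j) \<le> \<phi> (s i)"
            using s ij by (intro mono_onD[OF mono]) auto
          then have "t i = t j"
            using \<open>t i \<le> t j\<close> s ij by simp
          then show False
            using \<open>\<not> s i \<le> s j\<close> unfolding s_def by simp
        qed
      qed
      show "s ` {..n} \<subseteq> {a..b}"
        using s by blast
    qed
    finally show "(\<Sum>i<n. d (\<gamma> (t i)) (\<gamma> (t (Suc i)))) \<le> variation d (\<lambda>t. \<gamma> (\<phi> t)) a b" .
  qed
qed

lemma mono_on_image_Icc:
  fixes \<phi> :: "real \<Rightarrow> real"
  assumes "a \<le> b" "continuous_on {a..b} \<phi>" "mono_on {a..b} \<phi>"
  shows "\<phi> ` {a..b} = {\<phi> a..\<phi> b}"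
proof
  show "\<phi> ` {a..b} \<subseteq> {\<phi> a..\<phi> b}"
    using assms by (auto intro!: mono_onD[OF assms(3)])
  show "{\<phi> a..\<phi> b} \<subseteq> \<phi> ` {a..b}"
    using IVT'[OF _ _ assms(1,2)] by force
qed

lemma reparametrizationsD:
  assumes "\<phi> \<in> reparametrizations"
  shows "continuous_on {0..1} \<phi>" "mono_on {0..1} \<phi>" "\<phi> ` {0..1} = {0..1}" "\<phi> 0 = 0" "\<phi> 1 = 1"
proof -
  show 1: "continuous_on {0..1} \<phi>" "mono_on {0..1} \<phi>" "\<phi> ` {0..1} = {0..1}"
    using assms by (auto simp: reparametrizations_def)
  have "{\<phi> 0..\<phi> 1} = {0..1}"
    using mono_on_image_Icc[OF _ 1(1,2)] 1(3) by simp
  then show "\<phi> 0 = 0" "\<phi> 1 = 1"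
    by (auto simp: Icc_eq_Icc)
qed

lemma variation_reparametrize:
  assumes \<phi>: "\<phi> \<in> reparametrizations" and "0 \<le> a" "a \<le> b" "b \<le> 1"
  shows "variation d (\<lambda>t. \<gamma> (\<phi> t)) a b = variation d \<gamma> (\<phi> a) (\<phi> b)"
proof (rule variation_compose[OF \<open>a \<le> b\<close>])
  note \<phi> = reparametrizationsD[OF \<phi>]
  show *: "mono_on {a..b} \<phi>"
    using assms by (intro mono_on_subset[OF \<phi>(2)]) auto
  show "\<phi> ` {a..b} = {\<phi> a..\<phi> b}"
    using assms by (intro mono_on_image_Icc * continuous_on_subset[OF \<phi>(1)]) auto
qed

text \<open>A partition of \<open>{lo t..hi t}\<close> whose sum exceeds \<open>C\<close> is clamped
  to \<open>{lo u..hi u}\<close>; the clamped points converge as \<open>u\<close> tends to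
  \<open>t\<close>, and continuity for \<open>d\<close> makes the change of the sum small. Movable
  end points cover both the length up to \<open>u\<close> and the length from \<open>u\<close>
  on.\<close>

lemma variation_lower_semicontinuous:
  assumes d: "extended_distance d" and c: "d_continuous d \<gamma>"
    and lo: "continuous_on {0..1} lo" and hi: "continuous_on {0..1} hi"
    and lohi: "\<And>u. u \<in> {0..1} \<Longrightarrow> 0 \<le> lo u \<and> lo u \<le> hi u \<and> hi u \<le> 1"
    and t: "t \<in> {0..1::real}" and C: "C < variation d \<gamma> (lo t) (hi t)"
  shows "\<forall>\<^sub>F u in at t within {0..1}. C < variation d \<gamma> (lo u) (hi u)"
proof -
  obtain n p where p: "mono_on {..n} p" "p ` {..n} \<subseteq> {lo t..hi t}"
    and S: "C < (\<Sum>i<n. d (\<gamma> (p i)) (\<gamma> (p (Suc i))))"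
    using C unfolding variation_def less_Sup_iff by auto
  define P where "P u x = max (lo u) (min x (hi u))" for u x
  define e where "e u = (\<Sum>i<n. d (\<gamma> (P u (p i))) (\<gamma> (p i)) + d (\<gamma> (P u (p (Suc i)))) (\<gamma> (p (Suc i))))" for u
  have lim: "((\<lambda>u. d (\<gamma> (P u x)) (\<gamma> x)) \<longlongrightarrow> 0) (at t within {0..1})" if x: "x \<in> {lo t..hi t}" for x
  proof -
    have x01: "x \<in> {0..1}" and Pt: "P t x = x"
      using x lohi[OF t] unfolding P_def by auto
    have d0: "d (\<gamma> x) (\<gamma> x) = 0"
      using d unfolding extended_distance_def by blast
    have "continuous_on {0..1} (\<lambda>u. P u x)"
      unfolding P_def by (intro continuous_intros lo hi)
    then have 1: "continuous (at t within {0..1}) (\<lambda>u. P u x)"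
      using t by (simp add: continuous_on_eq_continuous_within)
    have "continuous (at x within {0..1}) (\<lambda>s. d (\<gamma> s) (\<gamma> x))"
      using c x01 unfolding d_continuous_def continuous_within d0 by blast
    moreover have "(\<lambda>u. P u x) ` {0..1} \<subseteq> {0..1}"
      using lohi unfolding P_def by force
    ultimately have "continuous (at (P t x) within (\<lambda>u. P u x) ` {0..1}) (\<lambda>s. d (\<gamma> s) (\<gamma> x))"
      unfolding Pt by (rule continuous_within_subset)
    from continuous_within_compose2[OF 1 this] show ?thesis
      unfolding continuous_within Pt d0 .
  qed
  have "(e \<longlongrightarrow> (\<Sum>i<n. 0 + 0)) (at t within {0..1})"
    unfolding e_def
  proof (intro tendsto_sum tendsto_add lim)
    fix i assume "i \<in> {..<n}"
    then show "p i \<in> {lo t..hi t}" "p (Suc i) \<in> {lo t..hi t}"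
      using p(2) by (auto simp: image_subset_iff)
  qed
  then have "((\<lambda>u. C + e u) \<longlongrightarrow> C + 0) (at t within {0..1})"
    by (intro tendsto_add tendsto_const) simp
  then have "\<forall>\<^sub>F u in at t within {0..1}. C + e u < (\<Sum>i<n. d (\<gamma> (p i)) (\<gamma> (p (Suc i))))"
    by (rule order_tendstoD) (use S in simp)
  moreover have "\<forall>\<^sub>F u in at t within {0..1}. u \<in> {0..1}"
    by (simp add: eventually_at_filter)
  ultimately show ?thesis
  proof eventually_elim
    case (elim u)
    have "d (\<gamma> (p i)) (\<gamma> (p (Suc i))) \<le> d (\<gamma> (P u (p i))) (\<gamma> (P u (p (Suc i))))
        + (d (\<gamma> (P u (p i))) (\<gamma> (p i)) + d (\<gamma> (P u (p (Suc i)))) (\<gamma> (p (Suc i))))" for i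
    proof -
      have sym: "d x y = d y x" and tri: "d x z \<le> d x y + d y z" for x y z
        using d unfolding extended_distance_def by blast+
      have "d (\<gamma> (p i)) (\<gamma> (p (Suc i))) \<le> d (\<gamma> (p i)) (\<gamma> (P u (p i))) + d (\<gamma> (P u (p i))) (\<gamma> (p (Suc i)))"
        by (rule tri)
      also have "\<dots> \<le> d (\<gamma> (P u (p i))) (\<gamma> (p i)) +
          (d (\<gamma> (P u (p i))) (\<gamma> (P u (p (Suc i)))) + d (\<gamma> (P u (p (Suc i)))) (\<gamma> (p (Suc i))))"
        by (intro add_mono tri) (simp add: sym)
      finally show ?thesis
        by (simp add: ac_simps)
    qed
    then have "(\<Sum>i<n. d (\<gamma> (p i)) (\<gamma> (p (Suc i)))) \<le> (\<Sum>i<n. d (\<gamma> (P u (p i))) (\<gamma> (P u (p (Suc i))))) + e u"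
      unfolding e_def sum.distrib[symmetric] by (intro sum_mono) auto
    also have "\<dots> \<le> variation d \<gamma> (lo u) (hi u) + e u"
    proof (intro add_right_mono variation_upper[where t="\<lambda>i. P u (p i)"])
      show "mono_on {..n} (\<lambda>i. P u (p i))"
        using p(1) unfolding P_def mono_on_def by (meson max.mono min.mono order_refl)
      show "(\<lambda>i. P u (p i)) ` {..n} \<subseteq> {lo u..hi u}"
        using lohi[OF elim(2)] unfolding P_def by auto
    qed
    \<comment> \<open>Distances may be infinite, so the error \<open>e u\<close> is kept on both
      sides and cancelled by monotonicity rather than subtracted.\<close>
    finally have "C + e u < variation d \<gamma> (lo u) (hi u) + e u"
      by (rule less_le_trans[OF elim(1)])
    then show "C < variation d \<gamma> (lo u) (hi u)"
      by (meson add_right_mono not_le)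
  qed
qed

text \<open>The lengths before and after \<open>t\<close> are both lower semicontinuous and add up
  to a finite constant, so each of them is upper semicontinuous too.\<close>

lemma variation_continuous:
  assumes d: "extended_distance d" and c: "d_continuous d \<gamma>" and fin: "variation d \<gamma> 0 1 < \<infinity>"
  shows "continuous_on {0..1} (\<lambda>t. variation d \<gamma> 0 t)"
  unfolding continuous_on_def
proof (intro ballI order_tendstoI)
  fix t :: real and C assume t: "t \<in> {0..1}"
  {
    assume "C < variation d \<gamma> 0 t"
    with variation_lower_semicontinuous[OF d c, of "\<lambda>_. 0" "\<lambda>u. u" t C]
    show "\<forall>\<^sub>F u in at t within {0..1}. C < variation d \<gamma> 0 u"
      using t by auto
  next
    assume C: "variation d \<gamma> 0 t < C"
    have split: "variation d \<gamma> 0 1 = variation d \<gamma> 0 u + variation d \<gamma> u 1" if "u \<in> {0..1}" for u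
      using that by (intro variation_add[OF d]) auto
    have in01: "\<forall>\<^sub>F u in at t within {0..1}. u \<in> {0..1::real}"
      by (simp add: eventually_at_filter)
    show "\<forall>\<^sub>F u in at t within {0..1}. variation d \<gamma> 0 u < C"
    proof (cases "variation d \<gamma> 0 1 < C")
      case True
      from in01 show ?thesis
      proof eventually_elim
        case (elim u)
        then show ?case
          using True variation_subinterval_mono[of 0 0 u 1 d \<gamma>] by auto
      qed
    next
      case False
      then have C1: "C \<le> variation d \<gamma> 0 1" "C < \<infinity>"
        using fin by auto
      \<comment> \<open>As \<open>C\<close> is at most the finite total length, an upper bound on
        the length before a point can be rewritten as a lower bound on the length after it.\<close>
      have "variation d \<gamma> 0 1 - C < variation d \<gamma> t 1"
        using C C1 fin unfolding split[OF t]
        by (cases "variation d \<gamma> 0 t"; cases "variation d \<gamma> t 1"; cases C)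
          (auto simp: ennreal_plus[symmetric] ennreal_minus ennreal_less_iff simp del: ennreal_plus)
      then have "\<forall>\<^sub>F u in at t within {0..1}. variation d \<gamma> 0 1 - C < variation d \<gamma> u 1"
        using variation_lower_semicontinuous[OF d c, of "\<lambda>u. u" "\<lambda>_. 1" t] t by auto
      with in01 show ?thesis
      proof eventually_elim
        case (elim u)
        then show ?case
          using C1 fin unfolding split[OF elim(1)]
          by (cases "variation d \<gamma> 0 u"; cases "variation d \<gamma> u 1"; cases C)
            (auto simp: ennreal_plus[symmetric] ennreal_minus ennreal_less_iff simp del: ennreal_plus)
      qed
    qed
  }
qed

section \<open>Constant speed representatives and the topology of arcs\<close>

lemma id_reparametrization: "(\<lambda>t. t) \<in> reparametrizations"
  by (auto simp: reparametrizations_def mono_on_def)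

lemma curve_rel_refl: "\<gamma> \<in> curves \<Longrightarrow> (\<gamma>, \<gamma>) \<in> curve_rel"
  unfolding curve_rel_def using id_reparametrization by blast

lemma curve_relE:
  assumes "(\<gamma>, \<sigma>) \<in> curve_rel"
  obtains \<phi> \<psi> where "\<gamma> \<in> curves" "\<sigma> \<in> curves" "\<phi> \<in> reparametrizations" "\<psi> \<in> reparametrizations"
    "\<And>t. t \<in> {0..1} \<Longrightarrow> \<gamma> (\<phi> t) = \<sigma> (\<psi> t)"
  using assms unfolding curve_rel_def by blast

lemma reparametrization_preimage:
  assumes "\<phi> \<in> reparametrizations" "s \<in> {0..1}"
  obtains t where "t \<in> {0..1}" "\<phi> t = s"
  using reparametrizationsD(3)[OF assms(1)] assms(2) by (metis imageE)

lemma reparametrization_bounds: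
  assumes "\<phi> \<in> reparametrizations" "t \<in> {0..1}"
  shows "0 \<le> \<phi> t" "\<phi> t \<le> 1"
  using reparametrizationsD(3)[OF assms(1)] assms(2) by auto

lemma variation_curve_rel:
  assumes "(\<gamma>, \<sigma>) \<in> curve_rel"
  shows "variation d \<gamma> 0 1 = variation d \<sigma> 0 1"
proof -
  from assms obtain \<phi> \<psi> where *: "\<phi> \<in> reparametrizations" "\<psi> \<in> reparametrizations"
    "\<And>t. t \<in> {0..1} \<Longrightarrow> \<gamma> (\<phi> t) = \<sigma> (\<psi> t)"
    by (rule curve_relE) blast
  have "variation d \<gamma> (\<phi> 0) (\<phi> 1) = variation d (\<lambda>t. \<gamma> (\<phi> t)) 0 1"
    by (rule variation_reparametrize[OF *(1), symmetric]) auto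
  also have "\<dots> = variation d (\<lambda>t. \<sigma> (\<psi> t)) 0 1"
    by (rule variation_cong) (use * in auto)
  also have "\<dots> = variation d \<sigma> (\<psi> 0) (\<psi> 1)"
    by (rule variation_reparametrize[OF *(2)]) auto
  finally show ?thesis
    using *(1,2)[THEN reparametrizationsD(4)] *(1,2)[THEN reparametrizationsD(5)] by simp
qed

lemma zero_variation_constant:
  assumes d: "extended_distance d" and "variation d \<gamma> 0 1 = 0" "s \<in> {0..1}" "t \<in> {0..1}"
  shows "\<gamma> s = \<gamma> t"
proof -
  have "d (\<gamma> s) (\<gamma> t) \<le> variation d \<gamma> 0 1" if "s \<le> t" "s \<in> {0..1}" "t \<in> {0..1}" for s t
    using that by (intro dist_le_variation) auto
  then have "d (\<gamma> s) (\<gamma> t) = 0" if "s \<le> t" "s \<in> {0..1}" "t \<in> {0..1}" for s t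
    using that assms(2) by force
  then show ?thesis
    using assms linear[of s t] unfolding extended_distance_def by metis
qed

text \<open>The normalised length \<open>\<psi>\<close> is a reparametrization, and
  \<open>\<gamma>\<close> is constant wherever \<open>\<psi>\<close> is, so \<open>\<gamma>\<close>
  factors as \<open>R\<close> after \<open>\<psi>\<close>. In this way \<open>R\<close> has
  travelled the fraction \<open>s\<close> of the length at time \<open>s\<close>.\<close>

lemma constant_speed_exists:
  assumes d: "extended_distance d" and \<gamma>: "\<gamma> \<in> curves" "d_continuous d \<gamma>" "variation d \<gamma> 0 1 < \<infinity>"
  obtains R where "(\<gamma>, R) \<in> curve_rel"
    "\<And>t. t \<in> {0..1} \<Longrightarrow> variation d R 0 t = variation d \<gamma> 0 1 * ennreal t"
proof (cases "variation d \<gamma> 0 1 = 0")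
  case True
  \<comment> \<open>A curve of length zero has constant speed already, and dividing by its length
    would be meaningless.\<close>
  have "variation d \<gamma> 0 t = 0" if "t \<in> {0..1}" for t
    using variation_subinterval_mono[of 0 0 t 1 d \<gamma>] that True by auto
  then show thesis
    using that[of \<gamma>] curve_rel_refl[OF \<gamma>(1)] True by auto
next
  case False
  define l where "l = enn2real (variation d \<gamma> 0 1)"
  have l: "variation d \<gamma> 0 1 = ennreal l" "0 < l"
    using \<gamma>(3) False unfolding l_def
    by (simp_all add: less_top[symmetric] enn2real_positive_iff zero_less_iff_neq_zero)
  define V where "V t = enn2real (variation d \<gamma> 0 t)" for t
  have V: "variation d \<gamma> 0 t = ennreal (V t)" if "t \<le> 1" for t
  proof -
    have "variation d \<gamma> 0 t < top"
      using variation_subinterval_mono[of 0 0 t 1 d \<gamma>] that \<gamma>(3) by (simp add: le_less_trans)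
    then show ?thesis
      unfolding V_def by simp
  qed
  define \<psi> where "\<psi> t = V t / l" for t
  have "continuous_on {0..1} V"
    unfolding continuous_on_def
  proof (rule ballI)
    fix t :: real assume "t \<in> {0..1}"
    then have "((\<lambda>t. variation d \<gamma> 0 t) \<longlongrightarrow> variation d \<gamma> 0 t) (at t within {0..1})"
      using variation_continuous[OF d \<gamma>(2,3)] unfolding continuous_on_def by blast
    then have "((\<lambda>t. variation d \<gamma> 0 t) \<longlongrightarrow> ennreal (V t)) (at t within {0..1})"
      using V[of t] \<open>t \<in> {0..1}\<close> by simp
    then show "(V \<longlongrightarrow> V t) (at t within {0..1})"
      unfolding V_def by (intro tendsto_enn2real) auto
  qed
  then have \<psi>c: "continuous_on {0..1} \<psi>"
    unfolding \<psi>_def by (intro continuous_intros) (use l in auto)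
  have V_nonneg: "0 \<le> V t" for t
    unfolding V_def by simp
  have "V s \<le> V t" if "s \<le> t" "t \<le> 1" for s t
    using variation_subinterval_mono[of 0 0 s t d \<gamma>] V[of s] V[of t] that V_nonneg
    by (simp add: ennreal_le_iff)
  then have \<psi>m: "mono_on {0..1} \<psi>"
    unfolding \<psi>_def by (intro mono_onI divide_right_mono) (use l in auto)
  have "V 0 = 0" "V 1 = l"
    by (simp_all add: V_def l_def variation_refl[OF d])
  then have "\<psi> 0 = 0" "\<psi> 1 = 1"
    using l(2) unfolding \<psi>_def by auto
  then have \<psi>i: "\<psi> ` {0..1} = {0..1}"
    using mono_on_image_Icc[OF _ \<psi>c \<psi>m] by simp
  then have \<psi>: "\<psi> \<in> reparametrizations"
    using \<psi>c \<psi>m unfolding reparametrizations_def by blast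
  have \<psi>V: "variation d \<gamma> 0 t = ennreal (l * \<psi> t)" if "t \<in> {0..1}" for t
    using V[of t] l that unfolding \<psi>_def by simp
  have \<gamma>_eq: "\<gamma> s = \<gamma> t" if "\<psi> s = \<psi> t" "s \<in> {0..1}" "t \<in> {0..1}" for s t
  proof -
    have "\<gamma> s = \<gamma> t" if "\<psi> s = \<psi> t" "s \<in> {0..1}" "t \<in> {0..1}" "s \<le> t" for s t
    proof -
      have "variation d \<gamma> 0 t = variation d \<gamma> 0 s + variation d \<gamma> s t"
        using that by (intro variation_add[OF d]) auto
      then have "variation d \<gamma> s t = 0"
        using that \<psi>V[of s] \<psi>V[of t] by simp
      then have "d (\<gamma> s) (\<gamma> t) = 0"
        using dist_le_variation[of s s t t d \<gamma>] that by simp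
      then show ?thesis
        using d unfolding extended_distance_def by blast
    qed
    then show ?thesis
      using that linear[of s t] by metis
  qed
  define R where "R = restrict (\<lambda>s. \<gamma> (inv_into {0..1} \<psi> s)) {0..1}"
  have R: "R (\<psi> t) = \<gamma> t" if "t \<in> {0..1}" for t
  proof -
    have "\<psi> t \<in> \<psi> ` {0..1}"
      using that by blast
    then have "\<psi> (inv_into {0..1} \<psi> (\<psi> t)) = \<psi> t" "inv_into {0..1} \<psi> (\<psi> t) \<in> {0..1}"
      by (rule f_inv_into_f, rule inv_into_into)
    then show ?thesis
      using \<gamma>_eq[of "inv_into {0..1} \<psi> (\<psi> t)" t] that \<psi>i \<open>\<psi> t \<in> \<psi> ` {0..1}\<close> unfolding R_def by simp
  qed
  \<comment> \<open>\<open>\<psi>\<close> is a continuous map of the compact interval onto itself,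
    so closed sets pull back under \<open>R\<close> to images of compact sets. This needs no metric
    for the topology of the target.\<close>
  have "continuous_on {0..1} R"
    unfolding continuous_on_closed_vimage[OF closed_real_atLeastAtMost]
  proof (intro allI impI)
    fix B :: "'a set" assume "closed B"
    have \<gamma>c: "continuous_on {0..1} \<gamma>"
      using \<gamma>(1) unfolding curves_def by blast
    have "closed (\<gamma> -` B \<inter> {0..1})"
      using continuous_on_closed_vimage[OF closed_real_atLeastAtMost] \<gamma>c \<open>closed B\<close> by blast
    then have "compact (\<gamma> -` B \<inter> {0..1})"
      by (meson bounded_closed_interval bounded_subset compact_eq_bounded_closed inf_le2)
    then have "compact (\<psi> ` (\<gamma> -` B \<inter> {0..1}))"
      by (intro compact_continuous_image continuous_on_subset[OF \<psi>c]) auto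
    moreover have "\<psi> ` (\<gamma> -` B \<inter> {0..1}) = R -` B \<inter> {0..1}"
    proof
      show "\<psi> ` (\<gamma> -` B \<inter> {0..1}) \<subseteq> R -` B \<inter> {0..1}"
        using R \<psi>i by auto
      show "R -` B \<inter> {0..1} \<subseteq> \<psi> ` (\<gamma> -` B \<inter> {0..1})"
      proof
        fix s assume s: "s \<in> R -` B \<inter> {0..1}"
        then obtain t where "t \<in> {0..1}" "s = \<psi> t"
          using \<psi>i by blast
        then show "s \<in> \<psi> ` (\<gamma> -` B \<inter> {0..1})"
          using s R[of t] by auto
      qed
    qed
    ultimately show "closed (R -` B \<inter> {0..1})"
      using compact_imp_closed by metis
  qed
  then have "R \<in> curves"
    unfolding curves_def R_def by auto
  then have "(\<gamma>, R) \<in> curve_rel"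
    unfolding curve_rel_def using \<gamma>(1) R \<psi> id_reparametrization
    by (intro CollectI case_prodI conjI bexI[of _ "\<lambda>t. t"] bexI[of _ \<psi>] ballI) (simp_all only: R)
  moreover have "variation d R 0 s = variation d \<gamma> 0 1 * ennreal s" if s: "s \<in> {0..1}" for s
  proof -
    obtain t where t: "t \<in> {0..1}" "\<psi> t = s"
      using reparametrization_preimage[OF \<psi> s] .
    have "variation d R (\<psi> 0) (\<psi> t) = variation d (\<lambda>t. R (\<psi> t)) 0 t"
      by (rule variation_reparametrize[OF \<psi>, symmetric]) (use t in auto)
    also have "\<dots> = variation d \<gamma> 0 t"
      by (rule variation_cong) (use R t in auto)
    also have "\<dots> = ennreal l * ennreal s"
      using \<psi>V[OF t(1)] t s l by (simp add: ennreal_mult)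
    finally show ?thesis
      using t \<open>\<psi> 0 = 0\<close> l by simp
  qed
  ultimately show thesis
    using that by blast
qed

text \<open>The travelled length determines the time: where
  \<open>\<gamma> (\<phi> t) = S (\<psi> t)\<close>, the length of \<open>\<gamma>\<close> up to
  \<open>\<phi> t\<close> is the fraction \<open>\<psi> t\<close> of the total. Points of
  \<open>R\<close> and \<open>R'\<close> that come from the same point of \<open>\<gamma>\<close>
  therefore have the same time. Both are compared with \<open>\<gamma>\<close>, so transitivity of
  \<open>curve_rel\<close> does not enter.\<close>

lemma constant_speed_unique:
  assumes d: "extended_distance d" and fin: "variation d \<gamma> 0 1 < \<infinity>"
    and R: "(\<gamma>, R) \<in> curve_rel" "\<And>t. t \<in> {0..1} \<Longrightarrow> variation d R 0 t = variation d \<gamma> 0 1 * ennreal t"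
    and R': "(\<gamma>, R') \<in> curve_rel" "\<And>t. t \<in> {0..1} \<Longrightarrow> variation d R' 0 t = variation d \<gamma> 0 1 * ennreal t"
  shows "R = R'"
proof -
  have key: "variation d \<gamma> 0 (\<phi> t) = variation d \<gamma> 0 1 * ennreal (\<psi> t)"
    if \<phi>: "\<phi> \<in> reparametrizations" and \<psi>: "\<psi> \<in> reparametrizations"
      and eq: "\<And>t. t \<in> {0..1} \<Longrightarrow> \<gamma> (\<phi> t) = S (\<psi> t)" and t: "t \<in> {0..1}"
      and S: "\<And>t. t \<in> {0..1} \<Longrightarrow> variation d S 0 t = variation d \<gamma> 0 1 * ennreal t" for S \<phi> \<psi> t
  proof -
    have "variation d \<gamma> (\<phi> 0) (\<phi> t) = variation d (\<lambda>t. \<gamma> (\<phi> t)) 0 t"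
      by (rule variation_reparametrize[OF \<phi>, symmetric]) (use t in auto)
    also have "\<dots> = variation d (\<lambda>t. S (\<psi> t)) 0 t"
      by (rule variation_cong) (use t eq in auto)
    also have "\<dots> = variation d S (\<psi> 0) (\<psi> t)"
      by (rule variation_reparametrize[OF \<psi>]) (use t in auto)
    finally show ?thesis
      using reparametrizationsD(4)[OF \<phi>] reparametrizationsD(4)[OF \<psi>] S[of "\<psi> t"]
        reparametrization_bounds[OF \<psi> t] by simp
  qed
  obtain \<phi> \<psi> where 1: "\<phi> \<in> reparametrizations" "\<psi> \<in> reparametrizations"
    "\<And>t. t \<in> {0..1} \<Longrightarrow> \<gamma> (\<phi> t) = R (\<psi> t)" and "R \<in> curves"
    using R(1) by (rule curve_relE) blast
  obtain \<phi>' \<psi>' where 2: "\<phi>' \<in> reparametrizations" "\<psi>' \<in> reparametrizations"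
    "\<And>t. t \<in> {0..1} \<Longrightarrow> \<gamma> (\<phi>' t) = R' (\<psi>' t)" and "R' \<in> curves"
    using R'(1) by (rule curve_relE) blast
  have "R s = R' s" if s: "s \<in> {0..1}" for s
  proof -
    obtain t where t: "t \<in> {0..1}" "\<psi> t = s"
      using reparametrization_preimage[OF 1(2) s] .
    have \<phi>t: "\<phi> t \<in> {0..1}"
      using reparametrization_bounds[OF 1(1) t(1)] by simp
    show ?thesis
    proof (cases "variation d \<gamma> 0 1 = 0")
      case True
      obtain t' where t': "t' \<in> {0..1}" "\<psi>' t' = s"
        using reparametrization_preimage[OF 2(2) s] .
      have "\<phi>' t' \<in> {0..1}"
        using reparametrization_bounds[OF 2(1) t'(1)] by simp
      then have "\<gamma> (\<phi> t) = \<gamma> (\<phi>' t')"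
        using zero_variation_constant[OF d True \<phi>t] by blast
      then show ?thesis
        using 1(3) 2(3) t t' by simp
    next
      case False
      obtain t' where t': "t' \<in> {0..1}" "\<phi>' t' = \<phi> t"
        using reparametrization_preimage[OF 2(1) \<phi>t] .
      have "variation d \<gamma> 0 1 * ennreal s = variation d \<gamma> 0 1 * ennreal (\<psi>' t')"
        using key[OF 1 t(1) R(2)] key[OF 2 t'(1) R'(2)] t t' by simp
      then have "\<psi>' t' = s"
        using False fin s reparametrization_bounds[OF 2(2) t'(1)]
        by (auto simp: ennreal_mult_cancel_left)
      then show ?thesis
        using 1(3)[OF t(1)] 2(3)[OF t'(1)] t t' by simp
    qed
  qed
  then show ?thesis
    using \<open>R \<in> curves\<close> \<open>R' \<in> curves\<close> unfolding curves_def by (auto intro: extensionalityI)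
qed

text \<open>The last clause replaces transitivity of \<open>curve_rel\<close>: an arc is the set of
  curves related to one curve, and comparison through that curve is enough for invariant
  properties.\<close>

lemma arc_rep_props:
  assumes d: "extended_distance d" and "\<Gamma> \<in> RA d"
  shows "arc_length d \<Gamma> < \<infinity>" and "arc_rep d \<Gamma> \<in> \<Gamma>" and "arc_rep d \<Gamma> \<in> curves"
    and "\<And>t. t \<in> {0..1} \<Longrightarrow> variation d (arc_rep d \<Gamma>) 0 t = arc_length d \<Gamma> * ennreal t"
    and "\<And>\<gamma>. \<gamma> \<in> \<Gamma> \<Longrightarrow> \<exists>\<gamma>\<^sub>0. (\<gamma>\<^sub>0, \<gamma>) \<in> curve_rel \<and> (\<gamma>\<^sub>0, arc_rep d \<Gamma>) \<in> curve_rel"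
proof -
  from assms(2) obtain \<gamma> where \<gamma>: "\<gamma> \<in> curves" "d_continuous d \<gamma>" "variation d \<gamma> 0 1 < \<infinity>"
    and \<Gamma>: "\<Gamma> = curve_rel `` {\<gamma>}"
    unfolding RA_def by blast
  have "\<exists>\<sigma>. \<sigma> \<in> \<Gamma>"
    using curve_rel_refl[OF \<gamma>(1)] \<Gamma> by blast
  then have "(SOME \<sigma>. \<sigma> \<in> \<Gamma>) \<in> \<Gamma>"
    by (rule someI_ex)
  then have len: "arc_length d \<Gamma> = variation d \<gamma> 0 1"
    unfolding arc_length_def \<Gamma> using variation_curve_rel by fastforce
  obtain R where R: "(\<gamma>, R) \<in> curve_rel"
    "\<And>t. t \<in> {0..1} \<Longrightarrow> variation d R 0 t = variation d \<gamma> 0 1 * ennreal t"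
    using constant_speed_exists[OF d \<gamma>] by blast
  have rep: "arc_rep d \<Gamma> = R"
    unfolding arc_rep_def
  proof (rule the_equality)
    show "R \<in> \<Gamma> \<and> (\<forall>t\<in>{0..1}. variation d R 0 t = arc_length d \<Gamma> * ennreal t)"
      using R \<Gamma> len by auto
    show "S = R" if "S \<in> \<Gamma> \<and> (\<forall>t\<in>{0..1}. variation d S 0 t = arc_length d \<Gamma> * ennreal t)" for S
      using that R \<Gamma> len by (intro constant_speed_unique[OF d \<gamma>(3)]) auto
  qed
  show "arc_length d \<Gamma> < \<infinity>" "arc_rep d \<Gamma> \<in> \<Gamma>" "arc_rep d \<Gamma> \<in> curves"
    "\<And>t. t \<in> {0..1} \<Longrightarrow> variation d (arc_rep d \<Gamma>) 0 t = arc_length d \<Gamma> * ennreal t"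
    using len \<gamma>(3) rep R \<Gamma> by (auto elim: curve_relE)
  show "\<exists>\<gamma>\<^sub>0. (\<gamma>\<^sub>0, \<gamma>') \<in> curve_rel \<and> (\<gamma>\<^sub>0, arc_rep d \<Gamma>) \<in> curve_rel" if "\<gamma>' \<in> \<Gamma>" for \<gamma>'
    using that R rep \<Gamma> by blast
qed

lemma arc_rep_continuous:
  assumes "extended_distance d" "\<Gamma> \<in> RA d"
  shows "continuous_on {0..1} (arc_rep d \<Gamma>)"
  using arc_rep_props(3)[OF assms] unfolding curves_def by blast

lemma arc_rep_speed:
  assumes d: "extended_distance d" and \<Gamma>: "\<Gamma> \<in> RA d" and "0 \<le> s" "s \<le> t" "t \<le> 1"
  shows "variation d (arc_rep d \<Gamma>) s t = arc_length d \<Gamma> * ennreal (t - s)"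
proof -
  note rep = arc_rep_props[OF d \<Gamma>]
  obtain l where l: "arc_length d \<Gamma> = ennreal l" "0 \<le> l"
    using rep(1) by (cases "arc_length d \<Gamma>") auto
  have "variation d (arc_rep d \<Gamma>) 0 t = variation d (arc_rep d \<Gamma>) 0 s + variation d (arc_rep d \<Gamma>) s t"
    using assms by (intro variation_add[OF d]) auto
  then have "ennreal (l * t) = ennreal (l * s) + variation d (arc_rep d \<Gamma>) s t"
    using rep(4)[of s] rep(4)[of t] assms l by (simp add: ennreal_mult)
  then have "variation d (arc_rep d \<Gamma>) s t = ennreal (l * t) - ennreal (l * s)"
    by simp
  also have "\<dots> = ennreal (l * (t - s))"
    using l assms by (simp add: ennreal_minus right_diff_distrib)
  finally show ?thesis
    using l assms by (simp add: ennreal_mult)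
qed

lemma arc_rep_dist:
  assumes d: "extended_distance d" and \<Gamma>: "\<Gamma> \<in> RA d" and "s \<in> {0..1}" "t \<in> {0..1}"
  shows "d (arc_rep d \<Gamma> s) (arc_rep d \<Gamma> t) \<le> ennreal (enn2real (arc_length d \<Gamma>) * \<bar>t - s\<bar>)"
proof -
  have *: "d (arc_rep d \<Gamma> s) (arc_rep d \<Gamma> t) \<le> ennreal (enn2real (arc_length d \<Gamma>) * \<bar>t - s\<bar>)"
    if "s \<le> t" "0 \<le> s" "t \<le> 1" for s t
    using dist_le_variation[of s s t t d "arc_rep d \<Gamma>"] arc_rep_speed[OF d \<Gamma>, of s t] that
      arc_rep_props(1)[OF d \<Gamma>] by (simp add: ennreal_mult)
  show ?thesis
    using *[of s t] *[of t s] assms linear[of s t] unfolding extended_distance_def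
    by (auto simp: abs_minus_commute)
qed

section \<open>Open conditions on curves and their descent to arcs\<close>

lemma topspace_curve_topology: "topspace curve_topology = curves"
proof -
  have "curves \<in> {{\<gamma> \<in> curves. \<gamma> ` K \<subseteq> V} | K V. compact K \<and> K \<subseteq> {0..1::real} \<and> open V}"
    by (intro CollectI exI[of _ "{}"]) auto
  then show ?thesis
    unfolding curve_topology_def topology_generated_by_topspace by blast
qed

lemma openin_curves_image_subset:
  assumes "compact K" "K \<subseteq> {0..1}" "open V"
  shows "openin curve_topology {\<gamma> \<in> curves. \<gamma> ` K \<subseteq> V}"
  unfolding curve_topology_def using assms by (intro topology_generated_by_Basis) blast

lemma topspace_RA_topology:
  fixes d :: "'a::topological_space \<Rightarrow> 'a \<Rightarrow> ennreal"
  shows "topspace (RA_topology d) = RA d"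
proof -
  let ?Q = "curves // curve_rel :: (real \<Rightarrow> 'a) set set"
  have "{\<gamma> :: real \<Rightarrow> 'a. \<gamma> \<in> topspace curve_topology \<and> curve_rel `` {\<gamma>} \<in> topspace curve_topology // curve_rel} = topspace curve_topology"
    by (auto intro: quotientI)
  then have "openin arc_topology ?Q"
    unfolding arc_topology_def openin_quotient_topology topspace_curve_topology[symmetric]
    by (simp only: openin_topspace order_refl simp_thms)
  moreover have "topspace arc_topology \<subseteq> ?Q"
    using openin_topspace[of arc_topology]
    unfolding arc_topology_def openin_quotient_topology topspace_curve_topology by (rule conjunct1)
  ultimately have "topspace arc_topology = ?Q"
    using openin_subset by blast
  moreover have "RA d \<subseteq> ?Q"
    unfolding RA_def by (auto intro: quotientI)
  ultimately show ?thesis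
    unfolding RA_topology_def by auto
qed

definition reparametrization_invariant :: "((real \<Rightarrow> 'a::topological_space) \<Rightarrow> bool) \<Rightarrow> bool" where
  "reparametrization_invariant P \<longleftrightarrow> (\<forall>\<gamma> \<sigma>. (\<gamma>, \<sigma>) \<in> curve_rel \<longrightarrow> P \<gamma> = P \<sigma>)"

text \<open>The two composed curves agree on \<open>{0..1}\<close> only and need not be extensional.
  Hence the second hypothesis, and hence \<open>P\<close> is tested on arbitrary functions instead
  of members of \<open>curves\<close>.\<close>

lemma reparametrization_invariantI:
  assumes "\<And>\<gamma> \<phi>. \<phi> \<in> reparametrizations \<Longrightarrow> P (\<lambda>t. \<gamma> (\<phi> t)) \<longleftrightarrow> P \<gamma>"
    and "\<And>\<gamma> \<sigma>. (\<And>t. t \<in> {0..1} \<Longrightarrow> \<gamma> t = \<sigma> t) \<Longrightarrow> P \<gamma> \<Longrightarrow> P \<sigma>"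
  shows "reparametrization_invariant P"
  unfolding reparametrization_invariant_def
proof (intro allI impI)
  fix \<gamma> \<sigma> :: "real \<Rightarrow> 'a" assume "(\<gamma>, \<sigma>) \<in> curve_rel"
  then obtain \<phi> \<psi> where *: "\<phi> \<in> reparametrizations" "\<psi> \<in> reparametrizations"
    "\<And>t. t \<in> {0..1} \<Longrightarrow> \<gamma> (\<phi> t) = \<sigma> (\<psi> t)"
    by (rule curve_relE) blast
  have "P (\<lambda>t. \<gamma> (\<phi> t)) \<longleftrightarrow> P (\<lambda>t. \<sigma> (\<psi> t))"
    using assms(2)[of "\<lambda>t. \<gamma> (\<phi> t)" "\<lambda>t. \<sigma> (\<psi> t)"] assms(2)[of "\<lambda>t. \<sigma> (\<psi> t)" "\<lambda>t. \<gamma> (\<phi> t)"] *(3)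
    by metis
  then show "P \<gamma> = P \<sigma>"
    using assms(1)[OF *(1)] assms(1)[OF *(2)] by simp
qed

text \<open>Invariance makes the open set of curves saturated, so its image in the quotient is open.
  Any member of an arc may then be tested, in particular the constant speed representative, although
  that one does not depend continuously on the arc.\<close>

lemma openin_RA_topology:
  assumes d: "extended_distance d" and inv: "reparametrization_invariant P"
    and op: "openin curve_topology {\<gamma> \<in> curves. P \<gamma>}"
  shows "openin (RA_topology d) {\<Gamma> \<in> RA d. P (arc_rep d \<Gamma>)}"
proof -
  define U where "U = {\<Gamma> \<in> curves // curve_rel. \<exists>\<gamma>\<in>\<Gamma>. P \<gamma>}"
  have "{\<gamma> \<in> curves. curve_rel `` {\<gamma>} \<in> U} = {\<gamma> \<in> curves. P \<gamma>}"
    using inv curve_rel_refl unfolding U_def reparametrization_invariant_def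
    by (auto intro: quotientI)
  then have "openin arc_topology U"
    unfolding arc_topology_def openin_quotient_topology using op
    by (auto simp: topspace_curve_topology U_def)
  moreover have "{\<Gamma> \<in> RA d. P (arc_rep d \<Gamma>)} = U \<inter> RA d"
  proof -
    have "P (arc_rep d \<Gamma>) \<longleftrightarrow> (\<exists>\<gamma>\<in>\<Gamma>. P \<gamma>)" if "\<Gamma> \<in> RA d" for \<Gamma>
      using arc_rep_props(2,5)[OF d that] inv unfolding reparametrization_invariant_def by metis
    moreover have "RA d \<subseteq> curves // curve_rel"
      unfolding RA_def by (auto intro: quotientI)
    ultimately show ?thesis
      unfolding U_def by blast
  qed
  ultimately show ?thesis
    unfolding RA_topology_def openin_subtopology by blast
qed

section \<open>Evaluation of arcs and open sets\<close>

lemma continuous_map_curve_eval: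
  fixes f :: "'a::topological_space \<Rightarrow> real"
  assumes "t \<in> {0..1}" "continuous_on UNIV f"
  shows "continuous_map curve_topology euclidean (\<lambda>\<gamma>. f (\<gamma> t))"
  unfolding continuous_map_def
proof (intro conjI allI impI)
  fix U :: "real set" assume "openin euclidean U"
  then have "open (f -` U)"
    using assms(2) by (simp add: open_vimage)
  then have "openin curve_topology {\<gamma> \<in> curves. \<gamma> ` {t} \<subseteq> f -` U}"
    using assms(1) by (intro openin_curves_image_subset) auto
  then show "openin curve_topology {\<gamma> \<in> topspace curve_topology. f (\<gamma> t) \<in> U}"
    by (simp add: topspace_curve_topology)
qed simp

text \<open>A nearly optimal function is fixed for one summand at a time and moved into the
  accumulated constant \<open>a\<close>, which is why \<open>a\<close> is kept general in the
  induction. Working with strict inequalities covers infinite suprema as well.\<close>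

lemma sum_SUP_greater_choice:
  fixes v :: "nat \<Rightarrow> 'b \<Rightarrow> ennreal"
  assumes "F \<noteq> {}" "c < a + (\<Sum>i<n. SUP f\<in>F. v i f)"
  shows "\<exists>h. (\<forall>i. h i \<in> F) \<and> c < a + (\<Sum>i<n. v i (h i))"
  using assms(2)
proof (induction n arbitrary: a)
  case 0
  obtain f where "f \<in> F"
    using \<open>F \<noteq> {}\<close> by blast
  then show ?case
    using 0 by (intro exI[of _ "\<lambda>_. f"]) simp
next
  case (Suc n)
  let ?s = "\<Sum>i<n. SUP f\<in>F. v i f"
  have "c < (a + ?s) + (SUP f\<in>F. v n f)"
    using Suc.prems by (simp only: sum.lessThan_Suc add.assoc)
  then have "c < (SUP f\<in>F. (a + ?s) + v n f)"
    unfolding ennreal_SUP_add_right[OF \<open>F \<noteq> {}\<close>] .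
  then obtain f where f: "f \<in> F" "c < (a + ?s) + v n f"
    unfolding less_SUP_iff by blast
  have "a + x + y = a + y + x" for x y
    by (simp only: ac_simps)
  then have f2: "c < (a + v n f) + ?s"
    using f(2) by metis
  obtain h where h: "\<forall>i. h i \<in> F" "c < (a + v n f) + (\<Sum>i<n. v i (h i))"
    using Suc.IH[OF f2] by blast
  have "a + v n f + (\<Sum>i<n. v i (h i)) = a + (\<Sum>i<Suc n. v i ((h(n := f)) i))"
    by (simp add: add.assoc add.commute)
  then show ?case
    using h f(1) by (intro exI[of _ "h(n := f)"]) (metis fun_upd_apply)
qed

text \<open>\<open>d x y\<close> is the supremum of \<open>\<bar>f x - f y\<bar>\<close> over
  continuous functions. A partition sum above \<open>c\<close> may therefore be replaced by a finite
  sum of such differences, which is continuous for the compact-open topology and never exceeds the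
  variation.\<close>

lemma openin_variation_greater:
  fixes d :: "'a::t2_space \<Rightarrow> 'a \<Rightarrow> ennreal"
  assumes X: "ext_metric_top_space d" and "0 \<le> p" "q \<le> 1"
  shows "openin curve_topology {\<gamma> \<in> curves. c < variation d \<gamma> p q}"
proof (subst openin_subopen, intro ballI)
  fix \<gamma> assume "\<gamma> \<in> {\<gamma> \<in> curves. c < variation d \<gamma> p q}"
  then have \<gamma>: "\<gamma> \<in> curves" "c < variation d \<gamma> p q"
    by auto
  define F where "F = {f \<in> Lipb d. Lip d UNIV f \<le> 1}"
  have dF: "d x y = (SUP f\<in>F. ennreal \<bar>f x - f y\<bar>)" for x y
    using X unfolding ext_metric_top_space_def F_def by blast
  have "Lip d UNIV (\<lambda>_. 0) \<le> 0"
    unfolding Lip_def by (rule Sup_least) auto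
  then have "(\<lambda>_. 0) \<in> F"
    unfolding F_def Lipb_def by auto
  then have "F \<noteq> {}"
    by blast
  obtain n t where t: "mono_on {..n} t" "t ` {..n} \<subseteq> {p..q}"
    and S: "c < (\<Sum>i<n. d (\<gamma> (t i)) (\<gamma> (t (Suc i))))"
    using \<gamma>(2) unfolding variation_def less_Sup_iff by auto
  have t01: "t i \<in> {0..1}" if "i \<le> n" for i
  proof -
    have "t i \<in> {p..q}"
      using t(2) that by blast
    then show ?thesis
      using assms(2,3) by simp
  qed
  obtain h where h: "\<And>i. h i \<in> F" "c < (\<Sum>i<n. ennreal \<bar>h i (\<gamma> (t i)) - h i (\<gamma> (t (Suc i)))\<bar>)"
    using sum_SUP_greater_choice[OF \<open>F \<noteq> {}\<close>, of c 0 "\<lambda>i f. ennreal \<bar>f (\<gamma> (t i)) - f (\<gamma> (t (Suc i)))\<bar>" n]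
      S unfolding dF by auto
  define G where "G \<sigma> = (\<Sum>i<n. \<bar>h i (\<sigma> (t i)) - h i (\<sigma> (t (Suc i)))\<bar>)" for \<sigma> :: "real \<Rightarrow> 'a"
  have G: "ennreal (G \<sigma>) = (\<Sum>i<n. ennreal \<bar>h i (\<sigma> (t i)) - h i (\<sigma> (t (Suc i)))\<bar>)" for \<sigma>
    unfolding G_def by (simp add: sum_ennreal)
  obtain c' where c': "c = ennreal c'" "0 \<le> c'"
    using h(2) G[of \<gamma>] by (cases c) auto
  have less_iff: "c < ennreal (G \<sigma>) \<longleftrightarrow> c' < G \<sigma>" for \<sigma>
    using c' by (simp add: ennreal_less_iff)
  have hc: "continuous_on UNIV (h i)" for i
    using h(1)[of i] unfolding F_def Lipb_def by blast
  have "continuous_map curve_topology euclidean (\<lambda>\<sigma>. \<bar>h i (\<sigma> (t i)) - h i (\<sigma> (t (Suc i)))\<bar>)" if "i < n" for i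
    using that
    by (intro continuous_map_real_abs continuous_map_diff continuous_map_curve_eval hc t01) simp_all
  then have "continuous_map curve_topology euclidean G"
    unfolding G_def by (intro continuous_map_sum) simp_all
  then have "openin curve_topology {\<sigma> \<in> topspace curve_topology. G \<sigma> \<in> {c'<..}}"
    by (rule openin_continuous_map_preimage) simp
  moreover have "\<gamma> \<in> {\<sigma> \<in> topspace curve_topology. G \<sigma> \<in> {c'<..}}"
    using \<gamma>(1) h(2) less_iff[of \<gamma>] G[of \<gamma>] by (simp add: topspace_curve_topology)
  moreover have "{\<sigma> \<in> topspace curve_topology. G \<sigma> \<in> {c'<..}} \<subseteq> {\<gamma> \<in> curves. c < variation d \<gamma> p q}"
  proof
    fix \<sigma> assume "\<sigma> \<in> {\<sigma> \<in> topspace curve_topology. G \<sigma> \<in> {c'<..}}"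
    then have \<sigma>: "\<sigma> \<in> curves" "c < ennreal (G \<sigma>)"
      using less_iff by (auto simp: topspace_curve_topology)
    note \<sigma>(2)
    also have "ennreal (G \<sigma>) \<le> (\<Sum>i<n. d (\<sigma> (t i)) (\<sigma> (t (Suc i))))"
      unfolding G
    proof (intro sum_mono)
      show "ennreal \<bar>h i (\<sigma> (t i)) - h i (\<sigma> (t (Suc i)))\<bar> \<le> d (\<sigma> (t i)) (\<sigma> (t (Suc i)))" for i
        unfolding dF by (rule SUP_upper[OF h(1)])
    qed
    also have "\<dots> \<le> variation d \<sigma> p q"
      using t by (rule variation_upper)
    finally show "\<sigma> \<in> {\<gamma> \<in> curves. c < variation d \<gamma> p q}"
      using \<sigma>(1) by simp
  qed
  ultimately show "\<exists>T. openin curve_topology T \<and> \<gamma> \<in> T \<and> T \<subseteq> {\<gamma> \<in> curves. c < variation d \<gamma> p q}"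
    by blast
qed

text \<open>The alternatives \<open>s = 1\<close> and \<open>r = 0\<close> are needed for the ends of an arc and for constant arcs,
  where the strict inequalities cannot hold.\<close>

definition portal ::
    "('a::topological_space \<Rightarrow> 'a \<Rightarrow> ennreal) \<Rightarrow> 'a set \<Rightarrow> real \<Rightarrow> real \<Rightarrow> (real \<Rightarrow> 'a) \<Rightarrow> bool" where
  "portal d V a b \<gamma> \<longleftrightarrow> (\<exists>r s. 0 \<le> r \<and> r \<le> s \<and> s \<le> 1 \<and> \<gamma> ` {r..s} \<subseteq> V \<and>
     (s = 1 \<or> ennreal a < variation d \<gamma> 0 s) \<and> (r = 0 \<or> ennreal b < variation d \<gamma> r 1))"

text \<open>Length and image transform well; the care goes into lifting an interval through a
  \<open>\<phi>\<close> that may be constant on intervals. An end \<open>0\<close> or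
  \<open>1\<close> has to be lifted to \<open>0\<close> or \<open>1\<close> itself, so that the
  exceptional alternative survives, and a single point has to be lifted to a single point, since two
  separate preimages might come in the wrong order.\<close>

lemma portal_invariant: "reparametrization_invariant (portal d V a b)"
proof (rule reparametrization_invariantI)
  fix \<gamma> :: "real \<Rightarrow> 'a" and \<phi> assume \<phi>: "\<phi> \<in> reparametrizations"
  note \<phi>D = reparametrizationsD[OF \<phi>]
  have image: "\<phi> ` {r..s} = {\<phi> r..\<phi> s}" if "0 \<le> r" "r \<le> s" "s \<le> 1" for r s
    using that by (intro mono_on_image_Icc continuous_on_subset[OF \<phi>D(1)] mono_on_subset[OF \<phi>D(2)]) auto
  have var: "variation d (\<lambda>t. \<gamma> (\<phi> t)) 0 s = variation d \<gamma> 0 (\<phi> s)"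
    "variation d (\<lambda>t. \<gamma> (\<phi> t)) s 1 = variation d \<gamma> (\<phi> s) 1" if "0 \<le> s" "s \<le> 1" for s
    using variation_reparametrize[OF \<phi>, of 0 s d \<gamma>] variation_reparametrize[OF \<phi>, of s 1 d \<gamma>] that \<phi>D(4,5) by auto
  have img: "(\<lambda>t. \<gamma> (\<phi> t)) ` {r..s} = \<gamma> ` {\<phi> r..\<phi> s}" if "0 \<le> r" "r \<le> s" "s \<le> 1" for r s
    unfolding image[OF that, symmetric] by (simp add: image_image)
  show "portal d V a b (\<lambda>t. \<gamma> (\<phi> t)) \<longleftrightarrow> portal d V a b \<gamma>"
  proof
    assume "portal d V a b (\<lambda>t. \<gamma> (\<phi> t))"
    then obtain r s where rs: "0 \<le> r" "r \<le> s" "s \<le> 1" "(\<lambda>t. \<gamma> (\<phi> t)) ` {r..s} \<subseteq> V"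
      "s = 1 \<or> ennreal a < variation d (\<lambda>t. \<gamma> (\<phi> t)) 0 s" "r = 0 \<or> ennreal b < variation d (\<lambda>t. \<gamma> (\<phi> t)) r 1"
      unfolding portal_def by blast
    have "\<phi> r \<le> \<phi> s"
      using rs by (intro mono_onD[OF \<phi>D(2)]) auto
    moreover have "0 \<le> \<phi> r" "\<phi> s \<le> 1"
      using reparametrization_bounds[OF \<phi>, of r] reparametrization_bounds[OF \<phi>, of s] rs(1-3) by simp_all
    moreover have "\<gamma> ` {\<phi> r..\<phi> s} \<subseteq> V"
      using rs(4) unfolding img[OF rs(1-3)] .
    moreover have "\<phi> s = 1 \<or> ennreal a < variation d \<gamma> 0 (\<phi> s)"
      using rs(5)
    proof
      assume "s = 1"
      then show ?thesis
        using \<phi>D(5) by simp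
    next
      assume "ennreal a < variation d (\<lambda>t. \<gamma> (\<phi> t)) 0 s"
      then show ?thesis
        using var(1)[of s] rs(1-3) by simp
    qed
    moreover have "\<phi> r = 0 \<or> ennreal b < variation d \<gamma> (\<phi> r) 1"
      using rs(6)
    proof
      assume "r = 0"
      then show ?thesis
        using \<phi>D(4) by simp
    next
      assume "ennreal b < variation d (\<lambda>t. \<gamma> (\<phi> t)) r 1"
      then show ?thesis
        using var(2)[of r] rs(1-3) by simp
    qed
    ultimately show "portal d V a b \<gamma>"
      unfolding portal_def by (intro exI[of _ "\<phi> r"] exI[of _ "\<phi> s"] conjI)
  next
    assume "portal d V a b \<gamma>"
    then obtain r s where rs: "0 \<le> r" "r \<le> s" "s \<le> 1" "\<gamma> ` {r..s} \<subseteq> V"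
      "s = 1 \<or> ennreal a < variation d \<gamma> 0 s" "r = 0 \<or> ennreal b < variation d \<gamma> r 1"
      unfolding portal_def by blast
    have "\<exists>r' s'. 0 \<le> r' \<and> r' \<le> s' \<and> s' \<le> 1 \<and> \<phi> r' = r \<and> \<phi> s' = s \<and> (s = 1 \<longrightarrow> s' = 1) \<and> (r = 0 \<longrightarrow> r' = 0)"
    proof -
      consider "r = 0" "s = 1" | "r = 0" "s \<noteq> 1" | "r \<noteq> 0" "s = 1" | "r \<noteq> 0" "s \<noteq> 1" "r = s" | "r \<noteq> 0" "s \<noteq> 1" "r < s"
        using rs(2) by linarith
      then show ?thesis
      proof cases
        case 1
        then show ?thesis
          using \<phi>D(4,5) by (intro exI[of _ 0] exI[of _ 1]) auto
      next
        case 2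
        obtain s' where "s' \<in> {0..1}" "\<phi> s' = s"
          by (rule reparametrization_preimage[OF \<phi>, of s]) (use rs(1-3) in auto)
        then show ?thesis
          using 2 \<phi>D(4) by (intro exI[of _ 0] exI[of _ s']) auto
      next
        case 3
        obtain r' where "r' \<in> {0..1}" "\<phi> r' = r"
          by (rule reparametrization_preimage[OF \<phi>, of r]) (use rs(1-3) in auto)
        then show ?thesis
          using 3 \<phi>D(5) by (intro exI[of _ r'] exI[of _ 1]) auto
      next
        case 4
        obtain r' where "r' \<in> {0..1}" "\<phi> r' = r"
          by (rule reparametrization_preimage[OF \<phi>, of r]) (use rs(1-3) in auto)
        then show ?thesis
          using 4 by (intro exI[of _ r'] exI[of _ r']) auto
      next
        case 5
        obtain r' where r': "r' \<in> {0..1}" "\<phi> r' = r"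
          by (rule reparametrization_preimage[OF \<phi>, of r]) (use rs(1-3) in auto)
        obtain s' where s': "s' \<in> {0..1}" "\<phi> s' = s"
          by (rule reparametrization_preimage[OF \<phi>, of s]) (use rs(1-3) in auto)
        have "r' \<le> s'"
        proof (rule ccontr)
          assume "\<not> r' \<le> s'"
          then have "\<phi> s' \<le> \<phi> r'"
            using r' s' by (intro mono_onD[OF \<phi>D(2)]) auto
          then show False
            using r' s' 5 by simp
        qed
        then show ?thesis
          using 5 r' s' by (intro exI[of _ r'] exI[of _ s']) auto
      qed
    qed
    then obtain r' s' where *: "0 \<le> r'" "r' \<le> s'" "s' \<le> 1" "\<phi> r' = r" "\<phi> s' = s" "s = 1 \<longrightarrow> s' = 1" "r = 0 \<longrightarrow> r' = 0"
      by (elim exE conjE)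
    have "(\<lambda>t. \<gamma> (\<phi> t)) ` {r'..s'} \<subseteq> V"
      using img[OF *(1-3)] rs(4) *(4,5) by simp
    moreover have "s' = 1 \<or> ennreal a < variation d (\<lambda>t. \<gamma> (\<phi> t)) 0 s'"
      using rs(5)
    proof
      assume "ennreal a < variation d \<gamma> 0 s"
      then show ?thesis
        using var(1)[of s'] *(1-3,5) by simp
    qed (use *(6) in blast)
    moreover have "r' = 0 \<or> ennreal b < variation d (\<lambda>t. \<gamma> (\<phi> t)) r' 1"
      using rs(6)
    proof
      assume "ennreal b < variation d \<gamma> r 1"
      then show ?thesis
        using var(2)[of r'] *(1-4) by simp
    qed (use *(7) in blast)
    ultimately show "portal d V a b (\<lambda>t. \<gamma> (\<phi> t))"
      unfolding portal_def using *(1-3) by (intro exI[of _ r'] exI[of _ s'] conjI)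
  qed
next
  fix \<gamma> \<sigma> :: "real \<Rightarrow> 'a" assume eq: "\<And>t. t \<in> {0..1} \<Longrightarrow> \<gamma> t = \<sigma> t" and "portal d V a b \<gamma>"
  then obtain r s where rs: "0 \<le> r" "r \<le> s" "s \<le> 1" "\<gamma> ` {r..s} \<subseteq> V"
    "s = 1 \<or> ennreal a < variation d \<gamma> 0 s" "r = 0 \<or> ennreal b < variation d \<gamma> r 1"
    unfolding portal_def by blast
  have "\<gamma> ` {r..s} = \<sigma> ` {r..s}"
    using eq rs(1-3) by (intro image_cong) auto
  moreover have "variation d \<gamma> 0 s = variation d \<sigma> 0 s" "variation d \<gamma> r 1 = variation d \<sigma> r 1"
    using eq rs(1-3) by (auto intro!: variation_cong)
  ultimately show "portal d V a b \<sigma>"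
    unfolding portal_def using rs by (intro exI[of _ r] exI[of _ s]) simp
qed

text \<open>For fixed \<open>r\<close> and \<open>s\<close> every condition is open: the first is
  subbasic and the length bounds are lower semicontinuous. The ends \<open>r\<close> and
  \<open>s\<close> range over uncountably many values, which is harmless for a union of open
  sets.\<close>

lemma openin_portal:
  fixes d :: "'a::t2_space \<Rightarrow> 'a \<Rightarrow> ennreal"
  assumes X: "ext_metric_top_space d" and V: "open V"
  shows "openin curve_topology {\<gamma> \<in> curves. portal d V a b \<gamma>}"
proof -
  have eq: "{\<gamma> \<in> curves. portal d V a b \<gamma>} = (\<Union>(r, s)\<in>{(r, s). 0 \<le> r \<and> r \<le> s \<and> s \<le> 1}.
     {\<gamma> \<in> curves. \<gamma> ` {r..s} \<subseteq> V} \<inter> {\<gamma> \<in> curves. s = 1 \<or> ennreal a < variation d \<gamma> 0 s} \<inter>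
     {\<gamma> \<in> curves. r = 0 \<or> ennreal b < variation d \<gamma> r 1})"
    (is "_ = (\<Union>(r, s)\<in>?I. ?S r s)")
    unfolding portal_def by blast
  have op: "openin curve_topology (?S r s)" if "0 \<le> r" "r \<le> s" "s \<le> 1" for r s
  proof -
    have C: "openin curve_topology (curves :: (real \<Rightarrow> 'a) set)"
      using openin_topspace[of "curve_topology :: (real \<Rightarrow> 'a) topology"] unfolding topspace_curve_topology .
    have "openin curve_topology {\<gamma> \<in> curves. s = 1 \<or> ennreal a < variation d \<gamma> 0 s}"
      using C openin_variation_greater[OF X, of 0 s "ennreal a"] that by (cases "s = 1") auto
    moreover have "openin curve_topology {\<gamma> \<in> curves. r = 0 \<or> ennreal b < variation d \<gamma> r 1}"
      using C openin_variation_greater[OF X, of r 1 "ennreal b"] that by (cases "r = 0") auto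
    ultimately show ?thesis
      using that by (intro openin_Int openin_curves_image_subset V) auto
  qed
  show ?thesis
    unfolding eq
  proof (intro openin_Union, elim imageE)
    fix A p assume "A = (case p of (r, s) \<Rightarrow> ?S r s)" "p \<in> ?I"
    then show "openin curve_topology A"
      using op[of "fst p" "snd p"] by (simp add: case_prod_beta)
  qed
qed

text \<open>Room on both sides, except at the ends of \<open>{0..1}\<close>, is what makes the
  length bounds in \<open>portal\<close> strict.\<close>

lemma exists_interval_around:
  fixes R :: "real \<Rightarrow> 'a::topological_space"
  assumes R: "continuous_on {0..1} R" and V: "open V" and rs: "0 \<le> r" "r \<le> s" "s \<le> 1" "R ` {r..s} \<subseteq> V"
  obtains r' s' where "0 \<le> r'" "r' \<le> r" "s \<le> s'" "s' \<le> 1" "R ` {r'..s'} \<subseteq> V"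
    "r' = 0 \<or> r' < r" "s' = 1 \<or> s < s'"
proof -
  obtain W where W: "open W" "W \<inter> {0..1} = R -` V \<inter> {0..1}"
    using R V unfolding continuous_on_open_invariant by blast
  have "r \<in> W" "s \<in> W"
    using W(2) rs by (auto simp: set_eq_iff image_subset_iff)
  then obtain e1 e2 where e: "0 < e1" "0 < e2" "ball r e1 \<subseteq> W" "ball s e2 \<subseteq> W"
    using W(1) open_contains_ball by metis
  define r' where "r' = max 0 (r - e1 / 2)"
  define s' where "s' = min 1 (s + e2 / 2)"
  have "R u \<in> V" if "u \<in> {r'..s'}" for u
  proof (cases "u \<in> {r..s}")
    case True
    then show ?thesis
      using rs(4) by blast
  next
    case False
    then have "u \<in> ball r e1 \<or> u \<in> ball s e2"
      using that e(1,2) unfolding r'_def s'_def by (auto simp: dist_real_def)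
    moreover have "u \<in> {0..1}"
      using that unfolding r'_def s'_def by auto
    ultimately show ?thesis
      using W(2) e(3,4) by blast
  qed
  then show thesis
    using that[of r' s'] rs e(1,2) unfolding r'_def s'_def by force
qed

lemma portal_arc_rep:
  fixes d :: "'a::t2_space \<Rightarrow> 'a \<Rightarrow> ennreal"
  assumes d: "extended_distance d" and \<Gamma>: "\<Gamma> \<in> RA d" and ab: "0 \<le> a" "0 \<le> b"
  defines "l \<equiv> enn2real (arc_length d \<Gamma>)"
  shows "portal d V a b (arc_rep d \<Gamma>) \<longleftrightarrow> (\<exists>r s. 0 \<le> r \<and> r \<le> s \<and> s \<le> 1 \<and> arc_rep d \<Gamma> ` {r..s} \<subseteq> V \<and>
    (s = 1 \<or> a < l * s) \<and> (r = 0 \<or> b < l * (1 - r)))"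
proof -
  have l: "arc_length d \<Gamma> = ennreal l" "0 \<le> l"
    using arc_rep_props(1)[OF d \<Gamma>] unfolding l_def by simp_all
  have *: "ennreal a < variation d (arc_rep d \<Gamma>) 0 s \<longleftrightarrow> a < l * s"
    "ennreal b < variation d (arc_rep d \<Gamma>) s 1 \<longleftrightarrow> b < l * (1 - s)" if "0 \<le> s" "s \<le> 1" for s
    using arc_rep_speed[OF d \<Gamma>, of 0 s] arc_rep_speed[OF d \<Gamma>, of s 1] that l ab
    by (simp_all add: ennreal_mult[symmetric] ennreal_less_iff)
  show ?thesis
    unfolding portal_def
  proof (intro iff_exI)
    fix r s
    show "0 \<le> r \<and> r \<le> s \<and> s \<le> 1 \<and> arc_rep d \<Gamma> ` {r..s} \<subseteq> V \<and> (s = 1 \<or> ennreal a < variation d (arc_rep d \<Gamma>) 0 s) \<and>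
        (r = 0 \<or> ennreal b < variation d (arc_rep d \<Gamma>) r 1) \<longleftrightarrow>
      0 \<le> r \<and> r \<le> s \<and> s \<le> 1 \<and> arc_rep d \<Gamma> ` {r..s} \<subseteq> V \<and> (s = 1 \<or> a < l * s) \<and> (r = 0 \<or> b < l * (1 - r))"
      using *(1)[of s] *(2)[of r] by (cases "0 \<le> r \<and> r \<le> s \<and> s \<le> 1") auto
  qed
qed

text \<open>At time \<open>t\<close> the length travelled is \<open>l * t \<le> a\<close>, so the
  point cannot lie after \<open>s\<close>; the length to come is \<open>l * (1 - t) \<le> b\<close>,
  so it cannot lie before \<open>r\<close>. If \<open>s = 1\<close> or \<open>r = 0\<close> there is
  nothing to exclude on that side.\<close>

lemma portal_imp_mem:
  fixes d :: "'a::t2_space \<Rightarrow> 'a \<Rightarrow> ennreal"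
  assumes d: "extended_distance d" and \<Gamma>: "\<Gamma> \<in> RA d" and t: "t \<in> {0..1}"
    and a: "enn2real (arc_length d \<Gamma>) * t \<le> a" and b: "enn2real (arc_length d \<Gamma>) * (1 - t) \<le> b"
    and P: "portal d V a b (arc_rep d \<Gamma>)"
  shows "arc_rep d \<Gamma> t \<in> V"
proof -
  define l where "l = enn2real (arc_length d \<Gamma>)"
  have "0 \<le> l" "0 \<le> l * t" "0 \<le> l * (1 - t)"
    using t unfolding l_def by auto
  then have "0 \<le> a" "0 \<le> b"
    using a b unfolding l_def[symmetric] by linarith+
  then obtain r s where rs: "0 \<le> r" "r \<le> s" "s \<le> 1" "arc_rep d \<Gamma> ` {r..s} \<subseteq> V"
    "s = 1 \<or> a < l * s" "r = 0 \<or> b < l * (1 - r)"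
    using P unfolding portal_arc_rep[OF d \<Gamma> \<open>0 \<le> a\<close> \<open>0 \<le> b\<close>] l_def by blast
  have "t \<le> s"
  proof (rule ccontr)
    assume "\<not> t \<le> s"
    then have "l * s \<le> l * t" "s \<noteq> 1"
      using \<open>0 \<le> l\<close> t by (auto intro: mult_left_mono)
    then show False
      using rs(5) a unfolding l_def[symmetric] by linarith
  qed
  moreover have "r \<le> t"
  proof (rule ccontr)
    assume "\<not> r \<le> t"
    then have "l * (1 - r) \<le> l * (1 - t)" "r \<noteq> 0"
      using \<open>0 \<le> l\<close> t by (auto intro: mult_left_mono)
    then show False
      using rs(6) b unfolding l_def[symmetric] by linarith
  qed
  ultimately show ?thesis
    using rs(4) by auto
qed

text \<open>Positive speed leaves room for a rational number strictly between \<open>l * t\<close>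
  and \<open>l * s\<close> whenever \<open>t < s\<close>, and likewise for the length to
  come.\<close>

lemma arc_rep_mem_open_iff:
  fixes d :: "'a::t2_space \<Rightarrow> 'a \<Rightarrow> ennreal"
  assumes d: "extended_distance d" and \<Gamma>: "\<Gamma> \<in> RA d" and t: "t \<in> {0..1}" and V: "open V"
  shows "arc_rep d \<Gamma> t \<in> V \<longleftrightarrow> (\<exists>a b. a \<in> \<rat> \<and> b \<in> \<rat> \<and> enn2real (arc_length d \<Gamma>) * t \<le> a \<and>
    enn2real (arc_length d \<Gamma>) * (1 - t) \<le> b \<and> portal d V a b (arc_rep d \<Gamma>))"
proof
  define l where "l = enn2real (arc_length d \<Gamma>)"
  have l: "arc_length d \<Gamma> = ennreal l" "0 \<le> l"
    using arc_rep_props(1)[OF d \<Gamma>] unfolding l_def by simp_all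
  have lt: "0 \<le> l * t" "0 \<le> l * (1 - t)"
    using l t by auto
  assume tV: "arc_rep d \<Gamma> t \<in> V"
  show "\<exists>a b. a \<in> \<rat> \<and> b \<in> \<rat> \<and> enn2real (arc_length d \<Gamma>) * t \<le> a \<and>
    enn2real (arc_length d \<Gamma>) * (1 - t) \<le> b \<and> portal d V a b (arc_rep d \<Gamma>)"
  proof (cases "l = 0")
    \<comment> \<open>On an arc of length zero the strict length bounds fail everywhere, but the
      whole arc is a single point and the interval \<open>{0..1}\<close> passes through both
      exceptional alternatives.\<close>
    case True
    have "arc_rep d \<Gamma> u \<in> V" if "u \<in> {0..1}" for u
      using zero_variation_constant[OF d _ that t, of "arc_rep d \<Gamma>"] arc_rep_props(4)[OF d \<Gamma>, of 1] l True tV by simp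
    then have "portal d V 0 0 (arc_rep d \<Gamma>)"
      unfolding portal_def by (intro exI[of _ 0] exI[of _ 1]) auto
    then show ?thesis
      using True unfolding l_def[symmetric] by (intro exI[of _ 0]) auto
  next
    case False
    then have "0 < l"
      using l by simp
    obtain r s where rs: "0 \<le> r" "r \<le> t" "t \<le> s" "s \<le> 1" "arc_rep d \<Gamma> ` {r..s} \<subseteq> V"
      "r = 0 \<or> r < t" "s = 1 \<or> t < s"
      by (rule exists_interval_around[OF arc_rep_continuous[OF d \<Gamma>] V, of t t]) (use t tV in auto)
    have "\<exists>a\<in>\<rat>. l * t < a \<and> (s = 1 \<or> a < l * s)"
    proof (cases "s = 1")
      case True
      then show ?thesis
        using Rats_dense_in_real[of "l * t" "l * t + 1"] by auto
    next
      case False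
      then have "l * t < l * s"
        using rs \<open>0 < l\<close> by simp
      then show ?thesis
        using Rats_dense_in_real by blast
    qed
    moreover have "\<exists>b\<in>\<rat>. l * (1 - t) < b \<and> (r = 0 \<or> b < l * (1 - r))"
    proof (cases "r = 0")
      case True
      then show ?thesis
        using Rats_dense_in_real[of "l * (1 - t)" "l * (1 - t) + 1"] by auto
    next
      case False
      then have "l * (1 - t) < l * (1 - r)"
        using rs \<open>0 < l\<close> by simp
      then show ?thesis
        using Rats_dense_in_real by blast
    qed
    ultimately obtain a b where ab: "a \<in> \<rat>" "b \<in> \<rat>" "l * t < a" "l * (1 - t) < b"
      "s = 1 \<or> a < l * s" "r = 0 \<or> b < l * (1 - r)"
      by blast
    have "r \<le> s" "0 \<le> a" "0 \<le> b"
      using rs ab lt by linarith+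
    then have "portal d V a b (arc_rep d \<Gamma>)"
      unfolding portal_arc_rep[OF d \<Gamma> \<open>0 \<le> a\<close> \<open>0 \<le> b\<close>] l_def[symmetric] using rs ab by blast
    then show ?thesis
      using ab unfolding l_def[symmetric] by (intro exI[of _ a] exI[of _ b]) simp
  qed
next
  assume "\<exists>a b. a \<in> \<rat> \<and> b \<in> \<rat> \<and> enn2real (arc_length d \<Gamma>) * t \<le> a \<and>
    enn2real (arc_length d \<Gamma>) * (1 - t) \<le> b \<and> portal d V a b (arc_rep d \<Gamma>)"
  then show "arc_rep d \<Gamma> t \<in> V"
    using portal_imp_mem[OF d \<Gamma> t] by blast
qed

text \<open>If the piece of one arc lies in an open \<open>V\<close>, then so do the pieces of all
  nearby arcs of \<open>C\<close>, because the portal condition is open. A cover of the union has a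
  finite subcover on each piece, which thus works for a whole neighbourhood of arcs, and compactness
  of \<open>C\<close> leaves finitely many neighbourhoods.\<close>

lemma compact_arc_pieces:
  fixes d :: "'a::t2_space \<Rightarrow> 'a \<Rightarrow> ennreal"
  assumes X: "ext_metric_top_space d" and C: "compactin (RA_topology d) C" and ab: "0 \<le> a" "0 \<le> b"
    and len: "\<And>\<Gamma>. \<Gamma> \<in> C \<Longrightarrow> enn2real (arc_length d \<Gamma>) \<le> a + b"
  defines "piece \<equiv> \<lambda>\<Gamma>. arc_rep d \<Gamma> ` {t \<in> {0..1}. enn2real (arc_length d \<Gamma>) * t \<le> a \<and>
    enn2real (arc_length d \<Gamma>) * (1 - t) \<le> b}"
  shows "compact (\<Union>\<Gamma>\<in>C. piece \<Gamma>)"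
proof -
  have d: "extended_distance d"
    using X unfolding ext_metric_top_space_def by blast
  have CRA: "C \<subseteq> RA d"
    using compactin_subset_topspace[OF C] unfolding topspace_RA_topology .
  have piece_subset: "piece \<Gamma> \<subseteq> V" if "\<Gamma> \<in> C" "portal d V a b (arc_rep d \<Gamma>)" for V \<Gamma>
  proof
    fix x assume "x \<in> piece \<Gamma>"
    then obtain t where t: "x = arc_rep d \<Gamma> t" "t \<in> {0..1}" "enn2real (arc_length d \<Gamma>) * t \<le> a"
      "enn2real (arc_length d \<Gamma>) * (1 - t) \<le> b"
      unfolding piece_def by auto
    show "x \<in> V"
      unfolding t(1) by (rule portal_imp_mem[OF d subsetD[OF CRA that(1)] t(2-4) that(2)])
  qed
  have piece_portal: "compact (piece \<Gamma>) \<and> (\<forall>V. open V \<longrightarrow> piece \<Gamma> \<subseteq> V \<longrightarrow> portal d V a b (arc_rep d \<Gamma>))"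
    if "\<Gamma> \<in> C" for \<Gamma>
  proof -
    define l where "l = enn2real (arc_length d \<Gamma>)"
    have l: "0 \<le> l" "l \<le> a + b"
      using len[OF that] unfolding l_def by auto
    have \<Gamma>: "\<Gamma> \<in> RA d"
      using that CRA by blast
    \<comment> \<open>\<open>r\<close> and \<open>s\<close> are the end points of the interval cut
      out by the two conditions on \<open>t\<close>. That the length is at most \<open>a + b\<close>
      gives \<open>r \<le> s\<close>; for longer arcs the piece would be empty.\<close>
    define r where "r = (if l = 0 then 0 else max 0 (1 - b / l))"
    define s where "s = (if l = 0 then 1 else min 1 (a / l))"
    have rs: "0 \<le> r \<and> r \<le> s \<and> s \<le> 1" and set_eq: "{t \<in> {0..1}. l * t \<le> a \<and> l * (1 - t) \<le> b} = {r..s}"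
    proof -
      have RS: "(0 \<le> r \<and> r \<le> s \<and> s \<le> 1) \<and> {t \<in> {0..1}. l * t \<le> a \<and> l * (1 - t) \<le> b} = {r..s}"
      proof (cases "l = 0")
        case True
        then show ?thesis
          using ab unfolding r_def s_def by auto
      next
        case False
        then have "0 < l"
          using l by simp
        have "1 \<le> (a + b) / l"
          using \<open>0 < l\<close> l by simp
        then have 1: "1 - b / l \<le> a / l"
          unfolding add_divide_distrib by linarith
        have 2: "0 \<le> a / l" "0 \<le> b / l"
          using ab l by auto
        have E: "l * t \<le> a \<longleftrightarrow> t \<le> a / l" "l * (1 - t) \<le> b \<longleftrightarrow> 1 - b / l \<le> t" for t
          using \<open>0 < l\<close> by (auto simp: field_simps)
        have R: "r = max 0 (1 - b / l)" "s = min 1 (a / l)"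
          using False unfolding r_def s_def by simp_all
        show ?thesis
        proof
          show "0 \<le> r \<and> r \<le> s \<and> s \<le> 1"
            unfolding R using 1 2 by simp
          show "{t \<in> {0..1}. l * t \<le> a \<and> l * (1 - t) \<le> b} = {r..s}"
            unfolding R E by auto
        qed
      qed
      show "0 \<le> r \<and> r \<le> s \<and> s \<le> 1" "{t \<in> {0..1}. l * t \<le> a \<and> l * (1 - t) \<le> b} = {r..s}"
        by (rule RS[THEN conjunct1], rule RS[THEN conjunct2])
    qed
    from rs have rs: "0 \<le> r" "r \<le> s" "s \<le> 1"
      by auto
    have "compact (arc_rep d \<Gamma> ` {r..s})"
      using rs by (intro compact_continuous_image continuous_on_subset[OF arc_rep_continuous[OF d \<Gamma>]]) auto
    moreover have "portal d V a b (arc_rep d \<Gamma>)" if V: "open V" "arc_rep d \<Gamma> ` {r..s} \<subseteq> V" for V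
    proof -
      obtain r' s' where *: "0 \<le> r'" "r' \<le> r" "s \<le> s'" "s' \<le> 1" "arc_rep d \<Gamma> ` {r'..s'} \<subseteq> V"
        "r' = 0 \<or> r' < r" "s' = 1 \<or> s < s'"
        by (rule exists_interval_around[OF arc_rep_continuous[OF d \<Gamma>] V(1) rs V(2)])
      have "s' = 1 \<or> a < l * s'"
      proof (cases "s' = 1")
        case False
        then have "s < s'" "s' < 1"
          using *(4,7) by auto
        then have "l \<noteq> 0" "a / l < s'"
          unfolding s_def by (auto split: if_splits)
        then show ?thesis
          using l(1) by (simp add: field_simps)
      qed simp
      moreover have "r' = 0 \<or> b < l * (1 - r')"
      proof (cases "r' = 0")
        case False
        then have "r' < r" "0 < r'"
          using *(1,6) by auto
        then have "l \<noteq> 0" "r' < 1 - b / l"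
          unfolding r_def by (auto split: if_splits)
        then show ?thesis
          using l(1) by (simp add: field_simps)
      qed simp
      moreover have "r' \<le> s'"
        using * rs by linarith
      ultimately show ?thesis
        unfolding portal_arc_rep[OF d \<Gamma> ab] l_def[symmetric]
        using *(1,4,5) by (intro exI[of _ r'] exI[of _ s'] conjI)
    qed
    moreover have "piece \<Gamma> = arc_rep d \<Gamma> ` {r..s}"
      unfolding piece_def l_def[symmetric] set_eq ..
    ultimately show ?thesis
      by simp
  qed
  show ?thesis
    unfolding compact_eq_Heine_Borel
  proof (intro allI impI)
    fix \<V> :: "'a set set" assume "(\<forall>V\<in>\<V>. open V) \<and> (\<Union>\<Gamma>\<in>C. piece \<Gamma>) \<subseteq> \<Union>\<V>"
    then have \<V>: "\<And>V. V \<in> \<V> \<Longrightarrow> open V" "\<And>\<Gamma>. \<Gamma> \<in> C \<Longrightarrow> piece \<Gamma> \<subseteq> \<Union>\<V>"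
      by auto
    have "\<exists>\<F>\<subseteq>\<V>. finite \<F> \<and> piece \<Gamma> \<subseteq> \<Union>\<F>" if "\<Gamma> \<in> C" for \<Gamma>
      by (rule compactE[OF conjunct1[OF piece_portal[OF that]] \<V>(2)[OF that] \<V>(1)]) auto
    then have "\<forall>\<Gamma>\<in>C. \<exists>\<F>. \<F> \<subseteq> \<V> \<and> finite \<F> \<and> piece \<Gamma> \<subseteq> \<Union>\<F>"
      by (rule ballI)
    from bchoice[OF this] obtain \<F> where
      \<F>: "\<And>\<Gamma>. \<Gamma> \<in> C \<Longrightarrow> \<F> \<Gamma> \<subseteq> \<V> \<and> finite (\<F> \<Gamma>) \<and> piece \<Gamma> \<subseteq> \<Union>(\<F> \<Gamma>)"
      by auto
    define N where "N \<Gamma> = {\<Delta> \<in> RA d. portal d (\<Union>(\<F> \<Gamma>)) a b (arc_rep d \<Delta>)}" for \<Gamma>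
    have Fo: "open (\<Union>(\<F> \<Gamma>))" if "\<Gamma> \<in> C" for \<Gamma>
      using \<F>[OF that] \<V>(1) by (intro open_Union) blast
    have "openin (RA_topology d) (N \<Gamma>)" if "\<Gamma> \<in> C" for \<Gamma>
      unfolding N_def by (rule openin_RA_topology[OF d portal_invariant openin_portal[OF X Fo[OF that]]])
    moreover have "\<Gamma> \<in> N \<Gamma>" if "\<Gamma> \<in> C" for \<Gamma>
    proof -
      have "portal d (\<Union>(\<F> \<Gamma>)) a b (arc_rep d \<Gamma>)"
        using conjunct2[OF piece_portal[OF that], rule_format, OF Fo[OF that]] \<F>[OF that] by simp
      then show ?thesis
        using that CRA unfolding N_def by auto
    qed
    ultimately have "\<And>U. U \<in> N ` C \<Longrightarrow> openin (RA_topology d) U" "C \<subseteq> \<Union>(N ` C)"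
      by auto
    from compactinD[OF C this] obtain \<G> where \<G>: "finite \<G>" "\<G> \<subseteq> N ` C" "C \<subseteq> \<Union>\<G>"
      by auto
    obtain D where D: "finite D" "D \<subseteq> C" "C \<subseteq> (\<Union>\<Gamma>\<in>D. N \<Gamma>)"
      using finite_subset_image[OF \<G>(1,2)] \<G>(3) by auto
    have "(\<Union>\<Gamma>\<in>C. piece \<Gamma>) \<subseteq> \<Union>(\<Union>\<Gamma>\<in>D. \<F> \<Gamma>)"
    proof
      fix x assume "x \<in> (\<Union>\<Gamma>\<in>C. piece \<Gamma>)"
      then obtain \<Delta> where \<Delta>: "\<Delta> \<in> C" "x \<in> piece \<Delta>"
        by (rule UN_E)
      from subsetD[OF D(3) \<Delta>(1)] obtain \<Gamma> where \<Gamma>: "\<Gamma> \<in> D" "\<Delta> \<in> N \<Gamma>"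
        by (rule UN_E)
      then have "piece \<Delta> \<subseteq> \<Union>(\<F> \<Gamma>)"
        unfolding N_def by (intro piece_subset[OF \<Delta>(1)]) simp
      then have "x \<in> \<Union>(\<F> \<Gamma>)"
        using \<Delta>(2) by (rule subsetD)
      then show "x \<in> \<Union>(\<Union>\<Gamma>\<in>D. \<F> \<Gamma>)"
        using \<Gamma>(1) by auto
    qed
    moreover have "finite (\<Union>\<Gamma>\<in>D. \<F> \<Gamma>)"
      using \<F> D(2) by (intro finite_UN_I[OF D(1)]) auto
    moreover have "(\<Union>\<Gamma>\<in>D. \<F> \<Gamma>) \<subseteq> \<V>"
      using \<F> D(2) by (intro UN_least) auto
    ultimately show "\<exists>\<D>\<subseteq>\<V>. finite \<D> \<and> (\<Union>\<Gamma>\<in>C. piece \<Gamma>) \<subseteq> \<Union>\<D>"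
      by (intro exI[of _ "\<Union>\<Gamma>\<in>D. \<F> \<Gamma>"] conjI)
  qed
qed

section \<open>The occupation measure\<close>

text \<open>The errors of the individual approximations sum to at most \<open>e / 2\<close> over the
  infinite union; continuity from above then passes to a finite union, the remaining
  \<open>e / 2\<close> paying for the tail.\<close>

lemma finite_union_approx:
  fixes N :: "'b measure"
  assumes "finite_measure N" and E: "E \<in> sets N" "E \<subseteq> (\<Union>i. G i)"
    and [measurable]: "\<And>i. G i \<in> sets N" "\<And>i. F i \<in> sets N"
    and e: "0 < e" and le: "\<And>i. measure N (G i - F i) \<le> e / 2 * (1 / 2) ^ Suc i"
  shows "\<exists>n. measure N (E - (\<Union>i<n. F i)) < e"
proof -
  interpret finite_measure N by fact
  have [measurable]: "E \<in> sets N" by (rule E)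
  have sums: "(\<lambda>i. e / 2 * (1 / 2) ^ Suc i) sums (e / 2 * 1)"
    by (intro sums_mult power_half_series)
  have summ: "summable (\<lambda>i. measure N (G i - F i))"
    by (rule summable_comparison_test'[OF sums_summable[OF sums]]) (use le in auto)
  have "measure N (E - (\<Union>i. F i)) \<le> measure N (\<Union>i. G i - F i)"
    using E(2) by (intro finite_measure_mono) auto
  also have "\<dots> \<le> (\<Sum>i. measure N (G i - F i))"
    by (intro finite_measure_subadditive_countably summ) auto
  also have "\<dots> \<le> (\<Sum>i. e / 2 * (1 / 2) ^ Suc i)"
    by (intro suminf_le le summ sums_summable[OF sums])
  also have "\<dots> = e / 2"
    using sums_unique[OF sums] by simp
  finally have "measure N (\<Inter>n. E - (\<Union>i<n. F i)) \<le> e / 2"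
  proof -
    assume "measure N (E - (\<Union>i. F i)) \<le> e / 2"
    moreover have "(\<Inter>n. E - (\<Union>i<n. F i)) = E - (\<Union>i. F i)"
      by auto
    ultimately show ?thesis
      by simp
  qed
  then have *: "measure N (\<Inter>n. E - (\<Union>i<n. F i)) < e"
    using e by simp
  have "(\<lambda>n. measure N (E - (\<Union>i<n. F i))) \<longlonglongrightarrow> measure N (\<Inter>n. E - (\<Union>i<n. F i))"
    by (rule finite_Lim_measure_decseq) (auto simp: decseq_def)
  then have "\<forall>\<^sub>F n in sequentially. measure N (E - (\<Union>i<n. F i)) < e"
    using * by (rule order_tendstoD)
  then show ?thesis
    by (rule eventually_happens'[OF sequentially_bot])
qed

text \<open>Sets enclosed between a closed and an open set with small difference form a
  sigma-algebra: complements exchange the two sides, and in a countable union finitely many closed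
  sets suffice. Closed sets are the right inner class here, as complements destroy compactness;
  compactness is recovered at the end.\<close>

lemma radon_measure_if_inner_regular_on_open:
  fixes M :: "'a::t2_space measure"
  assumes fin: "finite_measure M" and M: "sets M = sets borel"
    and inner: "\<And>V e. open V \<Longrightarrow> 0 < e \<Longrightarrow> \<exists>K. compact K \<and> K \<subseteq> V \<and> measure M (V - K) < e"
  shows "M \<in> radon_measures euclidean"
proof -
  interpret finite_measure M by fact
  note [measurable_cong] = M
  have op: "U \<in> sets M" if "open U" for U
    using that M by simp
  have cl: "K \<in> sets M" if "closed K" for K
    using that M by simp
  have approx: "\<forall>e>0. \<exists>K U. closed K \<and> open U \<and> K \<subseteq> B \<and> B \<subseteq> U \<and> measure M (U - K) < e"
    if "B \<in> sigma_sets UNIV {S. open S}" for B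
    using that
  proof induction
    case (Basic V)
    then have "open V"
      by simp
    show ?case
    proof (intro allI impI)
      fix e :: real assume "0 < e"
      then obtain K where "compact K" "K \<subseteq> V" "measure M (V - K) < e"
        using inner[OF \<open>open V\<close>] by metis
      then show "\<exists>K U. closed K \<and> open U \<and> K \<subseteq> V \<and> V \<subseteq> U \<and> measure M (U - K) < e"
        using \<open>open V\<close> compact_imp_closed by (intro exI[of _ K] exI[of _ V]) simp
    qed
  next
    case Empty
    show ?case
      by (intro allI impI exI[of _ "{}"]) simp
  next
    case (Compl B)
    show ?case
    proof (intro allI impI)
      fix e :: real assume "0 < e"
      then obtain K U where KU: "closed K" "open U" "K \<subseteq> B" "B \<subseteq> U" "measure M (U - K) < e"
        using Compl.IH by metis
      have "- K - - U = U - K"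
        by auto
      then show "\<exists>K U. closed K \<and> open U \<and> K \<subseteq> UNIV - B \<and> UNIV - B \<subseteq> U \<and> measure M (U - K) < e"
        using KU by (intro exI[of _ "- U"] exI[of _ "- K"]) auto
    qed
  next
    case (Union A)
    show ?case
    proof (intro allI impI)
      fix e :: real assume "0 < e"
      have "\<forall>i. \<exists>K U. closed K \<and> open U \<and> K \<subseteq> A i \<and> A i \<subseteq> U \<and> measure M (U - K) < e / 2 * (1 / 2) ^ Suc i"
        using \<open>0 < e\<close> by (intro allI Union.IH[rule_format]) simp
      then obtain K U where KU: "\<And>i. closed (K i)" "\<And>i. open (U i)" "\<And>i. K i \<subseteq> A i" "\<And>i. A i \<subseteq> U i"
        "\<And>i. measure M (U i - K i) < e / 2 * (1 / 2) ^ Suc i"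
        by metis
      have "\<exists>n. measure M ((\<Union>i. U i) - (\<Union>i<n. K i)) < e"
        using KU(1,2) \<open>0 < e\<close> less_imp_le[OF KU(5)]
        by (intro finite_union_approx[OF fin, where G=U] op cl open_UN) auto
      then obtain n where n: "measure M ((\<Union>i. U i) - (\<Union>i<n. K i)) < e"
        by blast
      show "\<exists>K U. closed K \<and> open U \<and> K \<subseteq> (\<Union>i. A i) \<and> (\<Union>i. A i) \<subseteq> U \<and> measure M (U - K) < e"
      proof (intro exI conjI)
        show "closed (\<Union>i<n. K i)"
          using KU(1) by (intro closed_UN) auto
        show "open (\<Union>i. U i)"
          using KU(2) by auto
        show "(\<Union>i<n. K i) \<subseteq> (\<Union>i. A i)" "(\<Union>i. A i) \<subseteq> (\<Union>i. U i)"
          using KU(3,4) by blast+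
      qed (rule n)
    qed
  qed
  have "emeasure M B = (SUP K\<in>{K. compact K \<and> K \<subseteq> B}. emeasure M K)" if B: "B \<in> sets M" for B
  proof (rule antisym)
    show "(SUP K\<in>{K. compact K \<and> K \<subseteq> B}. emeasure M K) \<le> emeasure M B"
      using B by (intro SUP_least emeasure_mono) auto
    show "emeasure M B \<le> (SUP K\<in>{K. compact K \<and> K \<subseteq> B}. emeasure M K)"
    proof (rule ennreal_le_epsilon)
      fix e :: real assume "0 < e"
      have "B \<in> sigma_sets UNIV {S. open S}"
        using B M unfolding sets_borel by simp
      then obtain K U where K: "closed K" "open U" "K \<subseteq> B" "B \<subseteq> U" "measure M (U - K) < e / 2"
        using approx[of B] \<open>0 < e\<close> by (metis half_gt_zero)
      \<comment> \<open>The hypothesis for the whole space supplies a compact set of almost full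
        measure; intersecting with it turns the closed inner set into a compact one.\<close>
      obtain T where T: "compact T" "measure M (UNIV - T) < e / 2"
        using inner[of UNIV "e / 2"] \<open>0 < e\<close> by auto
      have KT: "compact (K \<inter> T)"
        using K(1) T(1) by (simp add: closed_Int_compact)
      have m: "K \<in> sets M" "U \<in> sets M" "T \<in> sets M" "K \<inter> T \<in> sets M"
        using K T KT by (auto intro!: op cl compact_imp_closed)
      have "measure M B \<le> measure M ((K \<inter> T) \<union> ((U - K) \<union> (UNIV - T)))"
        using K m B by (intro finite_measure_mono) (auto simp: sets.compl_sets M)
      also have "\<dots> \<le> measure M (K \<inter> T) + measure M ((U - K) \<union> (UNIV - T))"
        using m by (intro measure_Un_le) (auto simp: M)
      also have "measure M ((U - K) \<union> (UNIV - T)) \<le> measure M (U - K) + measure M (UNIV - T)"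
        using m by (intro measure_Un_le) (auto simp: M)
      finally have "measure M B \<le> measure M (K \<inter> T) + e"
        using K(5) T(2) by linarith
      then have "emeasure M B \<le> emeasure M (K \<inter> T) + ennreal e"
        using \<open>0 < e\<close> by (simp add: emeasure_eq_measure ennreal_plus[symmetric] del: ennreal_plus)
      also have "emeasure M (K \<inter> T) \<le> (SUP K\<in>{K. compact K \<and> K \<subseteq> B}. emeasure M K)"
        using KT K(3) by (intro SUP_upper) auto
      finally show "emeasure M B \<le> (SUP K\<in>{K. compact K \<and> K \<subseteq> B}. emeasure M K) + ennreal e"
        by simp
    qed
  qed
  moreover have "space M = UNIV"
    using sets_eq_imp_space_eq[OF M] by simp
  ultimately show ?thesis
    unfolding radon_measures_def using fin M by (auto simp: sets_borel)
qed

lemma radon_measuresD: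
  assumes "\<mu> \<in> radon_measures T"
  shows "finite_measure \<mu>" "space \<mu> = topspace T" "\<And>U. openin T U \<Longrightarrow> U \<in> sets \<mu>"
    "\<And>B. B \<in> sets \<mu> \<Longrightarrow> emeasure \<mu> B = (SUP K\<in>{K. compactin T K \<and> K \<subseteq> B}. emeasure \<mu> K)"
  using assms unfolding radon_measures_def by (auto intro: sigma_sets.Basic)

lemma radon_measure_compact_approx:
  assumes \<mu>: "\<mu> \<in> radon_measures T" and A: "A \<in> sets \<mu>" and "0 < e"
  obtains C where "compactin T C" "C \<in> sets \<mu>" "C \<subseteq> A" "measure \<mu> (A - C) < e"
proof -
  interpret finite_measure \<mu>
    by (rule radon_measuresD[OF \<mu>])
  show thesis
  proof (cases "measure \<mu> A < e")
    case True
    then show thesis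
      using that[of "{}"] A by simp
  next
    case False
    then have "ennreal (measure \<mu> A - e) < emeasure \<mu> A"
      using \<open>0 < e\<close> by (simp add: emeasure_eq_measure ennreal_less_iff)
    then obtain C where C: "compactin T C" "C \<subseteq> A" "ennreal (measure \<mu> A - e) < emeasure \<mu> C"
      unfolding radon_measuresD(4)[OF \<mu> A] less_SUP_iff by auto
    \<comment> \<open>The supremum in \<open>radon_measures\<close> admits every compact set. A set
      outside the sigma-algebra has \<open>emeasure\<close> 0, which the strict inequality rules
      out.\<close>
    have Cs: "C \<in> sets \<mu>"
      using C(3) emeasure_notin_sets by fastforce
    have "measure \<mu> A - e < measure \<mu> C"
      using C(3) False by (simp add: emeasure_eq_measure ennreal_less_iff)
    moreover have "measure \<mu> (A - C) = measure \<mu> A - measure \<mu> C"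
      by (rule finite_measure_Diff[OF A Cs C(2)])
    ultimately show thesis
      using that[OF C(1) Cs C(2)] by simp
  qed
qed

lemma ext_metric_top_space_distance: "ext_metric_top_space d \<Longrightarrow> extended_distance d"
  unfolding ext_metric_top_space_def by blast

section \<open>Measurability of evaluation and inner regularity for a dynamic plan\<close>

locale radon_plan =
  fixes d :: "'a::t2_space \<Rightarrow> 'a \<Rightarrow> ennreal" and \<pi> :: "(real \<Rightarrow> 'a) set measure"
  assumes X: "ext_metric_top_space d" and plan: "\<pi> \<in> dynamic_plans d"
begin

lemma d: "extended_distance d"
  by (rule ext_metric_top_space_distance[OF X])

lemma radon: "\<pi> \<in> radon_measures (RA_topology d)"
  and finite_length: "(\<integral>\<^sup>+\<Gamma>. arc_length d \<Gamma> \<partial>\<pi>) < \<infinity>"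
  using plan unfolding dynamic_plans_def by auto

lemma space_plan: "space \<pi> = RA d"
  using radon_measuresD(2)[OF radon] unfolding topspace_RA_topology .

sublocale finite_measure \<pi>
  by (rule radon_measuresD(1)[OF radon])

abbreviation unit_interval :: "real measure" where
  "unit_interval \<equiv> restrict_space lborel {0..1}"

lemma unit_interval: "space unit_interval = {0..1}" "emeasure unit_interval {0..1} = 1"
  by (simp_all add: space_restrict_space emeasure_restrict_space)

sublocale I: finite_measure unit_interval
  by (rule finite_measureI) (simp add: unit_interval)

sublocale P: pair_sigma_finite \<pi> unit_interval ..

text \<open>Superlevel sets of the length are open, as the variation is reparametrization invariant
  and lower semicontinuous on curves.\<close>

lemma measurable_length [measurable]: "arc_length d \<in> borel_measurable \<pi>"
proof (rule borel_measurableI_greater)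
  fix y
  have "reparametrization_invariant (\<lambda>\<gamma> :: real \<Rightarrow> 'a. y < variation d \<gamma> 0 1)"
    unfolding reparametrization_invariant_def using variation_curve_rel by metis
  then have "openin (RA_topology d) {\<Gamma> \<in> RA d. y < variation d (arc_rep d \<Gamma>) 0 1}"
    by (rule openin_RA_topology[OF d]) (rule openin_variation_greater[OF X]; simp)
  moreover have "{\<Gamma> \<in> RA d. y < variation d (arc_rep d \<Gamma>) 0 1} = {\<Gamma> \<in> space \<pi>. y < arc_length d \<Gamma>}"
    unfolding space_plan using arc_rep_props(4)[OF d, of _ 1] by auto
  ultimately show "{\<Gamma> \<in> space \<pi>. y < arc_length d \<Gamma>} \<in> sets \<pi>"
    using radon_measuresD(3)[OF radon] by simp
qed

lemma sets_portal:
  assumes "open V"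
  shows "{\<Gamma> \<in> space \<pi>. portal d V a b (arc_rep d \<Gamma>)} \<in> sets \<pi>"
  unfolding space_plan
  by (rule radon_measuresD(3)[OF radon openin_RA_topology[OF d portal_invariant openin_portal[OF X assms]]])

text \<open>The pairs of arc and time for which membership of the evaluated point in
  \<open>V\<close> is certified by the bounds \<open>a\<close> and \<open>b\<close>. The portal
  condition is open in the arc, the other two conditions are Borel in the pair.\<close>

definition portal_hat :: "'a set \<Rightarrow> real \<Rightarrow> real \<Rightarrow> ((real \<Rightarrow> 'a) set \<times> real) set" where
  "portal_hat V a b = {p \<in> space (\<pi> \<Otimes>\<^sub>M unit_interval). fst p \<in> {\<Gamma> \<in> space \<pi>. portal d V a b (arc_rep d \<Gamma>)} \<and>
     enn2real (arc_length d (fst p)) * snd p \<le> a \<and> enn2real (arc_length d (fst p)) * (1 - snd p) \<le> b}"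

lemma sets_portal_hat [measurable]:
  assumes "open V"
  shows "portal_hat V a b \<in> sets (\<pi> \<Otimes>\<^sub>M unit_interval)"
proof -
  note sets_portal[OF assms, measurable]
  have [measurable]: "(\<lambda>x. x) \<in> borel_measurable unit_interval"
    by (rule measurable_restrict_space1) simp
  show ?thesis
    unfolding portal_hat_def by measurable
qed

lemma ehat_vimage_open:
  assumes V: "open V"
  shows "ehat d -` V \<inter> space (\<pi> \<Otimes>\<^sub>M unit_interval) = (\<Union>a\<in>\<rat>. \<Union>b\<in>\<rat>. portal_hat V a b)"
proof -
  have iff: "ehat d (\<Gamma>, t) \<in> V \<longleftrightarrow> (\<exists>a\<in>\<rat>. \<exists>b\<in>\<rat>. (\<Gamma>, t) \<in> portal_hat V a b)"
    if "\<Gamma> \<in> RA d" "t \<in> {0..1}" for \<Gamma> t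
    using arc_rep_mem_open_iff[OF d that V] that
    unfolding portal_hat_def ehat_def by (auto simp: space_pair_measure space_plan unit_interval)
  have sub: "portal_hat V a b \<subseteq> RA d \<times> {0..1}" for a b
    unfolding portal_hat_def by (auto simp: space_pair_measure space_plan unit_interval)
  show ?thesis
  proof (intro set_eqI)
    fix p :: "(real \<Rightarrow> 'a) set \<times> real"
    obtain \<Gamma> t where p: "p = (\<Gamma>, t)"
      by (cases p)
    show "p \<in> ehat d -` V \<inter> space (\<pi> \<Otimes>\<^sub>M unit_interval) \<longleftrightarrow> p \<in> (\<Union>a\<in>\<rat>. \<Union>b\<in>\<rat>. portal_hat V a b)"
    proof (cases "p \<in> RA d \<times> {0..1}")
      case True
      then show ?thesis
        using iff[of \<Gamma> t] unfolding p by (simp add: space_pair_measure space_plan unit_interval)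
    next
      case False
      then have "p \<notin> (\<Union>a\<in>\<rat>. \<Union>b\<in>\<rat>. portal_hat V a b)"
        using sub by blast
      then show ?thesis
        using False by (simp add: space_pair_measure space_plan unit_interval)
    qed
  qed
qed

text \<open>Only the rational bounds \<open>a\<close> and \<open>b\<close> index the union, so it is
  countable whatever the topology of the space. Measurability before completion is what later
  removes the completions built into the push-forwards.\<close>

lemma measurable_ehat [measurable]: "ehat d \<in> \<pi> \<Otimes>\<^sub>M unit_interval \<rightarrow>\<^sub>M borel"
proof (rule borel_measurableI)
  fix V :: "'a set" assume V: "open V"
  show "ehat d -` V \<inter> space (\<pi> \<Otimes>\<^sub>M unit_interval) \<in> sets (\<pi> \<Otimes>\<^sub>M unit_interval)"
    unfolding ehat_vimage_open[OF V]
    by (intro sets.countable_UN'' countable_rat sets_portal_hat V)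
qed

lemma measurable_arc_rep:
  assumes "t \<in> {0..1}"
  shows "(\<lambda>\<Gamma>. arc_rep d \<Gamma> t) \<in> \<pi> \<rightarrow>\<^sub>M borel"
proof -
  have "(\<lambda>\<Gamma>. ehat d (\<Gamma>, t)) \<in> \<pi> \<rightarrow>\<^sub>M borel"
    using assms by (intro measurable_compose[OF _ measurable_ehat] measurable_Pair1') (simp add: unit_interval)
  then show ?thesis
    by (simp add: ehat_def)
qed

text \<open>The length is the speed of the representative, so this weight turns integration in time
  into integration along the arc.\<close>

definition length_hat :: "((real \<Rightarrow> 'a) set \<times> real) measure" where
  "length_hat = density (\<pi> \<Otimes>\<^sub>M unit_interval) (\<lambda>p. arc_length d (fst p))"

lemma sets_length_hat [measurable_cong]: "sets length_hat = sets (\<pi> \<Otimes>\<^sub>M unit_interval)"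
  and space_length_hat: "space length_hat = space (\<pi> \<Otimes>\<^sub>M unit_interval)"
  unfolding length_hat_def by simp_all

lemma emeasure_length_hat_cylinder:
  assumes A: "A \<in> sets \<pi>"
  shows "emeasure length_hat (A \<times> {0..1}) = (\<integral>\<^sup>+\<Gamma>. arc_length d \<Gamma> * indicator A \<Gamma> \<partial>\<pi>)"
proof -
  have 1: "{0..1} \<in> sets unit_interval"
    using sets.top[of unit_interval] unfolding unit_interval .
  have "emeasure length_hat (A \<times> {0..1}) = (\<integral>\<^sup>+p. arc_length d (fst p) * indicator (A \<times> {0..1}) p \<partial>(\<pi> \<Otimes>\<^sub>M unit_interval))"
    unfolding length_hat_def using A 1 by (subst emeasure_density) auto
  also have "\<dots> = (\<integral>\<^sup>+\<Gamma>. \<integral>\<^sup>+t. arc_length d \<Gamma> * indicator A \<Gamma> * indicator {0..1} t \<partial>unit_interval \<partial>\<pi>)"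
    using A 1 by (subst I.nn_integral_fst[symmetric]) (auto simp: indicator_times mult.assoc)
  also have "\<dots> = (\<integral>\<^sup>+\<Gamma>. arc_length d \<Gamma> * indicator A \<Gamma> \<partial>\<pi>)"
    using 1 by (simp add: nn_integral_cmult unit_interval)
  finally show ?thesis .
qed

sublocale length_hat: finite_measure length_hat
proof (rule finite_measureI)
  have "emeasure length_hat (space length_hat) = (\<integral>\<^sup>+\<Gamma>. arc_length d \<Gamma> * indicator (space \<pi>) \<Gamma> \<partial>\<pi>)"
    using emeasure_length_hat_cylinder[of "space \<pi>"] by (simp add: space_length_hat space_pair_measure unit_interval)
  also have "\<dots> = (\<integral>\<^sup>+\<Gamma>. arc_length d \<Gamma> \<partial>\<pi>)"
    by (intro nn_integral_cong) (auto simp: indicator_def)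
  finally show "emeasure length_hat (space length_hat) \<noteq> \<infinity>"
    using finite_length by simp
qed

text \<open>Inner regularity of the plan gives a compact family \<open>C\<close> of arcs, and the
  pieces of these arcs fill a compact subset of \<open>V\<close>. Whatever is missed lies above
  \<open>A - C\<close>, where the length weight is bounded.\<close>

lemma portal_hat_compact_approx:
  assumes V: "open V" and ab: "0 \<le> a" "0 \<le> b" and e: "0 < e"
  obtains K where "compact K" "K \<subseteq> V"
    "measure length_hat (portal_hat V a b - (ehat d -` K \<inter> space length_hat)) \<le> e"
proof -
  define A where "A = {\<Gamma> \<in> space \<pi>. portal d V a b (arc_rep d \<Gamma>) \<and> enn2real (arc_length d \<Gamma>) \<le> a + b}"
  have A: "A \<in> sets \<pi>"
  proof -
    note sets_portal[OF V, measurable]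
    have "A = {\<Gamma> \<in> space \<pi>. portal d V a b (arc_rep d \<Gamma>)} \<inter> {\<Gamma> \<in> space \<pi>. enn2real (arc_length d \<Gamma>) \<le> a + b}"
      unfolding A_def by auto
    also have "\<dots> \<in> sets \<pi>"
      by measurable
    finally show ?thesis .
  qed
  \<comment> \<open>Above \<open>A - C\<close> the weight is at most \<open>a + b\<close>, whence
    the quotient; the 1 covers the case \<open>a = b = 0\<close>.\<close>
  obtain C where C: "compactin (RA_topology d) C" "C \<in> sets \<pi>" "C \<subseteq> A" "measure \<pi> (A - C) < e / (a + b + 1)"
    by (rule radon_measure_compact_approx[OF radon A, of "e / (a + b + 1)"]) (use e ab in auto)
  define piece where "piece \<Gamma> = arc_rep d \<Gamma> ` {t \<in> {0..1}. enn2real (arc_length d \<Gamma>) * t \<le> a \<and>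
    enn2real (arc_length d \<Gamma>) * (1 - t) \<le> b}" for \<Gamma>
  define K where "K = (\<Union>\<Gamma>\<in>C. piece \<Gamma>)"
  have CRA: "\<Gamma> \<in> RA d" "portal d V a b (arc_rep d \<Gamma>)" if "\<Gamma> \<in> C" for \<Gamma>
    using C(3) that unfolding A_def space_plan by auto
  have "compact K"
    unfolding K_def piece_def using C(3) by (intro compact_arc_pieces[OF X C(1) ab]) (auto simp: A_def)
  moreover have "K \<subseteq> V"
    unfolding K_def piece_def using portal_imp_mem[OF d CRA(1) _ _ _ CRA(2)] by auto
  moreover have "measure length_hat (portal_hat V a b - (ehat d -` K \<inter> space length_hat)) \<le> e"
  proof -
    have "portal_hat V a b - (ehat d -` K \<inter> space length_hat) \<subseteq> (A - C) \<times> {0..1}"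
    proof
      fix p assume p: "p \<in> portal_hat V a b - (ehat d -` K \<inter> space length_hat)"
      obtain \<Gamma> t where pt: "p = (\<Gamma>, t)"
        by (cases p)
      have *: "\<Gamma> \<in> space \<pi>" "portal d V a b (arc_rep d \<Gamma>)" "t \<in> {0..1}"
        "enn2real (arc_length d \<Gamma>) * t \<le> a" "enn2real (arc_length d \<Gamma>) * (1 - t) \<le> b"
        using p unfolding pt portal_hat_def by (auto simp: space_pair_measure unit_interval)
      \<comment> \<open>Adding the two time bounds eliminates \<open>t\<close>.\<close>
      have "enn2real (arc_length d \<Gamma>) \<le> a + b"
        using *(4,5) by (simp add: right_diff_distrib)
      moreover have "arc_rep d \<Gamma> t \<notin> K"
        using p * unfolding pt by (auto simp: ehat_def space_length_hat space_pair_measure unit_interval)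
      then have "\<Gamma> \<notin> C"
        using *(3-5) unfolding K_def piece_def by blast
      ultimately show "p \<in> (A - C) \<times> {0..1}"
        using * unfolding pt A_def by auto
    qed
    moreover have cyl: "(A - C) \<times> {0..1} \<in> sets length_hat"
      using A C(2) sets.top[of unit_interval] unfolding sets_length_hat unit_interval by blast
    ultimately have "measure length_hat (portal_hat V a b - (ehat d -` K \<inter> space length_hat))
        \<le> measure length_hat ((A - C) \<times> {0..1})"
      by (rule length_hat.finite_measure_mono)
    moreover have "emeasure length_hat ((A - C) \<times> {0..1}) \<le> ennreal e"
    proof -
      have "emeasure length_hat ((A - C) \<times> {0..1}) = (\<integral>\<^sup>+\<Gamma>. arc_length d \<Gamma> * indicator (A - C) \<Gamma> \<partial>\<pi>)"
        using A C(2) by (intro emeasure_length_hat_cylinder) auto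
      also have "\<dots> \<le> (\<integral>\<^sup>+\<Gamma>. ennreal (a + b) * indicator (A - C) \<Gamma> \<partial>\<pi>)"
      proof (rule nn_integral_mono)
        fix \<Gamma> assume "\<Gamma> \<in> space \<pi>"
        then have "arc_length d \<Gamma> = ennreal (enn2real (arc_length d \<Gamma>))"
          using arc_rep_props(1)[OF d] space_plan by simp
        then show "arc_length d \<Gamma> * indicator (A - C) \<Gamma> \<le> ennreal (a + b) * indicator (A - C) \<Gamma>"
          by (auto simp: indicator_def A_def) (metis ennreal_leI)
      qed
      also have "\<dots> = ennreal (a + b) * ennreal (measure \<pi> (A - C))"
        using A C(2) by (simp add: nn_integral_cmult emeasure_eq_measure)
      also have "\<dots> = ennreal ((a + b) * measure \<pi> (A - C))"
        using ab by (simp add: ennreal_mult)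
      also have "\<dots> \<le> ennreal e"
      proof (rule ennreal_leI)
        have "(a + b) * measure \<pi> (A - C) \<le> (a + b) * (e / (a + b + 1))"
          using C(4) ab by (intro mult_left_mono) auto
        also have "\<dots> \<le> e"
          using ab e by (simp add: field_simps)
        finally show "(a + b) * measure \<pi> (A - C) \<le> e" .
      qed
      finally show ?thesis .
    qed
    then have "measure length_hat ((A - C) \<times> {0..1}) \<le> e"
      using e by (simp add: length_hat.emeasure_eq_measure)
    ultimately show ?thesis
      by linarith
  qed
  ultimately show thesis
    by (rule that)
qed

definition occupation :: "'a measure" where
  "occupation = distr length_hat borel (ehat d)"

lemma sets_occupation [measurable_cong]: "sets occupation = sets borel"
  unfolding occupation_def by simp

lemma measurable_ehat_length [measurable]: "ehat d \<in> length_hat \<rightarrow>\<^sub>M borel"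
  using measurable_ehat unfolding length_hat_def by simp

sublocale occ: finite_measure occupation
  unfolding occupation_def by (intro length_hat.finite_measure_distr) measurable

text \<open>The preimage of \<open>V\<close> is a countable union of sets \<open>portal_hat\<close>,
  each filled up by the preimage of a compact set with an error from a geometric series; finitely
  many of these compact sets are enough.\<close>

lemma occupation_radon: "occupation \<in> radon_measures euclidean"
proof (rule radon_measure_if_inner_regular_on_open)
  show "finite_measure occupation"
    by (rule occ.finite_measure_axioms)
  show "sets occupation = sets borel"
    by (rule sets_occupation)
  fix V :: "'a set" and e :: real assume V: "open V" and e: "0 < e"
  \<comment> \<open>A negative bound makes \<open>portal_hat\<close> empty, so nonnegative rationals
    suffice; the pair \<open>(0, 0)\<close> shows that \<open>Q\<close> is nonempty, as its
    enumeration requires.\<close>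
  define Q :: "(real \<times> real) set" where "Q = (\<rat> \<inter> {0..}) \<times> (\<rat> \<inter> {0..})"
  have "countable Q" "(0, 0) \<in> Q"
    unfolding Q_def by (auto intro!: countable_SIGMA countable_Int1 countable_rat)
  then have Q: "range (from_nat_into Q) = Q"
    by (intro range_from_nat_into) auto
  define a where "a i = fst (from_nat_into Q i)" for i
  define b where "b i = snd (from_nat_into Q i)" for i
  have ab: "0 \<le> a i" "0 \<le> b i" for i
    using from_nat_into[of Q i] \<open>(0, 0) \<in> Q\<close> unfolding a_def b_def Q_def by (auto simp: mem_Times_iff)
  have "\<forall>i. \<exists>K. compact K \<and> K \<subseteq> V \<and>
      measure length_hat (portal_hat V (a i) (b i) - (ehat d -` K \<inter> space length_hat)) \<le> e / 2 * (1 / 2) ^ Suc i"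
    using portal_hat_compact_approx[OF V ab] e by (metis divide_pos_pos half_gt_zero zero_less_power mult_pos_pos zero_less_numeral zero_less_one)
  then obtain K where K: "\<And>i. compact (K i)" "\<And>i. K i \<subseteq> V"
    "\<And>i. measure length_hat (portal_hat V (a i) (b i) - (ehat d -` K i \<inter> space length_hat)) \<le> e / 2 * (1 / 2) ^ Suc i"
    by metis
  have Kb [measurable]: "K i \<in> sets borel" for i
    using K(1) by (simp add: borel_compact)
  have [measurable]: "V \<in> sets borel"
    using V by simp
  have sub: "ehat d -` V \<inter> space length_hat \<subseteq> (\<Union>i. portal_hat V (a i) (b i))"
  proof
    fix p assume "p \<in> ehat d -` V \<inter> space length_hat"
    then obtain a' b' where p: "a' \<in> \<rat>" "b' \<in> \<rat>" "p \<in> portal_hat V a' b'"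
      using ehat_vimage_open[OF V] by (auto simp: space_length_hat)
    have "0 \<le> enn2real (arc_length d (fst p)) * snd p" "0 \<le> enn2real (arc_length d (fst p)) * (1 - snd p)"
      using p(3) unfolding portal_hat_def by (auto simp: space_pair_measure unit_interval)
    then have "(a', b') \<in> Q"
      using p unfolding Q_def portal_hat_def by auto
    then obtain i where "(a', b') = from_nat_into Q i"
      using Q by blast
    then show "p \<in> (\<Union>i. portal_hat V (a i) (b i))"
      using p(3) unfolding a_def b_def by (metis UN_I UNIV_I fst_conv snd_conv)
  qed
  have "\<exists>n. measure length_hat ((ehat d -` V \<inter> space length_hat) - (\<Union>i<n. ehat d -` K i \<inter> space length_hat)) < e"
  proof (rule finite_union_approx[OF _ _ sub _ _ e K(3)])
    show "finite_measure length_hat"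
      by (rule length_hat.finite_measure_axioms)
    show "portal_hat V (a i) (b i) \<in> sets length_hat" for i
      unfolding sets_length_hat by (rule sets_portal_hat[OF V])
  qed measurable
  then obtain n where n: "measure length_hat ((ehat d -` V \<inter> space length_hat) - (\<Union>i<n. ehat d -` K i \<inter> space length_hat)) < e"
    by blast
  have "measure occupation (V - (\<Union>i<n. K i)) = measure length_hat (ehat d -` (V - (\<Union>i<n. K i)) \<inter> space length_hat)"
    unfolding occupation_def by (rule measure_distr) measurable
  also have "ehat d -` (V - (\<Union>i<n. K i)) \<inter> space length_hat = (ehat d -` V \<inter> space length_hat) - (\<Union>i<n. ehat d -` K i \<inter> space length_hat)"
    by auto
  finally show "\<exists>K. compact K \<and> K \<subseteq> V \<and> measure occupation (V - K) < e"
    using n K(1,2) by (intro exI[of _ "\<Union>i<n. K i"]) (auto intro!: compact_UN)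
qed

end

section \<open>Derivatives along arcs\<close>

lemma Lip_bound:
  assumes d: "extended_distance d" and "x \<in> A" "y \<in> A" "d x y < \<infinity>" and L: "Lip d A f \<le> ennreal L" "0 \<le> L"
  shows "\<bar>f x - f y\<bar> \<le> L * enn2real (d x y)"
proof (cases "x = y")
  case False
  define r where "r = enn2real (d x y)"
  have "d x y \<noteq> 0"
    using d False unfolding extended_distance_def by blast
  then have r: "d x y = ennreal r" "0 < r"
    using assms(4) unfolding r_def by (simp_all add: enn2real_positive_iff zero_less_iff_neq_zero)
  have "ennreal \<bar>f x - f y\<bar> / d x y \<le> Lip d A f"
    unfolding Lip_def using assms(2,3) False by (intro Sup_upper) blast
  then have "ennreal (\<bar>f x - f y\<bar> / r) \<le> ennreal L"
    using L(1) r by (simp add: divide_ennreal)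
  then have "\<bar>f x - f y\<bar> / r \<le> L"
    using L(2) by simp
  then show ?thesis
    using r by (simp add: field_simps r_def[symmetric])
qed (use L in simp)

lemma Lip_leI:
  assumes d: "extended_distance d" and "0 \<le> L"
    and b: "\<And>x y. x \<in> A \<Longrightarrow> y \<in> A \<Longrightarrow> d x y < \<infinity> \<Longrightarrow> \<bar>f x - f y\<bar> \<le> L * enn2real (d x y)"
  shows "Lip d A f \<le> ennreal L"
  unfolding Lip_def
proof (rule Sup_least, elim CollectE exE conjE)
  fix z x y assume z: "z = ennreal \<bar>f x - f y\<bar> / d x y" "x \<in> A" "y \<in> A" "x \<noteq> y"
  show "z \<le> ennreal L"
  proof (cases "d x y < \<infinity>")
    case True
    define r where "r = enn2real (d x y)"
    have "d x y \<noteq> 0"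
      using d z(4) unfolding extended_distance_def by blast
    then have r: "d x y = ennreal r" "0 < r"
      using True unfolding r_def by (simp_all add: enn2real_positive_iff zero_less_iff_neq_zero)
    have "\<bar>f x - f y\<bar> / r \<le> L"
      using b[OF z(2,3) True] r by (simp add: field_simps r_def[symmetric])
    then show ?thesis
      unfolding z(1) using r by (simp add: divide_ennreal ennreal_leI)
  next
    case False
    then have "d x y = top"
      by (simp add: less_top[symmetric])
    then show ?thesis
      unfolding z(1) by simp
  qed
qed

text \<open>Pairs at infinite distance contribute 0 to the Lipschitz constant, so only finite
  distances have to be controlled, and the condition can be stated in real numbers.\<close>

lemma Lipb_iff:
  assumes d: "extended_distance d"
  shows "f \<in> Lipb d \<longleftrightarrow> (\<exists>C. \<forall>x. \<bar>f x\<bar> \<le> C) \<and> continuous_on UNIV f \<and>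
    (\<exists>L\<ge>0. \<forall>x y. d x y < \<infinity> \<longrightarrow> \<bar>f x - f y\<bar> \<le> L * enn2real (d x y))"
proof -
  have "bounded (range f) \<longleftrightarrow> (\<exists>C. \<forall>x. \<bar>f x\<bar> \<le> C)"
    unfolding bounded_iff by auto
  moreover have "Lip d UNIV f < \<infinity> \<longleftrightarrow> (\<exists>L\<ge>0. \<forall>x y. d x y < \<infinity> \<longrightarrow> \<bar>f x - f y\<bar> \<le> L * enn2real (d x y))"
  proof
    assume "Lip d UNIV f < \<infinity>"
    then show "\<exists>L\<ge>0. \<forall>x y. d x y < \<infinity> \<longrightarrow> \<bar>f x - f y\<bar> \<le> L * enn2real (d x y)"
      using Lip_bound[OF d, of _ UNIV _ f "enn2real (Lip d UNIV f)"]
      by (intro exI[of _ "enn2real (Lip d UNIV f)"]) simp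
  next
    assume "\<exists>L\<ge>0. \<forall>x y. d x y < \<infinity> \<longrightarrow> \<bar>f x - f y\<bar> \<le> L * enn2real (d x y)"
    then obtain L where L: "0 \<le> L" "\<And>x y. d x y < \<infinity> \<Longrightarrow> \<bar>f x - f y\<bar> \<le> L * enn2real (d x y)"
      by blast
    then have "Lip d UNIV f \<le> ennreal L"
      by (intro Lip_leI[OF d])
    then show "Lip d UNIV f < \<infinity>"
      by (simp add: le_less_trans)
  qed
  ultimately show ?thesis
    unfolding Lipb_def by blast
qed

lemma LipbE:
  assumes d: "extended_distance d" and "f \<in> Lipb d"
  obtains C L where "\<And>x. \<bar>f x\<bar> \<le> C" "continuous_on UNIV f" "0 \<le> L"
    "\<And>x y. d x y < \<infinity> \<Longrightarrow> \<bar>f x - f y\<bar> \<le> L * enn2real (d x y)"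
  using assms(2) unfolding Lipb_iff[OF d] by blast

lemma Lipb_add:
  assumes d: "extended_distance d" and "f \<in> Lipb d" "g \<in> Lipb d"
  shows "(\<lambda>x. f x + g x) \<in> Lipb d"
proof -
  obtain C L where f: "\<And>x. \<bar>f x\<bar> \<le> C" "continuous_on UNIV f" "0 \<le> L"
    "\<And>x y. d x y < \<infinity> \<Longrightarrow> \<bar>f x - f y\<bar> \<le> L * enn2real (d x y)"
    using LipbE[OF d assms(2)] by blast
  obtain C' L' where g: "\<And>x. \<bar>g x\<bar> \<le> C'" "continuous_on UNIV g" "0 \<le> L'"
    "\<And>x y. d x y < \<infinity> \<Longrightarrow> \<bar>g x - g y\<bar> \<le> L' * enn2real (d x y)"
    using LipbE[OF d assms(3)] by blast
  show ?thesis
    unfolding Lipb_iff[OF d]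
  proof (intro conjI exI allI impI)
    show "\<bar>f x + g x\<bar> \<le> C + C'" for x
      using f(1)[of x] g(1)[of x] by linarith
    show "continuous_on UNIV (\<lambda>x. f x + g x)"
      by (intro continuous_intros f g)
    show "0 \<le> L + L'"
      using f g by simp
    show "\<bar>f x + g x - (f y + g y)\<bar> \<le> (L + L') * enn2real (d x y)" if "d x y < \<infinity>" for x y
      using f(4)[OF that] g(4)[OF that] by (simp add: distrib_right)
  qed
qed

lemma Lipb_mult:
  assumes d: "extended_distance d" and "f \<in> Lipb d" "g \<in> Lipb d"
  shows "(\<lambda>x. f x * g x) \<in> Lipb d"
proof -
  obtain C L where f: "\<And>x. \<bar>f x\<bar> \<le> C" "continuous_on UNIV f" "0 \<le> L"
    "\<And>x y. d x y < \<infinity> \<Longrightarrow> \<bar>f x - f y\<bar> \<le> L * enn2real (d x y)"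
    using LipbE[OF d assms(2)] by blast
  obtain C' L' where g: "\<And>x. \<bar>g x\<bar> \<le> C'" "continuous_on UNIV g" "0 \<le> L'"
    "\<And>x y. d x y < \<infinity> \<Longrightarrow> \<bar>g x - g y\<bar> \<le> L' * enn2real (d x y)"
    using LipbE[OF d assms(3)] by blast
  have C: "0 \<le> C" "0 \<le> C'"
    using f(1)[of undefined] g(1)[of undefined] by linarith+
  show ?thesis
    unfolding Lipb_iff[OF d]
  proof (intro conjI exI allI impI)
    show "\<bar>f x * g x\<bar> \<le> C * C'" for x
      unfolding abs_mult by (intro mult_mono f g C) simp
    show "continuous_on UNIV (\<lambda>x. f x * g x)"
      by (intro continuous_intros f g)
    show "0 \<le> C * L' + C' * L"
      using f g C by simp
    show "\<bar>f x * g x - f y * g y\<bar> \<le> (C * L' + C' * L) * enn2real (d x y)" if "d x y < \<infinity>" for x y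
    proof -
      have "f x * g x - f y * g y = f x * (g x - g y) + g y * (f x - f y)"
        by (simp add: algebra_simps)
      also have "\<bar>\<dots>\<bar> \<le> \<bar>f x\<bar> * \<bar>g x - g y\<bar> + \<bar>g y\<bar> * \<bar>f x - f y\<bar>"
        by (metis abs_mult abs_triangle_ineq)
      also have "\<dots> \<le> C * (L' * enn2real (d x y)) + C' * (L * enn2real (d x y))"
        by (intro add_mono mult_mono f g C that) auto
      finally show ?thesis
        by (simp add: algebra_simps)
    qed
  qed
qed

lemma Lipb_const: "(\<lambda>_. c) \<in> Lipb d"
proof -
  have "Lip d UNIV (\<lambda>_. c) \<le> 0"
    unfolding Lip_def by (rule Sup_least) auto
  then show ?thesis
    unfolding Lipb_def by simp
qed

lemma Lipb_cmult: "extended_distance d \<Longrightarrow> f \<in> Lipb d \<Longrightarrow> (\<lambda>x. c * f x) \<in> Lipb d"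
  by (intro Lipb_mult Lipb_const)

lemma tendsto_difference_quotient_shift:
  fixes g :: "real \<Rightarrow> real"
  assumes "(g has_real_derivative D) (at t within S)"
  shows "((\<lambda>h. (g (t + h) - g t) / h) \<longlongrightarrow> D) (at 0 within {h. t + h \<in> S})"
  using assms unfolding has_field_derivative_iff Lim_within
proof (intro allI impI)
  fix e :: real assume "0 < e"
    and *: "\<forall>e>0. \<exists>d>0. \<forall>x\<in>S. 0 < dist x t \<and> dist x t < d \<longrightarrow> dist ((g x - g t) / (x - t)) D < e"
  then obtain \<delta> where \<delta>: "0 < \<delta>" "\<And>x. x \<in> S \<Longrightarrow> 0 < dist x t \<Longrightarrow> dist x t < \<delta> \<Longrightarrow> dist ((g x - g t) / (x - t)) D < e"
    by metis
  have "dist ((g (t + h) - g t) / h) D < e" if "t + h \<in> S" "0 < dist h 0" "dist h 0 < \<delta>" for h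
    using \<delta>(2)[of "t + h"] that by (simp add: dist_real_def)
  then show "\<exists>d>0. \<forall>x\<in>{h. t + h \<in> S}. 0 < dist x 0 \<and> dist x 0 < d \<longrightarrow> dist ((g (t + x) - g t) / x) D < e"
    using \<delta>(1) by (intro exI[of _ \<delta>]) auto
qed

lemma at_within_Icc_nontrivial:
  fixes t :: real
  assumes "a < b" "t \<in> {a..b}"
  shows "at t within {a..b} \<noteq> bot"
  using assms by (simp add: trivial_limit_within islimpt_Icc)

lemma Dupper_eq:
  assumes D: "((\<lambda>s. f (arc_rep d \<Gamma> s)) has_real_derivative D) (at t within {0..1})" and t: "t \<in> {0..1}"
  shows "Dupper d f (\<Gamma>, t) = D"
proof -
  have "{h. t + h \<in> {0..1}} = {- t..1 - t}"
    by auto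
  then have "at 0 within {h. t + h \<in> {0..1}} \<noteq> bot"
    using t at_within_Icc_nontrivial[of "- t" "1 - t" 0] by simp
  then have "Limsup (at 0 within {h. t + h \<in> {0..1}})
        (\<lambda>h. ereal ((f (arc_rep d \<Gamma> (t + h)) - f (arc_rep d \<Gamma> t)) / h)) = ereal D"
    using tendsto_difference_quotient_shift[OF D] by (intro lim_imp_Limsup) simp_all
  then show ?thesis
    unfolding Dupper_def by simp
qed

lemma arc_rep_lipschitz:
  assumes d: "extended_distance d" and \<Gamma>: "\<Gamma> \<in> RA d" and L: "0 \<le> L"
    and A: "s \<in> {0..1}" "t \<in> {0..1}" "arc_rep d \<Gamma> s \<in> A" "arc_rep d \<Gamma> t \<in> A"
    and b: "\<And>x y. x \<in> A \<Longrightarrow> y \<in> A \<Longrightarrow> d x y < \<infinity> \<Longrightarrow> \<bar>f x - f y\<bar> \<le> L * enn2real (d x y)"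
  shows "\<bar>f (arc_rep d \<Gamma> s) - f (arc_rep d \<Gamma> t)\<bar> \<le> L * enn2real (arc_length d \<Gamma>) * \<bar>s - t\<bar>"
proof -
  have dl: "d (arc_rep d \<Gamma> s) (arc_rep d \<Gamma> t) \<le> ennreal (enn2real (arc_length d \<Gamma>) * \<bar>s - t\<bar>)"
    using arc_rep_dist[OF d \<Gamma> A(1,2)] by (simp add: abs_minus_commute)
  then have "d (arc_rep d \<Gamma> s) (arc_rep d \<Gamma> t) < \<infinity>"
    by (simp add: le_less_trans)
  then have "\<bar>f (arc_rep d \<Gamma> s) - f (arc_rep d \<Gamma> t)\<bar> \<le> L * enn2real (d (arc_rep d \<Gamma> s) (arc_rep d \<Gamma> t))"
    using A by (intro b)
  also have "\<dots> \<le> L * (enn2real (arc_length d \<Gamma>) * \<bar>s - t\<bar>)"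
    using enn2real_mono[OF dl] L by (intro mult_left_mono) auto
  finally show ?thesis
    by (simp add: mult.assoc)
qed

text \<open>The arc is \<tau>-continuous and stays in a neighbourhood \<open>U\<close> of its point
  for nearby times, where the Lipschitz constant of \<open>f\<close> on \<open>U\<close> times the
  speed bounds the difference quotient. The infimum over \<open>U\<close> comes last.\<close>

lemma derivative_le_slope:
  assumes d: "extended_distance d" and \<Gamma>: "\<Gamma> \<in> RA d" and t: "t \<in> {0..1}"
    and D: "((\<lambda>s. f (arc_rep d \<Gamma> s)) has_real_derivative D) (at t within {0..1})"
  shows "ennreal \<bar>D\<bar> \<le> arc_length d \<Gamma> * asymptotic_slope d f (arc_rep d \<Gamma> t)"
proof -
  define l where "l = enn2real (arc_length d \<Gamma>)"
  have l: "arc_length d \<Gamma> = ennreal l" "0 \<le> l"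
    using arc_rep_props(1)[OF d \<Gamma>] unfolding l_def by simp_all
  have lim: "((\<lambda>s. (f (arc_rep d \<Gamma> s) - f (arc_rep d \<Gamma> t)) / (s - t)) \<longlongrightarrow> D) (at t within {0..1})"
    using D unfolding has_field_derivative_iff .
  have bnd: "\<bar>D\<bar> \<le> \<Lambda> * l" if U: "open U" "arc_rep d \<Gamma> t \<in> U" "Lip d U f \<le> ennreal \<Lambda>" "0 \<le> \<Lambda>" for U \<Lambda>
  proof (rule tendsto_upperbound[OF tendsto_rabs[OF lim]])
    have "(arc_rep d \<Gamma> \<longlongrightarrow> arc_rep d \<Gamma> t) (at t within {0..1})"
      using arc_rep_continuous[OF d \<Gamma>] t unfolding continuous_on_def by blast
    then have "\<forall>\<^sub>F s in at t within {0..1}. arc_rep d \<Gamma> s \<in> U"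
      using U(1,2) by (rule topological_tendstoD)
    moreover have "\<forall>\<^sub>F s in at t within {0..1}. s \<in> {0..1} \<and> s \<noteq> t"
      by (simp add: eventually_at_filter)
    ultimately show "\<forall>\<^sub>F s in at t within {0..1}. \<bar>(f (arc_rep d \<Gamma> s) - f (arc_rep d \<Gamma> t)) / (s - t)\<bar> \<le> \<Lambda> * l"
    proof eventually_elim
      case (elim s)
      have "\<bar>f (arc_rep d \<Gamma> s) - f (arc_rep d \<Gamma> t)\<bar> \<le> \<Lambda> * l * \<bar>s - t\<bar>"
        unfolding l_def using elim t U Lip_bound[OF d _ _ _ U(3,4)]
        by (intro arc_rep_lipschitz[OF d \<Gamma>, where A=U]) auto
      then show ?case
        using elim(2) by (simp add: field_simps)
    qed
  qed (rule at_within_Icc_nontrivial[OF zero_less_one t])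
  show ?thesis
  proof (cases "l = 0")
    \<comment> \<open>In \<open>ennreal\<close>, zero times an infinite slope is zero, so an arc of
      length zero needs the separate argument that \<open>D\<close> vanishes.\<close>
    case True
    have const: "f (arc_rep d \<Gamma> s) - f (arc_rep d \<Gamma> t) = 0" if "s \<in> {0..1}" for s
      using zero_variation_constant[OF d _ that t, of "arc_rep d \<Gamma>"] arc_rep_props(4)[OF d \<Gamma>, of 1] l True by simp
    have "((\<lambda>s. (f (arc_rep d \<Gamma> s) - f (arc_rep d \<Gamma> t)) / (s - t)) \<longlongrightarrow> 0) (at t within {0..1})"
    proof (rule tendsto_eventually)
      have "\<forall>\<^sub>F s in at t within {0..1}. s \<in> {0..1}"
        by (simp add: eventually_at_filter)
      then show "\<forall>\<^sub>F s in at t within {0..1}. (f (arc_rep d \<Gamma> s) - f (arc_rep d \<Gamma> t)) / (s - t) = 0"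
        by eventually_elim (simp add: const)
    qed
    then have "D = 0"
      using tendsto_unique[OF at_within_Icc_nontrivial[OF zero_less_one t] lim] by simp
    then show ?thesis
      by simp
  next
    case False
    then have "0 < l"
      using l by simp
    have "ennreal (\<bar>D\<bar> / l) \<le> asymptotic_slope d f (arc_rep d \<Gamma> t)"
      unfolding asymptotic_slope_def
    proof (rule INF_greatest)
      fix U assume "U \<in> {U. open U \<and> arc_rep d \<Gamma> t \<in> U}"
      then have U: "open U" "arc_rep d \<Gamma> t \<in> U"
        by auto
      show "ennreal (\<bar>D\<bar> / l) \<le> Lip d U f"
      proof (cases "Lip d U f")
        case (real \<Lambda>)
        then show ?thesis
          using bnd[OF U, of \<Lambda>] \<open>0 < l\<close> by (simp add: field_simps)
      qed simp
    qed
    then have "ennreal l * ennreal (\<bar>D\<bar> / l) \<le> ennreal l * asymptotic_slope d f (arc_rep d \<Gamma> t)"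
      by (intro mult_left_mono) auto
    then show ?thesis
      using \<open>0 < l\<close> l by (simp add: ennreal_mult[symmetric])
  qed
qed

lemma Lipb_along_arc:
  assumes d: "extended_distance d" and \<Gamma>: "\<Gamma> \<in> RA d" and f: "f \<in> Lipb d"
  obtains r where "r \<in> borel_measurable borel" "\<exists>C. \<forall>t. \<bar>r t\<bar> \<le> C"
    "integral {0..1} r = f (arc_rep d \<Gamma> 1) - f (arc_rep d \<Gamma> 0)"
    "AE t in lborel. t \<in> {0..1} \<longrightarrow> ((\<lambda>s. f (arc_rep d \<Gamma> s)) has_real_derivative r t) (at t within {0..1})"
proof -
  obtain C L where L: "\<And>x. \<bar>f x\<bar> \<le> C" "continuous_on UNIV f" "0 \<le> L"
    "\<And>x y. d x y < \<infinity> \<Longrightarrow> \<bar>f x - f y\<bar> \<le> L * enn2real (d x y)"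
    using LipbE[OF d f] by blast
  \<comment> \<open>Clamping time to \<open>{0..1}\<close> extends the function along the arc to a
    Lipschitz function on the whole line.\<close>
  define c where "c t = min 1 (max 0 t)" for t :: real
  define g where "g t = f (arc_rep d \<Gamma> (c t))" for t
  have c: "c t \<in> {0..1}" "\<bar>c s - c t\<bar> \<le> \<bar>s - t\<bar>" for s t
    unfolding c_def by auto
  have glip: "\<bar>g s - g t\<bar> \<le> L * enn2real (arc_length d \<Gamma>) * \<bar>s - t\<bar>" for s t
  proof -
    have "\<bar>g s - g t\<bar> \<le> L * enn2real (arc_length d \<Gamma>) * \<bar>c s - c t\<bar>"
      unfolding g_def using L c by (intro arc_rep_lipschitz[OF d \<Gamma>, where A=UNIV]) auto
    also have "\<dots> \<le> L * enn2real (arc_length d \<Gamma>) * \<bar>s - t\<bar>"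
      using c(2) L(3) by (intro mult_left_mono) auto
    finally show ?thesis .
  qed
  obtain r where r: "r \<in> borel_measurable borel" "\<And>x. \<bar>r x\<bar> \<le> L * enn2real (arc_length d \<Gamma>)"
    "\<And>a b. a \<le> b \<Longrightarrow> integral {a..b} r = g b - g a"
    "AE x in lborel. (g has_real_derivative r x) (at x)"
    using lipschitz_real_derivative[of g, OF glip] by blast
  have gc: "g s = f (arc_rep d \<Gamma> s)" if "s \<in> {0..1}" for s
    using that unfolding g_def c_def by simp
  have "AE t in lborel. t \<in> {0..1} \<longrightarrow> ((\<lambda>s. f (arc_rep d \<Gamma> s)) has_real_derivative r t) (at t within {0..1})"
    using r(4)
  proof eventually_elim
    case (elim t)
    then have "(g has_real_derivative r t) (at t within {0..1})"
      by (rule has_field_derivative_at_within)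
    then show ?case
      using gc by (auto intro: has_field_derivative_transform_within[where d=1])
  qed
  then show thesis
    using that[of r] r(1,2) r(3)[of 0 1] gc[of 0] gc[of 1] by auto
qed

text \<open>The upper limit is taken over the reached times \<open>s = t + h\<close> instead of the
  increments: then one countable set of times works for all \<open>t\<close>, and each quotient
  involves evaluation at a fixed rational time. Restriction to rational \<open>s\<close> is allowed
  because the quotient is continuous in \<open>s \<noteq> t\<close>; the value
  \<open>- \<infinity>\<close> discards the times outside the punctured ball.\<close>

lemma Dupper_eq_INF_SUP:
  assumes w: "continuous_on {0..1} (\<lambda>s. f (arc_rep d \<Gamma> s))" and t: "t \<in> {0..1}"
  shows "Limsup (at 0 within {h. t + h \<in> {0..1}}) (\<lambda>h. ereal ((f (arc_rep d \<Gamma> (t + h)) - f (arc_rep d \<Gamma> t)) / h)) =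
    (INF n. SUP s\<in>\<rat> \<inter> {0..1}. if 0 < \<bar>s - t\<bar> \<and> \<bar>s - t\<bar> < 1 / real (Suc n)
       then ereal ((f (arc_rep d \<Gamma> s) - f (arc_rep d \<Gamma> t)) / (s - t)) else - \<infinity>)"
proof -
  define Q where "Q s = ereal ((f (arc_rep d \<Gamma> s) - f (arc_rep d \<Gamma> t)) / (s - t))" for s
  define S where "S = {h. t + h \<in> {0..1}}"
  define A where "A e = (SUP h\<in>S \<inter> ball 0 e - {0}. Q (t + h))" for e
  define B where "B e = (SUP s\<in>\<rat> \<inter> {0..1}. if 0 < \<bar>s - t\<bar> \<and> \<bar>s - t\<bar> < e then Q s else - \<infinity>)" for e
  have AB: "A e = B e" for e
  proof (rule antisym)
    show "A e \<le> B e"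
      unfolding A_def
    proof (rule SUP_least)
      fix h assume h: "h \<in> S \<inter> ball 0 e - {0}"
      define s0 where "s0 = t + h"
      have s0: "s0 \<in> {0..1}" "s0 \<noteq> t" "\<bar>s0 - t\<bar> < e"
        using h unfolding s0_def S_def by (auto simp: dist_real_def)
      show "Q (t + h) \<le> B e"
        unfolding s0_def[symmetric]
      proof (rule dense_le)
        fix c assume "c < Q s0"
        have "continuous (at s0 within {0..1}) (\<lambda>s. (f (arc_rep d \<Gamma> s) - f (arc_rep d \<Gamma> t)) / (s - t))"
          using w s0(1,2) by (intro continuous_intros) (auto simp: continuous_on_eq_continuous_within)
        then have "(Q \<longlongrightarrow> Q s0) (at s0 within {0..1})"
          unfolding Q_def by (simp add: continuous_within)
        then have "\<forall>\<^sub>F s in at s0 within {0..1}. c < Q s"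
          using \<open>c < Q s0\<close> by (rule order_tendstoD)
        then obtain \<delta> where \<delta>: "0 < \<delta>" "\<And>s. s \<in> {0..1} \<Longrightarrow> s \<noteq> s0 \<Longrightarrow> dist s s0 < \<delta> \<Longrightarrow> c < Q s"
          unfolding eventually_at by blast
        \<comment> \<open>The three bounds keep \<open>s\<close> where \<open>Q\<close> exceeds
          \<open>c\<close>, away from \<open>t\<close>, and closer than \<open>e\<close> to
          \<open>t\<close>.\<close>
        define \<eta> where "\<eta> = min \<delta> (min \<bar>s0 - t\<bar> (e - \<bar>s0 - t\<bar>))"
        have "0 < \<eta>"
          unfolding \<eta>_def using \<delta>(1) s0(2,3) by simp
        then have "max 0 (s0 - \<eta>) < min 1 (s0 + \<eta>)"
          using s0(1) by auto
        then obtain s where s: "s \<in> \<rat>" "max 0 (s0 - \<eta>) < s" "s < min 1 (s0 + \<eta>)"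
          using Rats_dense_in_real by blast
        then have s01: "s \<in> \<rat> \<inter> {0..1}" "\<bar>s - s0\<bar> < \<eta>"
          by auto
        then have cond: "0 < \<bar>s - t\<bar> \<and> \<bar>s - t\<bar> < e"
          unfolding \<eta>_def by auto
        have "c < Q s"
          using \<delta>(2)[of s] s01 \<open>c < Q s0\<close> unfolding \<eta>_def by (cases "s = s0") (auto simp: dist_real_def)
        then have "c \<le> (if 0 < \<bar>s - t\<bar> \<and> \<bar>s - t\<bar> < e then Q s else - \<infinity>)"
          using cond by simp
        also have "\<dots> \<le> B e"
          unfolding B_def by (rule SUP_upper[OF s01(1)])
        finally show "c \<le> B e" .
      qed
    qed
    show "B e \<le> A e"
      unfolding B_def
    proof (rule SUP_least)
      fix s assume s: "s \<in> \<rat> \<inter> {0..1::real}"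
      show "(if 0 < \<bar>s - t\<bar> \<and> \<bar>s - t\<bar> < e then Q s else - \<infinity>) \<le> A e"
      proof (cases "0 < \<bar>s - t\<bar> \<and> \<bar>s - t\<bar> < e")
        case True
        then have "s - t \<in> S \<inter> ball 0 e - {0}"
          using s unfolding S_def by (auto simp: dist_real_def)
        then have "Q (t + (s - t)) \<le> A e"
          unfolding A_def by (rule SUP_upper)
        then show ?thesis
          using True by simp
      next
        case False
        then show ?thesis
          by (subst if_not_P) simp_all
      qed
    qed
  qed
  have "Limsup (at 0 within S) (\<lambda>h. ereal ((f (arc_rep d \<Gamma> (t + h)) - f (arc_rep d \<Gamma> t)) / h)) = (INF e\<in>{0<..}. A e)"
    unfolding Limsup_within A_def Q_def by simp
  also have "\<dots> = (INF n. A (1 / real (Suc n)))"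
  proof (rule antisym)
    show "(INF e\<in>{0<..}. A e) \<le> (INF n. A (1 / real (Suc n)))"
      by (intro INF_greatest INF_lower) simp
    show "(INF n. A (1 / real (Suc n))) \<le> (INF e\<in>{0<..}. A e)"
    proof (rule INF_greatest)
      fix e :: real assume "e \<in> {0<..}"
      then obtain n where "1 / real (Suc n) < e"
        using nat_approx_posE by auto
      then have "A (1 / real (Suc n)) \<le> A e"
        unfolding A_def by (intro SUP_subset_mono) auto
      then show "(INF n. A (1 / real (Suc n))) \<le> A e"
        by (rule INF_lower2[OF UNIV_I])
    qed
  qed
  finally show ?thesis
    unfolding AB unfolding B_def Q_def S_def .
qed

section \<open>The upper derivative as a function of arc and time\<close>

context radon_plan
begin

abbreviation P :: "((real \<Rightarrow> 'a) set \<times> real) measure" where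
  "P \<equiv> \<pi> \<Otimes>\<^sub>M unit_interval"

lemma mem_space_P: "(\<Gamma>, t) \<in> space P \<longleftrightarrow> \<Gamma> \<in> RA d \<and> t \<in> {0..1}"
  by (simp add: space_pair_measure space_plan unit_interval)

text \<open>Only evaluations at rational times and at the running time occur, all of them Borel,
  combined by countable suprema and infima.\<close>

lemma measurable_Dupper:
  assumes f: "continuous_on UNIV f"
  shows "Dupper d f \<in> borel_measurable P"
proof -
  have fb: "f \<in> borel_measurable borel"
    using f by (rule borel_measurable_continuous_onI)
  define q where "q n s p = (if 0 < \<bar>s - snd p\<bar> \<and> \<bar>s - snd p\<bar> < 1 / real (Suc n)
    then ereal ((f (arc_rep d (fst p) s) - f (ehat d p)) / (s - snd p)) else - \<infinity>)" for n s p
  have q: "q n s \<in> borel_measurable P" if "s \<in> {0..1}" for n s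
  proof -
    have [measurable]: "(\<lambda>p. f (arc_rep d (fst p) s)) \<in> borel_measurable P"
      by (rule measurable_compose[OF measurable_fst measurable_compose[OF measurable_arc_rep[OF that] fb]])
    have [measurable]: "(\<lambda>p. f (ehat d p)) \<in> borel_measurable P"
      by (rule measurable_compose[OF measurable_ehat fb])
    have "(\<lambda>x. x) \<in> borel_measurable unit_interval"
      by (rule measurable_restrict_space1) simp
    then have [measurable]: "snd \<in> borel_measurable P"
      by (rule measurable_compose[OF measurable_snd])
    show ?thesis
      unfolding q_def by measurable
  qed
  have "(\<lambda>p. real_of_ereal (INF n. SUP s\<in>\<rat> \<inter> {0..1}. q n s p)) \<in> borel_measurable P"
    using q by (intro borel_measurable_real_of_ereal borel_measurable_INF borel_measurable_SUP) (auto intro: countable_Int1 countable_rat)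
  moreover have "Dupper d f p = real_of_ereal (INF n. SUP s\<in>\<rat> \<inter> {0..1}. q n s p)" if "p \<in> space P" for p
  proof -
    obtain \<Gamma> t where p: "p = (\<Gamma>, t)" "\<Gamma> \<in> RA d" "t \<in> {0..1}"
      using \<open>p \<in> space P\<close> mem_space_P by (metis surj_pair)
    have w: "continuous_on {0..1} (\<lambda>s. f (arc_rep d \<Gamma> s))"
      using f by (intro continuous_on_compose2[OF f arc_rep_continuous[OF d p(2)]]) auto
    show ?thesis
      unfolding p(1) Dupper_def prod.case Dupper_eq_INF_SUP[of f d \<Gamma>, OF w p(3)] q_def ehat_def fst_conv snd_conv ..
  qed
  ultimately show ?thesis
    by (subst measurable_cong) auto
qed

lemma measurable_Dupper_Lipb [measurable]: "f \<in> Lipb d \<Longrightarrow> Dupper d f \<in> borel_measurable P"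
  unfolding Lipb_def by (intro measurable_Dupper) blast

text \<open>For one arc the Borel derivative \<open>r\<close> agrees almost everywhere with the
  upper derivative, which thus inherits the fundamental theorem of calculus.\<close>

lemma AE_arc_derivative:
  assumes \<Gamma>: "\<Gamma> \<in> RA d" and f: "f \<in> Lipb d"
  shows "AE t in unit_interval. ((\<lambda>s. f (arc_rep d \<Gamma> s)) has_real_derivative Dupper d f (\<Gamma>, t)) (at t within {0..1})"
    and "(\<integral>t. Dupper d f (\<Gamma>, t) \<partial>unit_interval) = f (arc_rep d \<Gamma> 1) - f (arc_rep d \<Gamma> 0)"
proof -
  obtain r where r: "r \<in> borel_measurable borel" "\<exists>C. \<forall>t. \<bar>r t\<bar> \<le> C"
    "integral {0..1} r = f (arc_rep d \<Gamma> 1) - f (arc_rep d \<Gamma> 0)"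
    "AE t in lborel. t \<in> {0..1} \<longrightarrow> ((\<lambda>s. f (arc_rep d \<Gamma> s)) has_real_derivative r t) (at t within {0..1})"
    by (rule Lipb_along_arc[OF d \<Gamma> f])
  have r': "AE t in unit_interval. ((\<lambda>s. f (arc_rep d \<Gamma> s)) has_real_derivative r t) (at t within {0..1}) \<and>
      Dupper d f (\<Gamma>, t) = r t"
  proof (subst AE_restrict_space_iff)
    show "AE x in lborel. x \<in> {0..1} \<longrightarrow> ((\<lambda>s. f (arc_rep d \<Gamma> s)) has_real_derivative r x) (at x within {0..1}) \<and>
      Dupper d f (\<Gamma>, x) = r x"
      using r(4) by eventually_elim (auto intro: Dupper_eq)
  qed simp
  then show "AE t in unit_interval. ((\<lambda>s. f (arc_rep d \<Gamma> s)) has_real_derivative Dupper d f (\<Gamma>, t)) (at t within {0..1})"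
    by eventually_elim simp
  have m1: "(\<lambda>t. Dupper d f (\<Gamma>, t)) \<in> borel_measurable unit_interval"
    using f \<Gamma> by (intro measurable_compose[OF measurable_Pair1' measurable_Dupper_Lipb]) (auto simp: space_plan)
  have m2: "r \<in> borel_measurable unit_interval"
    using r(1) by (intro measurable_restrict_space1) simp
  obtain C where C: "\<And>t. \<bar>r t\<bar> \<le> C"
    using r(2) by blast
  have "(\<integral>t. Dupper d f (\<Gamma>, t) \<partial>unit_interval) = (\<integral>t. r t \<partial>unit_interval)"
    using r' by (intro integral_cong_AE m1 m2) auto
  also have "\<dots> = (LBINT t:{0..1}. r t)"
    by (simp add: integral_restrict_space set_lebesgue_integral_def)
  also have "\<dots> = integral {0..1} r"
    by (rule bounded_borel_integrable_on(3)[OF r(1) C])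
  finally show "(\<integral>t. Dupper d f (\<Gamma>, t) \<partial>unit_interval) = f (arc_rep d \<Gamma> 1) - f (arc_rep d \<Gamma> 0)"
    using r(3) by simp
qed

text \<open>Upper derivatives satisfy no sum or product rule in general. The rules hold at all times
  where both derivatives exist, hence at almost every time of every arc, and pass to pairs because
  the exceptional set is measurable.\<close>

lemma AE_derivative_rules:
  assumes f: "f \<in> Lipb d" and g: "g \<in> Lipb d"
  shows "AE p in P. Dupper d (\<lambda>x. f x + g x) p = Dupper d f p + Dupper d g p"
    and "AE p in P. Dupper d (\<lambda>x. c * f x) p = c * Dupper d f p"
    and "AE p in P. Dupper d (\<lambda>x. f x * g x) p = f (ehat d p) * Dupper d g p + g (ehat d p) * Dupper d f p"
proof -
  have fb [measurable]: "f \<in> borel_measurable borel" "g \<in> borel_measurable borel"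
    using f g unfolding Lipb_def by (auto intro: borel_measurable_continuous_onI)
  note [measurable] = measurable_Dupper_Lipb[OF f] measurable_Dupper_Lipb[OF g]
    measurable_Dupper_Lipb[OF Lipb_add[OF d f g]] measurable_Dupper_Lipb[OF Lipb_cmult[OF d f]]
    measurable_Dupper_Lipb[OF Lipb_mult[OF d f g]]
  have AE: "AE \<Gamma> in \<pi>. AE t in unit_interval.
      ((\<lambda>s. f (arc_rep d \<Gamma> s)) has_real_derivative Dupper d f (\<Gamma>, t)) (at t within {0..1}) \<and>
      ((\<lambda>s. g (arc_rep d \<Gamma> s)) has_real_derivative Dupper d g (\<Gamma>, t)) (at t within {0..1}) \<and> t \<in> {0..1}"
  proof (rule AE_I2)
    fix \<Gamma> assume "\<Gamma> \<in> space \<pi>"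
    then have \<Gamma>: "\<Gamma> \<in> RA d"
      by (simp add: space_plan)
    show "AE t in unit_interval.
      ((\<lambda>s. f (arc_rep d \<Gamma> s)) has_real_derivative Dupper d f (\<Gamma>, t)) (at t within {0..1}) \<and>
      ((\<lambda>s. g (arc_rep d \<Gamma> s)) has_real_derivative Dupper d g (\<Gamma>, t)) (at t within {0..1}) \<and> t \<in> {0..1}"
      using AE_arc_derivative(1)[OF \<Gamma> f] AE_arc_derivative(1)[OF \<Gamma> g] AE_space[of unit_interval]
      by eventually_elim (simp add: unit_interval)
  qed
  have lift: "AE \<Gamma> in \<pi>. AE t in unit_interval. Q \<Gamma> t"
    if Q: "\<And>\<Gamma> t. ((\<lambda>s. f (arc_rep d \<Gamma> s)) has_real_derivative Dupper d f (\<Gamma>, t)) (at t within {0..1}) \<Longrightarrow>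
      ((\<lambda>s. g (arc_rep d \<Gamma> s)) has_real_derivative Dupper d g (\<Gamma>, t)) (at t within {0..1}) \<Longrightarrow>
      t \<in> {0..1} \<Longrightarrow> Q \<Gamma> t" for Q
    using AE
  proof eventually_elim
    case (elim \<Gamma>)
    then show ?case
      by eventually_elim (use Q in blast)
  qed
  show "AE p in P. Dupper d (\<lambda>x. f x + g x) p = Dupper d f p + Dupper d g p"
  proof (rule P.AE_pair_measure)
    show "AE \<Gamma> in \<pi>. AE t in unit_interval. Dupper d (\<lambda>x. f x + g x) (\<Gamma>, t) = Dupper d f (\<Gamma>, t) + Dupper d g (\<Gamma>, t)"
      by (rule lift, rule Dupper_eq) (auto intro!: derivative_eq_intros)
  qed measurable
  show "AE p in P. Dupper d (\<lambda>x. c * f x) p = c * Dupper d f p"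
  proof (rule P.AE_pair_measure)
    show "AE \<Gamma> in \<pi>. AE t in unit_interval. Dupper d (\<lambda>x. c * f x) (\<Gamma>, t) = c * Dupper d f (\<Gamma>, t)"
      by (rule lift, rule Dupper_eq) (auto intro!: derivative_eq_intros)
  qed measurable
  show "AE p in P. Dupper d (\<lambda>x. f x * g x) p = f (ehat d p) * Dupper d g p + g (ehat d p) * Dupper d f p"
  proof (rule P.AE_pair_measure)
    show "AE \<Gamma> in \<pi>. AE t in unit_interval. Dupper d (\<lambda>x. f x * g x) (\<Gamma>, t) =
        f (ehat d (\<Gamma>, t)) * Dupper d g (\<Gamma>, t) + g (ehat d (\<Gamma>, t)) * Dupper d f (\<Gamma>, t)"
      unfolding ehat_def prod.case by (rule lift, rule Dupper_eq) (auto intro!: derivative_eq_intros)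
  qed measurable
qed

lemma AE_Dupper_le_slope:
  assumes f: "f \<in> Lipb d"
  shows "AE \<Gamma> in \<pi>. AE t in unit_interval.
    ennreal \<bar>Dupper d f (\<Gamma>, t)\<bar> \<le> arc_length d \<Gamma> * asymptotic_slope d f (ehat d (\<Gamma>, t))"
proof (rule AE_I2)
  fix \<Gamma> assume "\<Gamma> \<in> space \<pi>"
  then have \<Gamma>: "\<Gamma> \<in> RA d"
    by (simp add: space_plan)
  show "AE t in unit_interval. ennreal \<bar>Dupper d f (\<Gamma>, t)\<bar> \<le> arc_length d \<Gamma> * asymptotic_slope d f (ehat d (\<Gamma>, t))"
    using AE_arc_derivative(1)[OF \<Gamma> f] AE_space[of unit_interval]
    by eventually_elim (auto simp: ehat_def unit_interval intro: derivative_le_slope[OF d \<Gamma>])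
qed

end

section \<open>Densities and essential infima\<close>

text \<open>Preimages and the weight are measurable already for \<open>M\<close>, so both sides
  reduce to the same integral over \<open>M\<close>.\<close>

lemma distr_density_completion:
  assumes [measurable]: "f \<in> M \<rightarrow>\<^sub>M N" "w \<in> borel_measurable M"
  shows "distr (density (completion M) w) N f = distr (density M w) N f"
proof (rule measure_eqI)
  fix A assume "A \<in> sets (distr (density (completion M) w) N f)"
  then have [measurable]: "A \<in> sets N"
    by simp
  have [measurable]: "f \<in> completion M \<rightarrow>\<^sub>M N" "w \<in> borel_measurable (completion M)"
    by (simp_all add: measurable_completion)
  have "f -` A \<inter> space M \<in> sets M"
    by measurable
  then have [measurable]: "f -` A \<inter> space M \<in> sets (completion M)"
    by (rule sets_completionI_sets)
  have "emeasure (distr (density (completion M) w) N f) A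
      = (\<integral>\<^sup>+x. w x * indicator (f -` A \<inter> space M) x \<partial>completion M)"
    by (simp add: emeasure_distr emeasure_density)
  also have "\<dots> = (\<integral>\<^sup>+x. w x * indicator (f -` A \<inter> space M) x \<partial>M)"
    by (rule nn_integral_completion)
  also have "\<dots> = emeasure (distr (density M w) N f) A"
    by (simp add: emeasure_distr emeasure_density)
  finally show "emeasure (distr (density (completion M) w) N f) A = emeasure (distr (density M w) N f) A" .
qed simp

lemma distr_completion:
  assumes "f \<in> M \<rightarrow>\<^sub>M N"
  shows "distr (completion M) N f = distr M N f"
  using distr_density_completion[OF assms, of "\<lambda>_. 1"] by (simp add: density_1)

text \<open>The test set is where \<open>v < u\<close>. There \<open>v\<close> has finite integral,
  being below \<open>u\<close>, so the two integrals may be subtracted, even though \<open>v\<close>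
  may be infinite elsewhere.\<close>

lemma AE_le_if_set_nn_integral_le:
  assumes [measurable]: "u \<in> borel_measurable M" "v \<in> borel_measurable M"
    and fin: "(\<integral>\<^sup>+x. u x \<partial>M) < \<infinity>"
    and le: "\<And>B. B \<in> sets M \<Longrightarrow> (\<integral>\<^sup>+x. u x * indicator B x \<partial>M) \<le> (\<integral>\<^sup>+x. v x * indicator B x \<partial>M)"
  shows "AE x in M. u x \<le> v x"
proof -
  define B where "B = {x \<in> space M. v x < u x}"
  have [measurable]: "B \<in> sets M"
    unfolding B_def by measurable
  have vu: "v x * indicator B x \<le> u x * indicator B x" for x
    unfolding B_def by (auto simp: indicator_def)
  have "(\<integral>\<^sup>+x. v x * indicator B x \<partial>M) \<le> (\<integral>\<^sup>+x. u x \<partial>M)"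
    by (intro nn_integral_mono order_trans[OF vu]) (auto simp: indicator_def)
  then have vfin: "(\<integral>\<^sup>+x. v x * indicator B x \<partial>M) \<noteq> \<infinity>"
    using fin by auto
  have "(\<integral>\<^sup>+x. u x * indicator B x - v x * indicator B x \<partial>M)
      = (\<integral>\<^sup>+x. u x * indicator B x \<partial>M) - (\<integral>\<^sup>+x. v x * indicator B x \<partial>M)"
    using vfin vu by (intro nn_integral_diff) auto
  also have "\<dots> = 0"
    using le[of B] vfin by (simp add: diff_eq_0_iff_ennreal less_top)
  finally have "AE x in M. u x * indicator B x - v x * indicator B x = 0"
    by (subst (asm) nn_integral_0_iff_AE) auto
  moreover have "AE x in M. x \<in> space M"
    by (rule AE_space)
  ultimately show ?thesis
  proof eventually_elim
    case (elim x)
    show ?case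
    proof (rule ccontr)
      assume "\<not> u x \<le> v x"
      then have "x \<in> B" "v x < u x"
        using elim(2) unfolding B_def by auto
      then show False
        using elim(1) by (auto simp: diff_eq_0_iff_ennreal)
    qed
  qed
qed

text \<open>A finite measure has an almost everywhere finite density, so nothing is lost when the
  extended derivative is replaced by a real one.\<close>

lemma real_deriv_density:
  assumes m: "finite_measure m" and \<nu>: "finite_measure \<nu>" "sets \<nu> = sets m" "absolutely_continuous m \<nu>"
  shows "real_deriv m \<nu> \<in> borel_measurable m" "0 \<le> real_deriv m \<nu> x"
    "density m (\<lambda>x. ennreal (real_deriv m \<nu> x)) = \<nu>" "integrable m (real_deriv m \<nu>)"
proof -
  interpret m: finite_measure m by fact
  interpret \<nu>: finite_measure \<nu> by fact
  show [measurable]: "real_deriv m \<nu> \<in> borel_measurable m"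
    unfolding real_deriv_def by measurable
  show nn: "0 \<le> real_deriv m \<nu> x" for x
    unfolding real_deriv_def by simp
  have "AE x in m. RN_deriv m \<nu> x \<noteq> \<infinity>"
    by (rule m.RN_deriv_finite[OF \<nu>.sigma_finite_measure_axioms \<nu>(3,2)])
  then have "AE x in m. ennreal (real_deriv m \<nu> x) = RN_deriv m \<nu> x"
    by eventually_elim (simp add: real_deriv_def less_top)
  then have "density m (\<lambda>x. ennreal (real_deriv m \<nu> x)) = density m (RN_deriv m \<nu>)"
    by (intro density_cong) auto
  then show dens: "density m (\<lambda>x. ennreal (real_deriv m \<nu> x)) = \<nu>"
    using m.density_RN_deriv[OF \<nu>(3,2)] by simp
  have "(\<integral>\<^sup>+x. ennreal (real_deriv m \<nu> x) \<partial>m) = emeasure (density m (\<lambda>x. ennreal (real_deriv m \<nu> x))) (space m)"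
    by (subst emeasure_density) (auto intro!: nn_integral_cong)
  also have "\<dots> < \<infinity>"
    unfolding dens using \<nu>.emeasure_finite[of "space m"] by (simp add: less_top[symmetric])
  finally show "integrable m (real_deriv m \<nu>)"
    using nn by (intro integrableI_nonneg) auto
qed

lemma real_deriv_integral:
  assumes m: "finite_measure m" and \<nu>: "finite_measure \<nu>" "sets \<nu> = sets m" "absolutely_continuous m \<nu>"
    and \<phi>: "\<phi> \<in> borel_measurable m" "\<And>x. \<bar>\<phi> x\<bar> \<le> C"
  shows "integrable m (\<lambda>x. \<phi> x * real_deriv m \<nu> x)" "(\<integral>x. \<phi> x * real_deriv m \<nu> x \<partial>m) = (\<integral>x. \<phi> x \<partial>\<nu>)"
proof -
  note r = real_deriv_density[OF m \<nu>]
  show "integrable m (\<lambda>x. \<phi> x * real_deriv m \<nu> x)"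
  proof (rule Bochner_Integration.integrable_bound)
    show "integrable m (\<lambda>x. C * real_deriv m \<nu> x)"
      using r(4) by simp
    show "(\<lambda>x. \<phi> x * real_deriv m \<nu> x) \<in> borel_measurable m"
      using \<phi>(1) r(1) by measurable
    show "AE x in m. norm (\<phi> x * real_deriv m \<nu> x) \<le> norm (C * real_deriv m \<nu> x)"
    proof (rule AE_I2)
      show "norm (\<phi> x * real_deriv m \<nu> x) \<le> norm (C * real_deriv m \<nu> x)" for x
        unfolding real_norm_def abs_mult by (intro mult_right_mono order_trans[OF \<phi>(2) abs_ge_self]) simp
    qed
  qed
  have "(\<integral>x. \<phi> x \<partial>\<nu>) = (\<integral>x. \<phi> x \<partial>density m (\<lambda>x. ennreal (real_deriv m \<nu> x)))"
    unfolding r(3) ..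
  also have "\<dots> = (\<integral>x. real_deriv m \<nu> x *\<^sub>R \<phi> x \<partial>m)"
    using \<phi>(1) r(1,2) by (intro integral_density) auto
  finally show "(\<integral>x. \<phi> x * real_deriv m \<nu> x \<partial>m) = (\<integral>x. \<phi> x \<partial>\<nu>)"
    by (simp add: mult.commute)
qed

section \<open>Closure properties of q-integrable functions\<close>

lemma Lq_dominated:
  assumes g: "g \<in> Lq m q" and "0 \<le> q" and [measurable]: "u \<in> borel_measurable m"
    and le: "AE x in m. \<bar>u x\<bar> \<le> c * \<bar>g x\<bar>" and c: "0 \<le> c"
  shows "u \<in> Lq m q"
proof -
  have [measurable]: "g \<in> borel_measurable m" and gi: "integrable m (\<lambda>x. \<bar>g x\<bar> powr q)"
    using g unfolding Lq_def by auto
  have "integrable m (\<lambda>x. \<bar>u x\<bar> powr q)"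
  proof (rule Bochner_Integration.integrable_bound)
    show "integrable m (\<lambda>x. c powr q * \<bar>g x\<bar> powr q)"
      using gi by simp
    show "AE x in m. norm (\<bar>u x\<bar> powr q) \<le> norm (c powr q * \<bar>g x\<bar> powr q)"
      using le
    proof eventually_elim
      case (elim x)
      then have "\<bar>u x\<bar> powr q \<le> (c * \<bar>g x\<bar>) powr q"
        using \<open>0 \<le> q\<close> by (intro powr_mono2) auto
      then show ?case
        using c by (simp add: powr_mult)
    qed
  qed measurable
  then show ?thesis
    unfolding Lq_def by simp
qed

lemma Lq_max:
  assumes "g \<in> Lq m q" "h \<in> Lq m q" "0 \<le> q"
  shows "(\<lambda>x. max \<bar>g x\<bar> \<bar>h x\<bar>) \<in> Lq m q"
proof -
  have [measurable]: "g \<in> borel_measurable m" "h \<in> borel_measurable m"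
    and i: "integrable m (\<lambda>x. \<bar>g x\<bar> powr q)" "integrable m (\<lambda>x. \<bar>h x\<bar> powr q)"
    using assms unfolding Lq_def by auto
  have "integrable m (\<lambda>x. \<bar>max \<bar>g x\<bar> \<bar>h x\<bar>\<bar> powr q)"
  proof (rule Bochner_Integration.integrable_bound)
    show "integrable m (\<lambda>x. \<bar>g x\<bar> powr q + \<bar>h x\<bar> powr q)"
      using i by simp
    show "AE x in m. norm (\<bar>max \<bar>g x\<bar> \<bar>h x\<bar>\<bar> powr q) \<le> norm (\<bar>g x\<bar> powr q + \<bar>h x\<bar> powr q)"
      by (rule AE_I2) (simp add: max_def)
  qed measurable
  then show ?thesis
    unfolding Lq_def by simp
qed

text \<open>Twice the maximum of the absolute values dominates the difference; this avoids
  Minkowski's inequality.\<close>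

lemma Lq_diff:
  assumes g: "g \<in> Lq m q" and h: "h \<in> Lq m q" and q: "0 \<le> q"
  shows "(\<lambda>x. g x - h x) \<in> Lq m q"
proof (rule Lq_dominated[OF Lq_max[OF g h q] q, where c=2])
  show "(\<lambda>x. g x - h x) \<in> borel_measurable m"
    using g h unfolding Lq_def by auto
qed auto

lemma Lq_integrable:
  assumes m: "finite_measure m" and g: "g \<in> Lq m q" and q: "1 \<le> q"
  shows "integrable m g"
proof -
  interpret finite_measure m by fact
  have [measurable]: "g \<in> borel_measurable m" and gi: "integrable m (\<lambda>x. \<bar>g x\<bar> powr q)"
    using g unfolding Lq_def by auto
  show ?thesis
  proof (rule Bochner_Integration.integrable_bound)
    \<comment> \<open>The constant 1, integrable because \<open>m\<close> is finite, takes care of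
      the points with \<open>\<bar>g x\<bar> \<le> 1\<close>.\<close>
    show "integrable m (\<lambda>x. 1 + \<bar>g x\<bar> powr q)"
      using gi by simp
    show "AE x in m. norm (g x) \<le> norm (1 + \<bar>g x\<bar> powr q)"
    proof (rule AE_I2)
      fix x
      show "norm (g x) \<le> norm (1 + \<bar>g x\<bar> powr q)"
      proof (cases "\<bar>g x\<bar> \<le> 1")
        case True
        then show ?thesis
          by (simp add: add_increasing2)
      next
        case False
        then have "\<bar>g x\<bar> powr 1 \<le> \<bar>g x\<bar> powr q"
          using q by (intro powr_mono) auto
        then show ?thesis
          by simp
      qed
    qed
  qed measurable
qed

text \<open>A sequence minimising the integral, made decreasing by closure under minima, converges
  to a \<open>u\<close> with the least possible integral \<open>I\<close>. For \<open>h\<close> in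
  \<open>G\<close> the minimum of \<open>u\<close> and \<open>h\<close> is again a limit of members
  of \<open>G\<close> and has integral at least \<open>I\<close>, so it cannot fall below
  \<open>u\<close> on a set of positive measure. Only countably many members of \<open>G\<close>
  enter the construction, so \<open>u\<close> is measurable.\<close>

lemma ess_Inf_exists:
  fixes G :: "('a \<Rightarrow> real) set"
  assumes ne: "G \<noteq> {}" and int: "\<And>g. g \<in> G \<Longrightarrow> integrable M g"
    and nonneg: "\<And>g. g \<in> G \<Longrightarrow> AE x in M. 0 \<le> g x"
    and min: "\<And>g h. g \<in> G \<Longrightarrow> h \<in> G \<Longrightarrow> (\<lambda>x. min (g x) (h x)) \<in> G"
  shows "\<exists>u. is_ess_Inf M G u"
proof -
  define I where "I = (INF g\<in>G. \<integral>x. g x \<partial>M)"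
  have bdd: "bdd_below ((\<lambda>g. \<integral>x. g x \<partial>M) ` G)"
    using nonneg by (auto intro!: bdd_belowI2[where m=0] integral_nonneg_AE)
  have I_le: "I \<le> (\<integral>x. g x \<partial>M)" if "g \<in> G" for g
    unfolding I_def using that by (rule cINF_lower[OF bdd])
  have "\<forall>n. \<exists>g\<in>G. (\<integral>x. g x \<partial>M) < I + 1 / real (Suc n)"
  proof
    fix n
    have "(INF g\<in>G. \<integral>x. g x \<partial>M) < I + 1 / real (Suc n)"
      unfolding I_def by simp
    from cInf_lessD[OF _ this] show "\<exists>g\<in>G. (\<integral>x. g x \<partial>M) < I + 1 / real (Suc n)"
      using ne by auto
  qed
  then obtain g where g: "\<And>n. g n \<in> G" "\<And>n. (\<integral>x. g n x \<partial>M) < I + 1 / real (Suc n)"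
    by metis
  define v where "v = rec_nat (g 0) (\<lambda>k u x. min (u x) (g (Suc k) x))"
  have v0: "v 0 = g 0" and vS: "v (Suc n) = (\<lambda>x. min (v n x) (g (Suc n) x))" for n
    unfolding v_def by simp_all
  have vG: "v n \<in> G" for n
    by (induction n) (auto simp: v0 vS intro: g min)
  have v_le: "v n x \<le> g n x" for n x
    by (cases n) (auto simp: v0 vS)
  have v_dec: "decseq (\<lambda>n. v n x)" for x
    by (rule decseq_SucI) (simp add: vS)
  have [measurable]: "v n \<in> borel_measurable M" for n
    using int[OF vG] by simp
  have v_nonneg: "AE x in M. \<forall>n. 0 \<le> v n x"
    using nonneg[OF vG] by (simp add: AE_all_countable)
  define u where "u x = lim (\<lambda>n. v n x)" for x
  have [measurable]: "u \<in> borel_measurable M"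
    unfolding u_def by measurable
  have lim: "AE x in M. (\<lambda>n. v n x) \<longlonglongrightarrow> u x"
    using v_nonneg
  proof eventually_elim
    case (elim x)
    then obtain L where "(\<lambda>n. v n x) \<longlonglongrightarrow> L"
      using decseq_convergent[OF v_dec[of x], of 0] by blast
    then show ?case
      unfolding u_def by (simp add: limI)
  qed
  have u_le_v: "AE x in M. \<forall>n. u x \<le> v n x"
    using lim by eventually_elim (use decseq_ge[OF v_dec] in blast)
  have min_int: "I \<le> (\<integral>x. min (u x) (h x) \<partial>M) \<and> integrable M (\<lambda>x. min (u x) (h x))" if h: "h \<in> G" for h
  proof -
    have [measurable]: "h \<in> borel_measurable M"
      using int[OF h] by simp
    have AE1: "AE x in M. (\<lambda>n. min (v n x) (h x)) \<longlonglongrightarrow> min (u x) (h x)"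
      using lim by eventually_elim (intro tendsto_intros)
    have AE2: "AE x in M. norm (min (v n x) (h x)) \<le> norm (h x)" for n
      using v_nonneg nonneg[OF h] by eventually_elim (auto simp: min_def)
    have "(\<lambda>n. \<integral>x. min (v n x) (h x) \<partial>M) \<longlonglongrightarrow> (\<integral>x. min (u x) (h x) \<partial>M)"
      by (rule integral_dominated_convergence[OF _ _ integrable_norm[OF int[OF h]] AE1 AE2]) measurable
    then have "I \<le> (\<integral>x. min (u x) (h x) \<partial>M)"
      by (rule LIMSEQ_le_const) (use I_le[OF min[OF vG h]] in auto)
    moreover have "integrable M (\<lambda>x. min (u x) (h x))"
      by (rule integrable_dominated_convergence[OF _ _ integrable_norm[OF int[OF h]] AE1 AE2]) measurable
    ultimately show ?thesis
      by simp
  qed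
  have uv0: "AE x in M. min (u x) (v n x) = u x" for n
    using u_le_v by eventually_elim (auto simp: min_def)
  have u_int: "integrable M u"
    using min_int[OF vG[of 0]] uv0[of 0] by (subst integrable_cong_AE[where g="\<lambda>x. min (u x) (v 0 x)"]) auto
  have "(\<integral>x. u x \<partial>M) \<le> I + 1 / real (Suc n)" for n
  proof -
    have "(\<integral>x. u x \<partial>M) \<le> (\<integral>x. g n x \<partial>M)"
      using u_le_v by (intro integral_mono_AE u_int int g) (auto elim!: eventually_mono intro: order_trans[OF _ v_le])
    then show ?thesis
      using g(2)[of n] by linarith
  qed
  then have u_I: "(\<integral>x. u x \<partial>M) \<le> I"
    using LIMSEQ_le_const[OF tendsto_add[OF tendsto_const LIMSEQ_inverse_real_of_nat], of "\<integral>x. u x \<partial>M" I]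
    by (simp add: inverse_eq_divide)
  have "AE x in M. u x \<le> h x" if h: "h \<in> G" for h
  proof -
    have "integrable M (\<lambda>x. u x - min (u x) (h x))"
      using u_int min_int[OF h] by simp
    moreover have "(\<integral>x. u x - min (u x) (h x) \<partial>M) = 0"
    proof (rule antisym)
      show "(\<integral>x. u x - min (u x) (h x) \<partial>M) \<le> 0"
        using u_int min_int[OF h] u_I by simp
      show "0 \<le> (\<integral>x. u x - min (u x) (h x) \<partial>M)"
        by (rule integral_nonneg_AE) simp
    qed
    ultimately have "AE x in M. u x - min (u x) (h x) = 0"
      by (subst (asm) integral_nonneg_eq_0_iff_AE) auto
    then show ?thesis
      by eventually_elim (simp add: min_def split: if_splits)
  qed
  moreover have "AE x in M. w x \<le> u x" if "w \<in> borel_measurable M" "\<forall>g\<in>G. AE x in M. w x \<le> g x" for w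
  proof -
    have "AE x in M. \<forall>n. w x \<le> v n x"
      using that(2) vG by (simp add: AE_all_countable)
    with lim show ?thesis
      by eventually_elim (rule LIMSEQ_le_const, auto)
  qed
  ultimately show ?thesis
    unfolding is_ess_Inf_def by (intro exI[of _ u]) auto
qed

text \<open>A neighbourhood \<open>U\<close> that witnesses a slope below \<open>c\<close> at one
  point serves all of its points, so the slope is upper semicontinuous.\<close>

lemma borel_measurable_asymptotic_slope [measurable]:
  fixes d :: "'a::topological_space \<Rightarrow> 'a \<Rightarrow> ennreal"
  shows "asymptotic_slope d f \<in> borel_measurable borel"
proof (rule borel_measurableI_less)
  fix c
  have "open {x. asymptotic_slope d f x < c}"
  proof (subst open_subopen, intro ballI)
    fix x assume "x \<in> {x. asymptotic_slope d f x < c}"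
    then obtain U where U: "open U" "x \<in> U" "Lip d U f < c"
      unfolding asymptotic_slope_def by (auto simp: INF_less_iff)
    have "U \<subseteq> {x. asymptotic_slope d f x < c}"
      using U unfolding asymptotic_slope_def by (auto simp: INF_less_iff)
    then show "\<exists>T. open T \<and> x \<in> T \<and> T \<subseteq> {x. asymptotic_slope d f x < c}"
      using U by blast
  qed
  then show "{x \<in> space borel. asymptotic_slope d f x < c} \<in> sets borel"
    by simp
qed

lemma asymptotic_slope_le_Lip: "asymptotic_slope d f x \<le> Lip d UNIV f"
  unfolding asymptotic_slope_def by (rule INF_lower) simp

section \<open>The derivation induced by a test plan\<close>

context radon_plan
begin

lemma nn_integral_occupation:
  assumes [measurable]: "g \<in> borel_measurable borel"
  shows "(\<integral>\<^sup>+x. g x \<partial>occupation) = (\<integral>\<^sup>+p. arc_length d (fst p) * g (ehat d p) \<partial>P)"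
proof -
  have "(\<integral>\<^sup>+x. g x \<partial>occupation) = (\<integral>\<^sup>+p. g (ehat d p) \<partial>length_hat)"
    unfolding occupation_def by (rule nn_integral_distr) measurable
  also have "\<dots> = (\<integral>\<^sup>+p. arc_length d (fst p) * g (ehat d p) \<partial>P)"
    unfolding length_hat_def by (rule nn_integral_density) measurable
  finally show ?thesis .
qed

lemma length_hat_real: "length_hat = density P (\<lambda>p. ennreal (enn2real (arc_length d (fst p))))"
  unfolding length_hat_def
proof (intro density_cong AE_I2)
  fix p assume "p \<in> space P"
  then have "fst p \<in> RA d"
    by (auto simp: space_pair_measure space_plan)
  then show "arc_length d (fst p) = ennreal (enn2real (arc_length d (fst p)))"
    using arc_rep_props(1)[OF d] by simp
qed measurable

text \<open>With the length as weight, the inner integral in Fubini's theorem is the integral along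
  the arc.\<close>

lemma integral_occupation:
  assumes [measurable]: "f \<in> borel_measurable borel" and C: "\<And>x. \<bar>f x\<bar> \<le> C"
  shows "(\<integral>x. f x \<partial>occupation) = (\<integral>\<Gamma>. arc_integral d \<Gamma> f \<partial>completion \<pi>)"
proof -
  define F where "F p = enn2real (arc_length d (fst p)) * f (ehat d p)" for p
  have [measurable]: "F \<in> borel_measurable P"
    unfolding F_def by measurable
  have "integrable length_hat (\<lambda>p. f (ehat d p))"
    using C by (intro length_hat.integrable_const_bound[where B=C]) (auto intro!: AE_I2)
  then have F: "integrable P F"
    unfolding length_hat_real F_def by (subst (asm) integrable_density) auto
  have "(\<integral>x. f x \<partial>occupation) = (\<integral>p. f (ehat d p) \<partial>length_hat)"
    unfolding occupation_def by (rule integral_distr) measurable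
  also have "\<dots> = (\<integral>p. F p \<partial>P)"
    unfolding length_hat_real F_def by (subst integral_density) auto
  also have "\<dots> = (\<integral>\<Gamma>. \<integral>t. F (\<Gamma>, t) \<partial>unit_interval \<partial>\<pi>)"
    by (rule P.integral_fst'[OF F, symmetric])
  also have "(\<lambda>\<Gamma>. \<integral>t. F (\<Gamma>, t) \<partial>unit_interval) = (\<lambda>\<Gamma>. arc_integral d \<Gamma> f)"
    unfolding F_def arc_integral_def ehat_def
    by (simp add: integral_restrict_space set_lebesgue_integral_def)
  also have "(\<integral>\<Gamma>. arc_integral d \<Gamma> f \<partial>\<pi>) = (\<integral>\<Gamma>. arc_integral d \<Gamma> f \<partial>completion \<pi>)"
  proof (rule integral_completion[symmetric])
    have "(\<lambda>\<Gamma>. \<integral>t. F (\<Gamma>, t) \<partial>unit_interval) \<in> borel_measurable \<pi>"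
      by (rule I.borel_measurable_lebesgue_integral) measurable
    also have "(\<lambda>\<Gamma>. \<integral>t. F (\<Gamma>, t) \<partial>unit_interval) = (\<lambda>\<Gamma>. arc_integral d \<Gamma> f)"
      unfolding F_def arc_integral_def ehat_def
      by (simp add: integral_restrict_space set_lebesgue_integral_def)
    finally show "(\<lambda>\<Gamma>. arc_integral d \<Gamma> f) \<in> borel_measurable \<pi>" .
  qed
  finally show ?thesis .
qed

text \<open>\<open>barycenter\<close> is a definite description: existence rests on the inner
  regularity of the occupation measure, and uniqueness follows by testing with indicators of Borel
  sets.\<close>

lemma barycenter_eq: "barycenter d \<pi> = occupation"
  unfolding barycenter_def
proof (rule the_equality)
  show "occupation \<in> radon_measures euclidean \<and> (\<forall>f\<in>borel_measurable borel. bounded (range f) \<longrightarrow>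
      (\<integral>x. f x \<partial>occupation) = (\<integral>\<Gamma>. arc_integral d \<Gamma> f \<partial>completion \<pi>))"
    using occupation_radon integral_occupation by (auto simp: bounded_iff)
next
  fix \<mu> assume \<mu>: "\<mu> \<in> radon_measures euclidean \<and> (\<forall>f\<in>borel_measurable borel. bounded (range f) \<longrightarrow>
      (\<integral>x. f x \<partial>\<mu>) = (\<integral>\<Gamma>. arc_integral d \<Gamma> f \<partial>completion \<pi>))"
  then have sets: "sets \<mu> = sets borel" and "finite_measure \<mu>"
    unfolding radon_measures_def sets_borel by auto
  interpret \<mu>: finite_measure \<mu> by fact
  show "\<mu> = occupation"
  proof (rule measure_eqI)
    show "sets \<mu> = sets occupation"
      by (simp add: sets sets_occupation)
    fix B assume "B \<in> sets \<mu>"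
    then have B: "B \<in> sets borel" "B \<in> sets \<mu>" "B \<in> sets occupation"
      by (simp_all add: sets sets_occupation)
    have "bounded (range (indicator B :: 'a \<Rightarrow> real))"
      unfolding bounded_iff by (intro exI[of _ 1]) (auto simp: indicator_def)
    then have "(\<integral>x. indicator B x \<partial>\<mu>) = (\<integral>\<Gamma>. arc_integral d \<Gamma> (indicator B) \<partial>completion \<pi>)"
      using \<mu> B(1) by (auto intro: borel_measurable_indicator)
    also have "\<dots> = (\<integral>x. indicator B x \<partial>occupation)"
      using B(1) by (intro integral_occupation[symmetric, where C=1]) (auto simp: indicator_def)
    finally have "measure \<mu> B = measure occupation B"
      using B by simp
    then show "emeasure \<mu> B = emeasure occupation B"
      by (simp add: \<mu>.emeasure_eq_measure occ.emeasure_eq_measure)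
  qed
qed

lemma endpoint_law_eq:
  assumes "t \<in> {0..1}"
  shows "endpoint_law d \<pi> t = distr \<pi> borel (\<lambda>\<Gamma>. arc_rep d \<Gamma> t)"
  unfolding endpoint_law_def ehat_def prod.case by (rule distr_completion[OF measurable_arc_rep[OF assms]])

lemma push_weighted_eq:
  assumes "w \<in> borel_measurable P"
  shows "push_weighted d \<pi> w = distr (density P (\<lambda>p. ennreal (w p))) borel (ehat d)"
  unfolding push_weighted_def plan_hat_def
  by (rule distr_density_completion) (use assms in measurable)

lemma nn_integral_push_weighted:
  assumes [measurable]: "w \<in> borel_measurable P" "g \<in> borel_measurable borel"
  shows "(\<integral>\<^sup>+x. g x \<partial>push_weighted d \<pi> w) = (\<integral>\<^sup>+p. ennreal (w p) * g (ehat d p) \<partial>P)"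
  unfolding push_weighted_eq[OF assms(1)]
  by (subst nn_integral_distr, measurable) (subst nn_integral_density, auto)

lemma AE_Dupper_le_slope_P:
  assumes f: "f \<in> Lipb d"
  shows "AE p in P. ennreal \<bar>Dupper d f p\<bar> \<le> arc_length d (fst p) * asymptotic_slope d f (ehat d p)"
proof (rule P.AE_pair_measure)
  note [measurable] = measurable_Dupper_Lipb[OF f]
  show "{p \<in> space P. ennreal \<bar>Dupper d f p\<bar> \<le> arc_length d (fst p) * asymptotic_slope d f (ehat d p)} \<in> sets P"
    by measurable
  show "AE \<Gamma> in \<pi>. AE t in unit_interval.
      ennreal \<bar>Dupper d f (\<Gamma>, t)\<bar> \<le> arc_length d (fst (\<Gamma>, t)) * asymptotic_slope d f (ehat d (\<Gamma>, t))"
    using AE_Dupper_le_slope[OF f] by simp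
qed

text \<open>The slope bound transfers the integral to the occupation measure, which is finite
  because the plan has finite total length.\<close>

lemma integrable_Dupper:
  assumes f: "f \<in> Lipb d"
  shows "integrable P (Dupper d f)"
proof (rule integrableI_bounded)
  show [measurable]: "Dupper d f \<in> borel_measurable P"
    by (rule measurable_Dupper_Lipb[OF f])
  have "(\<integral>\<^sup>+p. ennreal (norm (Dupper d f p)) \<partial>P) \<le> (\<integral>\<^sup>+p. arc_length d (fst p) * asymptotic_slope d f (ehat d p) \<partial>P)"
    using AE_Dupper_le_slope_P[OF f] by (intro nn_integral_mono_AE) simp
  also have "\<dots> = (\<integral>\<^sup>+x. asymptotic_slope d f x \<partial>occupation)"
    by (rule nn_integral_occupation[symmetric]) measurable
  also have "\<dots> \<le> (\<integral>\<^sup>+x. Lip d UNIV f \<partial>occupation)"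
    by (intro nn_integral_mono asymptotic_slope_le_Lip)
  also have "\<dots> < \<infinity>"
    using f occ.emeasure_finite[of "space occupation"]
    by (auto simp: Lipb_def ennreal_mult_eq_top_iff less_top[symmetric])
  finally show "(\<integral>\<^sup>+p. ennreal (norm (Dupper d f p)) \<partial>P) < \<infinity>" .
qed

text \<open>The weight is left general so that the positive and the negative part, each bounded by
  the absolute value of the derivative, are covered by one estimate.\<close>

lemma push_weighted_le_slope:
  assumes f: "f \<in> Lipb d" and [measurable]: "w \<in> borel_measurable P"
    and w: "\<And>p. \<bar>w p\<bar> \<le> \<bar>Dupper d f p\<bar>" and [measurable]: "B \<in> sets borel"
  shows "emeasure (push_weighted d \<pi> w) B \<le> (\<integral>\<^sup>+x. asymptotic_slope d f x * indicator B x \<partial>occupation)"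
proof -
  have s: "sets (push_weighted d \<pi> w) = sets borel"
    unfolding push_weighted_eq[OF assms(2)] by simp
  have "emeasure (push_weighted d \<pi> w) B = (\<integral>\<^sup>+x. indicator B x \<partial>push_weighted d \<pi> w)"
    using s by simp
  also have "\<dots> = (\<integral>\<^sup>+p. ennreal (w p) * indicator B (ehat d p) \<partial>P)"
    by (rule nn_integral_push_weighted) measurable
  also have "\<dots> \<le> (\<integral>\<^sup>+p. arc_length d (fst p) * (asymptotic_slope d f (ehat d p) * indicator B (ehat d p)) \<partial>P)"
  proof (rule nn_integral_mono_AE)
    show "AE p in P. ennreal (w p) * indicator B (ehat d p) \<le> arc_length d (fst p) * (asymptotic_slope d f (ehat d p) * indicator B (ehat d p))"
      using AE_Dupper_le_slope_P[OF f]
    proof eventually_elim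
      case (elim p)
      have "ennreal (w p) \<le> ennreal \<bar>Dupper d f p\<bar>"
        using w[of p] by (intro ennreal_leI) linarith
      also note elim
      finally show ?case
        unfolding mult.assoc[symmetric] by (rule mult_right_mono) simp
    qed
  qed
  also have "\<dots> = (\<integral>\<^sup>+x. asymptotic_slope d f x * indicator B x \<partial>occupation)"
    by (rule nn_integral_occupation[symmetric]) measurable
  finally show ?thesis .
qed

end

lemma Lipb_bounded:
  assumes "f \<in> Lipb d"
  obtains C where "\<And>x. \<bar>f x\<bar> \<le> C"
proof -
  obtain C where "\<forall>x\<in>range f. norm x \<le> C"
    using assms unfolding Lipb_def bounded_iff by auto
  then show thesis
    by (intro that[of C]) simp
qed

lemma Lipb_borel_measurable: "f \<in> Lipb d \<Longrightarrow> f \<in> borel_measurable borel"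
  unfolding Lipb_def by (simp add: borel_measurable_continuous_onI)

section \<open>The derivation of a test plan, its bound and its divergence\<close>

locale lipschitz_test_plan =
  fixes d :: "'a::t2_space \<Rightarrow> 'a \<Rightarrow> ennreal" and m :: "'a measure" and q :: real
    and \<pi> :: "(real \<Rightarrow> 'a) set measure"
  assumes mms: "ext_metric_top_measure_space d m" and q: "1 < q" and test: "\<pi> \<in> test_plans d m q"
begin

sublocale radon_plan d \<pi>
  using mms test unfolding ext_metric_top_measure_space_def test_plans_def by unfold_locales auto

lemma m_radon: "m \<in> radon_measures euclidean"
  using mms unfolding ext_metric_top_measure_space_def by simp

sublocale m: finite_measure m
  by (rule radon_measuresD(1)[OF m_radon])

lemma sets_m [measurable_cong]: "sets m = sets borel"
  using m_radon unfolding radon_measures_def sets_borel by auto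

abbreviation h :: "'a \<Rightarrow> real" where
  "h \<equiv> plan_density d m \<pi>"

lemma h: "h \<in> borel_measurable m" "0 \<le> h x" "density m (\<lambda>x. ennreal (h x)) = occupation" "h \<in> Lq m q"
proof -
  have "absolutely_continuous m (barycenter d \<pi>)" "h \<in> Lq m q"
    using test unfolding test_plans_def by auto
  then show "h \<in> borel_measurable m" "0 \<le> h x" "density m (\<lambda>x. ennreal (h x)) = occupation" "h \<in> Lq m q"
    using real_deriv_density[OF m.finite_measure_axioms occ.finite_measure_axioms]
    unfolding plan_density_def barycenter_eq by (auto simp: sets_occupation sets_m)
qed

text \<open>Domination on Borel sets by the density \<open>h\<close> times the slope gives absolute
  continuity at once, and the pointwise bound by comparing densities set by set. Finiteness comes
  from the integrability of the derivative and makes the real-valued density legitimate.\<close>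

lemma push_density:
  assumes f: "f \<in> Lipb d" and w: "w \<in> borel_measurable P" "\<And>p. 0 \<le> w p" "\<And>p. w p \<le> \<bar>Dupper d f p\<bar>"
  shows "absolutely_continuous m (push_weighted d \<pi> w)"
    and "finite_measure (push_weighted d \<pi> w)" and "sets (push_weighted d \<pi> w) = sets m"
    and "AE x in m. ennreal (real_deriv m (push_weighted d \<pi> w) x) \<le> ennreal (h x) * asymptotic_slope d f x"
proof -
  have [measurable]: "w \<in> borel_measurable P" "h \<in> borel_measurable m"
    by (rule w, rule h)
  have w': "\<bar>w p\<bar> \<le> \<bar>Dupper d f p\<bar>" for p
    using w(2,3)[of p] by simp
  show s: "sets (push_weighted d \<pi> w) = sets m"
    unfolding push_weighted_eq[OF w(1)] by (simp add: sets_m)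
  have le: "emeasure (push_weighted d \<pi> w) B \<le> (\<integral>\<^sup>+x. ennreal (h x) * asymptotic_slope d f x * indicator B x \<partial>m)"
    if B: "B \<in> sets m" for B
  proof -
    have [measurable]: "B \<in> sets borel"
      using B by (simp add: sets_m)
    have "emeasure (push_weighted d \<pi> w) B \<le> (\<integral>\<^sup>+x. asymptotic_slope d f x * indicator B x \<partial>occupation)"
      by (rule push_weighted_le_slope[OF f w(1) w']) measurable
    also have "\<dots> = (\<integral>\<^sup>+x. ennreal (h x) * asymptotic_slope d f x * indicator B x \<partial>m)"
      unfolding h(3)[symmetric] by (subst nn_integral_density) (auto simp: mult.assoc)
    finally show ?thesis .
  qed
  show ac: "absolutely_continuous m (push_weighted d \<pi> w)"
    unfolding absolutely_continuous_def
  proof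
    fix B assume B: "B \<in> null_sets m"
    have [measurable]: "B \<in> sets m"
      using B by auto
    have "(\<integral>\<^sup>+x. ennreal (h x) * asymptotic_slope d f x * indicator B x \<partial>m) = 0"
      using B by (subst nn_integral_0_iff_AE) (auto dest!: AE_not_in elim!: eventually_mono)
    then show "B \<in> null_sets (push_weighted d \<pi> w)"
      using le[of B] s by (intro null_setsI) auto
  qed
  show fin: "finite_measure (push_weighted d \<pi> w)"
  proof (rule finite_measureI)
    have "emeasure (push_weighted d \<pi> w) UNIV = (\<integral>\<^sup>+x. 1 \<partial>push_weighted d \<pi> w)"
      using sets_eq_imp_space_eq[OF s] sets_eq_imp_space_eq[OF sets_m] by (simp add: nn_integral_const)
    also have "\<dots> = (\<integral>\<^sup>+p. ennreal (w p) * 1 \<partial>P)"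
      by (rule nn_integral_push_weighted) measurable
    also have "\<dots> \<le> (\<integral>\<^sup>+p. ennreal (norm (Dupper d f p)) \<partial>P)"
      using w(3) by (intro nn_integral_mono) (auto intro: ennreal_leI)
    also have "\<dots> < \<infinity>"
      using integrable_Dupper[OF f] by (simp add: integrable_iff_bounded)
    finally show "emeasure (push_weighted d \<pi> w) (space (push_weighted d \<pi> w)) \<noteq> \<infinity>"
      using sets_eq_imp_space_eq[OF s] sets_eq_imp_space_eq[OF sets_m] by simp
  qed
  note r = real_deriv_density[OF m.finite_measure_axioms fin s ac]
  note [measurable] = r(1)
  show "AE x in m. ennreal (real_deriv m (push_weighted d \<pi> w) x) \<le> ennreal (h x) * asymptotic_slope d f x"
  proof (rule AE_le_if_set_nn_integral_le)
    have "(\<integral>\<^sup>+x. ennreal (real_deriv m (push_weighted d \<pi> w) x) \<partial>m) = ennreal (\<integral>x. real_deriv m (push_weighted d \<pi> w) x \<partial>m)"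
      using r(2,4) by (intro nn_integral_eq_integral) auto
    then show "(\<integral>\<^sup>+x. ennreal (real_deriv m (push_weighted d \<pi> w) x) \<partial>m) < \<infinity>"
      by simp
    show "(\<integral>\<^sup>+x. ennreal (real_deriv m (push_weighted d \<pi> w) x) * indicator B x \<partial>m)
        \<le> (\<integral>\<^sup>+x. ennreal (h x) * asymptotic_slope d f x * indicator B x \<partial>m)" if B: "B \<in> sets m" for B
    proof -
      have "(\<integral>\<^sup>+x. ennreal (real_deriv m (push_weighted d \<pi> w) x) * indicator B x \<partial>m)
          = emeasure (density m (\<lambda>x. ennreal (real_deriv m (push_weighted d \<pi> w) x))) B"
        using B by (subst emeasure_density) auto
      then show ?thesis
        unfolding r(3) using le[OF B] by simp
    qed
  qed measurable
qed

abbreviation b :: "('a \<Rightarrow> real) \<Rightarrow> 'a \<Rightarrow> real" where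
  "b \<equiv> plan_derivation d m \<pi>"

lemma push_Dpos_density:
  assumes f: "f \<in> Lipb d"
  shows "absolutely_continuous m (push_Dpos d \<pi> f)" "finite_measure (push_Dpos d \<pi> f)"
    "sets (push_Dpos d \<pi> f) = sets m"
    "AE x in m. ennreal (real_deriv m (push_Dpos d \<pi> f) x) \<le> ennreal (h x) * asymptotic_slope d f x"
proof -
  have w: "(\<lambda>p. max 0 (Dupper d f p)) \<in> borel_measurable P"
    using measurable_Dupper_Lipb[OF f] by measurable
  show "absolutely_continuous m (push_Dpos d \<pi> f)" "finite_measure (push_Dpos d \<pi> f)"
    "sets (push_Dpos d \<pi> f) = sets m"
    "AE x in m. ennreal (real_deriv m (push_Dpos d \<pi> f) x) \<le> ennreal (h x) * asymptotic_slope d f x"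
    unfolding push_Dpos_def by (rule push_density[OF f w]; simp)+
qed

lemma push_Dneg_density:
  assumes f: "f \<in> Lipb d"
  shows "absolutely_continuous m (push_Dneg d \<pi> f)" "finite_measure (push_Dneg d \<pi> f)"
    "sets (push_Dneg d \<pi> f) = sets m"
    "AE x in m. ennreal (real_deriv m (push_Dneg d \<pi> f) x) \<le> ennreal (h x) * asymptotic_slope d f x"
proof -
  have w: "(\<lambda>p. max 0 (- Dupper d f p)) \<in> borel_measurable P"
    using measurable_Dupper_Lipb[OF f] by measurable
  show "absolutely_continuous m (push_Dneg d \<pi> f)" "finite_measure (push_Dneg d \<pi> f)"
    "sets (push_Dneg d \<pi> f) = sets m"
    "AE x in m. ennreal (real_deriv m (push_Dneg d \<pi> f) x) \<le> ennreal (h x) * asymptotic_slope d f x"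
    unfolding push_Dneg_def by (rule push_density[OF f w]; simp)+
qed

lemma measurable_b: "f \<in> Lipb d \<Longrightarrow> b f \<in> borel_measurable m"
  unfolding plan_derivation_def
  using real_deriv_density(1)[OF m.finite_measure_axioms push_Dpos_density(2,3,1)]
    real_deriv_density(1)[OF m.finite_measure_axioms push_Dneg_density(2,3,1)]
  by (intro borel_measurable_diff)

text \<open>Both densities are nonnegative and obey the same bound, so their difference is bounded
  by the larger one instead of the sum. This is the source of the constant 1 in the bound by
  \<open>h\<close>.\<close>

lemma b_le_slope:
  assumes f: "f \<in> Lipb d"
  shows "AE x in m. ennreal \<bar>b f x\<bar> \<le> ennreal (h x) * asymptotic_slope d f x"
  using push_Dpos_density(4)[OF f] push_Dneg_density(4)[OF f]
proof eventually_elim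
  case (elim x)
  have nn: "0 \<le> real_deriv m (push_Dpos d \<pi> f) x" "0 \<le> real_deriv m (push_Dneg d \<pi> f) x"
    by (simp_all add: real_deriv_def)
  then have "\<bar>b f x\<bar> \<le> max (real_deriv m (push_Dpos d \<pi> f) x) (real_deriv m (push_Dneg d \<pi> f) x)"
    unfolding plan_derivation_def by linarith
  then have "ennreal \<bar>b f x\<bar> \<le> max (ennreal (real_deriv m (push_Dpos d \<pi> f) x)) (ennreal (real_deriv m (push_Dneg d \<pi> f) x))"
    using nn by (auto simp: max_def ennreal_le_iff split: if_splits)
  then show ?case
    using elim by (meson max.boundedI order_trans)
qed

text \<open>The slope never exceeds the global Lipschitz constant, so \<open>b f\<close> is
  dominated by a multiple of \<open>h\<close>.\<close>

lemma b_Lq: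
  assumes f: "f \<in> Lipb d"
  shows "b f \<in> Lq m q"
proof (rule Lq_dominated[OF h(4) _ measurable_b[OF f]])
  define L where "L = enn2real (Lip d UNIV f)"
  have L: "Lip d UNIV f = ennreal L" "0 \<le> L"
    using f unfolding L_def Lipb_def by simp_all
  show "AE x in m. \<bar>b f x\<bar> \<le> L * \<bar>h x\<bar>"
    using b_le_slope[OF f]
  proof eventually_elim
    case (elim x)
    also have "ennreal (h x) * asymptotic_slope d f x \<le> ennreal (h x) * ennreal L"
      unfolding L(1)[symmetric] by (intro mult_left_mono asymptotic_slope_le_Lip) simp
    also have "\<dots> = ennreal (L * \<bar>h x\<bar>)"
      using h(2)[of x] L(2) by (simp add: ennreal_mult[symmetric] mult.commute)
    finally show ?case
      using L(2) by (simp add: ennreal_le_iff)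
  qed
  show "0 \<le> L"
    by (rule L)
qed (use q in simp)

lemma integrable_b: "f \<in> Lipb d \<Longrightarrow> integrable m (b f)"
  using Lq_integrable[OF m.finite_measure_axioms b_Lq] q by simp

text \<open>Change of variables for the signed push-forward, with a bounded Borel test function.
  Each part is finite, so the parts may be integrated separately and then subtracted.\<close>

lemma integral_mult_b:
  assumes f: "f \<in> Lipb d" and \<phi>: "\<phi> \<in> borel_measurable borel" "\<And>x. \<bar>\<phi> x\<bar> \<le> C"
  shows "integrable m (\<lambda>x. \<phi> x * b f x)"
    and "integrable P (\<lambda>p. \<phi> (ehat d p) * Dupper d f p)"
    and "(\<integral>x. \<phi> x * b f x \<partial>m) = (\<integral>p. \<phi> (ehat d p) * Dupper d f p \<partial>P)"
proof -
  note [measurable] = \<phi>(1) measurable_Dupper_Lipb[OF f]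
  have \<phi>m: "\<phi> \<in> borel_measurable m"
    by measurable
  have int: "integrable P (\<lambda>p. u p * \<phi> (ehat d p))" and eq: "(\<integral>x. \<phi> x \<partial>push_weighted d \<pi> u) = (\<integral>p. u p * \<phi> (ehat d p) \<partial>P)"
    if [measurable]: "u \<in> borel_measurable P" and u: "\<And>p. 0 \<le> u p" "\<And>p. u p \<le> \<bar>Dupper d f p\<bar>" for u
  proof -
    show "integrable P (\<lambda>p. u p * \<phi> (ehat d p))"
    proof (rule Bochner_Integration.integrable_bound)
      show "integrable P (\<lambda>p. C * \<bar>Dupper d f p\<bar>)"
        using integrable_Dupper[OF f] by simp
      show "AE p in P. norm (u p * \<phi> (ehat d p)) \<le> norm (C * \<bar>Dupper d f p\<bar>)"
      proof (rule AE_I2)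
        fix p
        have "\<bar>u p\<bar> * \<bar>\<phi> (ehat d p)\<bar> \<le> \<bar>Dupper d f p\<bar> * \<bar>C\<bar>"
          using u[of p] by (intro mult_mono order_trans[OF \<phi>(2) abs_ge_self]) auto
        then show "norm (u p * \<phi> (ehat d p)) \<le> norm (C * \<bar>Dupper d f p\<bar>)"
          by (simp add: abs_mult mult.commute)
      qed
    qed measurable
    have "(\<integral>x. \<phi> x \<partial>push_weighted d \<pi> u) = (\<integral>p. \<phi> (ehat d p) \<partial>density P (\<lambda>p. ennreal (u p)))"
      unfolding push_weighted_eq[OF that(1)] by (rule integral_distr) measurable
    also have "\<dots> = (\<integral>p. u p * \<phi> (ehat d p) \<partial>P)"
      using u(1) by (subst integral_density) auto
    finally show "(\<integral>x. \<phi> x \<partial>push_weighted d \<pi> u) = (\<integral>p. u p * \<phi> (ehat d p) \<partial>P)" .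
  qed
  have pos: "integrable P (\<lambda>p. max 0 (Dupper d f p) * \<phi> (ehat d p))"
    "(\<integral>x. \<phi> x \<partial>push_Dpos d \<pi> f) = (\<integral>p. max 0 (Dupper d f p) * \<phi> (ehat d p) \<partial>P)"
    unfolding push_Dpos_def by (rule int eq; auto)+
  have neg: "integrable P (\<lambda>p. max 0 (- Dupper d f p) * \<phi> (ehat d p))"
    "(\<integral>x. \<phi> x \<partial>push_Dneg d \<pi> f) = (\<integral>p. max 0 (- Dupper d f p) * \<phi> (ehat d p) \<partial>P)"
    unfolding push_Dneg_def by (rule int eq; auto)+
  note rpos = real_deriv_integral[OF m.finite_measure_axioms push_Dpos_density(2,3,1)[OF f] \<phi>m \<phi>(2)]
  note rneg = real_deriv_integral[OF m.finite_measure_axioms push_Dneg_density(2,3,1)[OF f] \<phi>m \<phi>(2)]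
  have split: "\<phi> (ehat d p) * Dupper d f p = max 0 (Dupper d f p) * \<phi> (ehat d p) - max 0 (- Dupper d f p) * \<phi> (ehat d p)" for p
    by (auto simp: max_def)
  show "integrable m (\<lambda>x. \<phi> x * b f x)"
    unfolding plan_derivation_def right_diff_distrib by (intro Bochner_Integration.integrable_diff rpos rneg)
  show "integrable P (\<lambda>p. \<phi> (ehat d p) * Dupper d f p)"
    unfolding split by (intro Bochner_Integration.integrable_diff pos neg)
  show "(\<integral>x. \<phi> x * b f x \<partial>m) = (\<integral>p. \<phi> (ehat d p) * Dupper d f p \<partial>P)"
    unfolding plan_derivation_def right_diff_distrib split
    using rpos rneg pos neg by (simp add: Bochner_Integration.integral_diff)
qed

text \<open>An identity between densities of push-forwards follows from the corresponding identity
  between derivatives along arcs, by testing against indicators of Borel sets.\<close>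

lemma b_linear_combination:
  assumes f: "f \<in> Lipb d" and g: "g \<in> Lipb d" and k: "k \<in> Lipb d"
    and \<alpha>: "\<alpha> \<in> borel_measurable borel" "\<And>x. \<bar>\<alpha> x\<bar> \<le> A"
    and \<beta>: "\<beta> \<in> borel_measurable borel" "\<And>x. \<bar>\<beta> x\<bar> \<le> B"
    and D: "AE p in P. Dupper d k p = \<alpha> (ehat d p) * Dupper d f p + \<beta> (ehat d p) * Dupper d g p"
  shows "AE x in m. b k x = \<alpha> x * b f x + \<beta> x * b g x"
proof (rule density_unique_real)
  show "integrable m (b k)"
    by (rule integrable_b[OF k])
  show "integrable m (\<lambda>x. \<alpha> x * b f x + \<beta> x * b g x)"
    by (intro Bochner_Integration.integrable_add integral_mult_b(1)[OF f \<alpha>] integral_mult_b(1)[OF g \<beta>])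
  fix S assume "S \<in> sets m"
  then have [measurable]: "S \<in> sets borel"
    by (simp add: sets_m)
  note [measurable] = \<alpha>(1) \<beta>(1) measurable_Dupper_Lipb[OF f] measurable_Dupper_Lipb[OF g] measurable_Dupper_Lipb[OF k]
  have ind: "\<bar>indicator S x\<bar> \<le> (1::real)" for x
    by (simp add: indicator_def)
  have \<alpha>S: "\<bar>indicator S x * \<alpha> x\<bar> \<le> A" for x
    using \<alpha>(2)[of x] by (auto simp: indicator_def)
  have \<beta>S: "\<bar>indicator S x * \<beta> x\<bar> \<le> B" for x
    using \<beta>(2)[of x] by (auto simp: indicator_def)
  note K = integral_mult_b[OF k _ ind, simplified]
  have mA: "(\<lambda>x. indicator S x * \<alpha> x) \<in> borel_measurable borel" and mB: "(\<lambda>x. indicator S x * \<beta> x) \<in> borel_measurable borel"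
    by measurable
  note F = integral_mult_b[OF f mA \<alpha>S] and G = integral_mult_b[OF g mB \<beta>S]
  have "(\<integral>x\<in>S. b k x \<partial>m) = (\<integral>x. indicator S x * b k x \<partial>m)"
    by (simp add: set_lebesgue_integral_def)
  also have "\<dots> = (\<integral>p. indicator S (ehat d p) * Dupper d k p \<partial>P)"
    by (rule integral_mult_b(3)[OF k _ ind]) measurable
  also have "\<dots> = (\<integral>p. indicator S (ehat d p) * \<alpha> (ehat d p) * Dupper d f p + indicator S (ehat d p) * \<beta> (ehat d p) * Dupper d g p \<partial>P)"
  proof (rule integral_cong_AE)
    show "AE p in P. indicator S (ehat d p) * Dupper d k p =
        indicator S (ehat d p) * \<alpha> (ehat d p) * Dupper d f p + indicator S (ehat d p) * \<beta> (ehat d p) * Dupper d g p"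
      using D by eventually_elim (simp add: algebra_simps)
  qed measurable
  also have "\<dots> = (\<integral>x. indicator S x * \<alpha> x * b f x \<partial>m) + (\<integral>x. indicator S x * \<beta> x * b g x \<partial>m)"
    unfolding F(3) G(3) by (rule Bochner_Integration.integral_add[OF F(2) G(2)])
  also have "\<dots> = (\<integral>x. indicator S x * \<alpha> x * b f x + indicator S x * \<beta> x * b g x \<partial>m)"
    by (rule Bochner_Integration.integral_add[OF F(1) G(1), symmetric])
  also have "\<dots> = (\<integral>x\<in>S. \<alpha> x * b f x + \<beta> x * b g x \<partial>m)"
    by (simp add: set_lebesgue_integral_def algebra_simps)
  finally show "(\<integral>x\<in>S. b k x \<partial>m) = (\<integral>x\<in>S. \<alpha> x * b f x + \<beta> x * b g x \<partial>m)" .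
qed

lemma b_derivation: "lipschitz_derivation d m b"
  unfolding lipschitz_derivation_def
proof (intro conjI ballI allI)
  fix f assume f: "f \<in> Lipb d"
  show "b f \<in> borel_measurable m"
    by (rule measurable_b[OF f])
  obtain A where A: "\<And>x. \<bar>f x\<bar> \<le> A"
    by (rule Lipb_bounded[OF f]) (rule that)
  have fb: "f \<in> borel_measurable borel"
    by (rule Lipb_borel_measurable[OF f])
  show "AE x in m. b (\<lambda>y. c * f y) x = c * b f x" for c
    using b_linear_combination[OF f f Lipb_cmult[OF d f], of "\<lambda>_. c" "\<bar>c\<bar>" "\<lambda>_. 0" 0 c]
      AE_derivative_rules(2)[OF f f, of c] by simp
  fix g assume g: "g \<in> Lipb d"
  obtain B where B: "\<And>x. \<bar>g x\<bar> \<le> B"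
    by (rule Lipb_bounded[OF g]) (rule that)
  have gb: "g \<in> borel_measurable borel"
    by (rule Lipb_borel_measurable[OF g])
  show "AE x in m. b (\<lambda>y. f y + g y) x = b f x + b g x"
    using b_linear_combination[OF f g Lipb_add[OF d f g], of "\<lambda>_. 1" 1 "\<lambda>_. 1" 1]
      AE_derivative_rules(1)[OF f g] by simp
  show "AE x in m. b (\<lambda>y. f y * g y) x = f x * b g x + g x * b f x"
    \<comment> \<open>\<open>f\<close> and \<open>g\<close> enter in exchanged order: the
      coefficient \<open>f\<close> belongs to the derivative of \<open>g\<close>.\<close>
    by (rule b_linear_combination[OF g f Lipb_mult[OF d f g] fb A gb B AE_derivative_rules(3)[OF f g]])
qed

abbreviation v :: "'a \<Rightarrow> real" where
  "v \<equiv> \<lambda>x. real_deriv m (endpoint_law d \<pi> 0) x - real_deriv m (endpoint_law d \<pi> 1) x"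

lemma endpoint:
  assumes "t \<in> {0, 1}"
  shows "finite_measure (endpoint_law d \<pi> t)" "sets (endpoint_law d \<pi> t) = sets m"
    "absolutely_continuous m (endpoint_law d \<pi> t)" "real_deriv m (endpoint_law d \<pi> t) \<in> Lq m q"
proof -
  have t: "t \<in> {0..1}"
    using assms by auto
  show "finite_measure (endpoint_law d \<pi> t)"
    unfolding endpoint_law_eq[OF t] by (rule finite_measure_distr[OF measurable_arc_rep[OF t]])
  show "sets (endpoint_law d \<pi> t) = sets m"
    unfolding endpoint_law_eq[OF t] by (simp add: sets_m)
  show "absolutely_continuous m (endpoint_law d \<pi> t)" "real_deriv m (endpoint_law d \<pi> t) \<in> Lq m q"
    using test assms unfolding test_plans_def by auto
qed

lemma v_Lq: "v \<in> Lq m q"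
  using endpoint(4)[of 0] endpoint(4)[of 1] q by (intro Lq_diff) auto

text \<open>Integration over each arc leaves \<open>f\<close> at the end minus \<open>f\<close> at
  the start; the minus sign in the definition of the divergence turns this into the start density
  minus the end density.\<close>

lemma b_divergence: "has_divergence d m b v"
  unfolding has_divergence_def
proof (intro conjI ballI)
  show "integrable m v"
    using Lq_integrable[OF m.finite_measure_axioms v_Lq] q by simp
  fix f assume f: "f \<in> Lipb d"
  show "integrable m (b f)"
    by (rule integrable_b[OF f])
  obtain C where C: "\<And>x. \<bar>f x\<bar> \<le> C"
    by (rule Lipb_bounded[OF f]) (rule that)
  have fb [measurable]: "f \<in> borel_measurable borel"
    by (rule Lipb_borel_measurable[OF f])
  have fm: "f \<in> borel_measurable m"
    by measurable
  have ends: "(\<integral>x. f x \<partial>endpoint_law d \<pi> t) = (\<integral>\<Gamma>. f (arc_rep d \<Gamma> t) \<partial>\<pi>)"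
    "integrable \<pi> (\<lambda>\<Gamma>. f (arc_rep d \<Gamma> t))" if "t \<in> {0..1}" for t
  proof -
    show "(\<integral>x. f x \<partial>endpoint_law d \<pi> t) = (\<integral>\<Gamma>. f (arc_rep d \<Gamma> t) \<partial>\<pi>)"
      unfolding endpoint_law_eq[OF that] by (rule integral_distr[OF measurable_arc_rep[OF that] fb])
    show "integrable \<pi> (\<lambda>\<Gamma>. f (arc_rep d \<Gamma> t))"
      using C measurable_compose[OF measurable_arc_rep[OF that] fb]
      by (intro integrable_const_bound[where B=C]) auto
  qed
  have "(\<integral>x. b f x \<partial>m) = (\<integral>p. Dupper d f p \<partial>P)"
    using integral_mult_b(3)[OF f, of "\<lambda>_. 1" 1] by simp
  also have "\<dots> = (\<integral>\<Gamma>. \<integral>t. Dupper d f (\<Gamma>, t) \<partial>unit_interval \<partial>\<pi>)"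
    by (rule P.integral_fst'[OF integrable_Dupper[OF f], symmetric])
  also have "\<dots> = (\<integral>\<Gamma>. f (arc_rep d \<Gamma> 1) - f (arc_rep d \<Gamma> 0) \<partial>\<pi>)"
    using AE_arc_derivative(2)[OF _ f] by (intro Bochner_Integration.integral_cong) (auto simp: space_plan)
  also have "\<dots> = (\<integral>x. f x \<partial>endpoint_law d \<pi> 1) - (\<integral>x. f x \<partial>endpoint_law d \<pi> 0)"
    using ends[of 0] ends[of 1] by simp
  also have "\<dots> = (\<integral>x. f x * real_deriv m (endpoint_law d \<pi> 1) x \<partial>m) - (\<integral>x. f x * real_deriv m (endpoint_law d \<pi> 0) x \<partial>m)"
    using real_deriv_integral(2)[OF m.finite_measure_axioms endpoint(1-3) fm C] by simp
  also have "\<dots> = - (\<integral>x. f x * v x \<partial>m)"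
    using real_deriv_integral(1)[OF m.finite_measure_axioms endpoint(1-3) fm C]
    by (simp add: right_diff_distrib)
  finally show "(\<integral>x. b f x \<partial>m) = - (\<integral>x. f x * v x \<partial>m)" .
qed

lemma h_der_bound: "h \<in> der_bounds d m q b"
  unfolding der_bounds_def using h(2,4) b_le_slope by auto

text \<open>At each point the minimum is one of the two bounds, so the inequality persists; closure
  under minima is what the construction of the essential infimum requires.\<close>

lemma der_bounds_min:
  assumes "g \<in> der_bounds d m q b" "k \<in> der_bounds d m q b"
  shows "(\<lambda>x. min (g x) (k x)) \<in> der_bounds d m q b"
proof -
  have g: "g \<in> Lq m q" "AE x in m. 0 \<le> g x" "\<And>f. f \<in> Lipb d \<Longrightarrow> AE x in m. ennreal \<bar>b f x\<bar> \<le> ennreal (g x) * asymptotic_slope d f x"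
    using assms(1) unfolding der_bounds_def by auto
  have k: "k \<in> Lq m q" "AE x in m. 0 \<le> k x" "\<And>f. f \<in> Lipb d \<Longrightarrow> AE x in m. ennreal \<bar>b f x\<bar> \<le> ennreal (k x) * asymptotic_slope d f x"
    using assms(2) unfolding der_bounds_def by auto
  have [measurable]: "g \<in> borel_measurable m" "k \<in> borel_measurable m"
    using g(1) k(1) unfolding Lq_def by auto
  have nn: "AE x in m. 0 \<le> min (g x) (k x)"
    using g(2) k(2) by eventually_elim simp
  have "(\<lambda>x. min (g x) (k x)) \<in> Lq m q"
  proof (rule Lq_dominated[OF g(1), where c=1])
    show "AE x in m. \<bar>min (g x) (k x)\<bar> \<le> 1 * \<bar>g x\<bar>"
      using g(2) k(2) by eventually_elim (simp add: min_def)
  qed (use q in auto)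
  moreover have "AE x in m. ennreal \<bar>b f x\<bar> \<le> ennreal (min (g x) (k x)) * asymptotic_slope d f x" if "f \<in> Lipb d" for f
    using g(3)[OF that] k(3)[OF that] by eventually_elim (simp add: min_def)
  ultimately show ?thesis
    unfolding der_bounds_def using nn by auto
qed

text \<open>\<open>der_norm\<close> is a choice, so it has no properties until some essential
  infimum is known to exist; being a lower bound, it then lies below the admissible
  \<open>h\<close>.\<close>

lemma der_norm_le: "AE x in m. der_norm d m q b x \<le> h x"
proof -
  have "\<exists>u. is_ess_Inf m (der_bounds d m q b) u"
  proof (rule ess_Inf_exists)
    show "der_bounds d m q b \<noteq> {}"
      using h_der_bound by blast
    show "integrable m g" if "g \<in> der_bounds d m q b" for g
      using that q Lq_integrable[OF m.finite_measure_axioms, of g q] unfolding der_bounds_def by simp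
    show "AE x in m. 0 \<le> g x" if "g \<in> der_bounds d m q b" for g
      using that unfolding der_bounds_def by simp
  qed (rule der_bounds_min)
  then have "is_ess_Inf m (der_bounds d m q b) (der_norm d m q b)"
    unfolding der_norm_def by (rule someI_ex)
  then show ?thesis
    using h_der_bound unfolding is_ess_Inf_def by blast
qed

lemma b_Der_div: "b \<in> Der_div d m q"
  unfolding Der_div_def Der_def using b_derivation h_der_bound v_Lq b_divergence by blast

end

theorem proposition5p8:
  fixes d :: "'a::t2_space \<Rightarrow> 'a \<Rightarrow> ennreal"
    and m :: "'a measure"
    and q :: real
    and \<pi> :: "(real \<Rightarrow> 'a) set measure"
  assumes "ext_metric_top_measure_space d m"
    and "1 < q"
    and "\<pi> \<in> test_plans d m q"
  shows "(\<forall>f\<in>Lipb d.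
            absolutely_continuous m (push_Dpos d \<pi> f) \<and>
            absolutely_continuous m (push_Dneg d \<pi> f) \<and>
            plan_derivation d m \<pi> f \<in> Lq m q) \<and>
         plan_derivation d m \<pi> \<in> Der_div d m q \<and>
         (AE x in m. der_norm d m q (plan_derivation d m \<pi>) x \<le> plan_density d m \<pi> x) \<and>
         has_divergence d m (plan_derivation d m \<pi>)
           (\<lambda>x. real_deriv m (endpoint_law d \<pi> 0) x - real_deriv m (endpoint_law d \<pi> 1) x)"
proof -
  interpret lipschitz_test_plan d m q \<pi>
    by unfold_locales (rule assms)+
  show ?thesis
    using push_Dpos_density(1) push_Dneg_density(1) b_Lq b_Der_div der_norm_le b_divergence by blast
qed

end
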